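(* Let $F:\mathbb{T}^d\times\mathbb{R}^d\to\mathbb{R}$ satisfy: $F$ is continuous with respect to both variables; there exist $\alpha>1$ and $c_F\ge 1$ such that $\frac{1}{c_F}|v|^\alpha-c_F\le F(x,v)\le c_F(1+|v|^\alpha)$ for all $(x,v)\in\mathbb{T}^d\times\mathbb{R}^d$; and $F(x,v)\ge 0$ for all $(x,v)\in\mathbb{T}^d\times\mathbb{R}^d$. Then, for every $(x,v)\in\mathbb{T}^d\times\mathbb{R}^d$, the limits $$\lim_{T\to+\infty}\frac1T V^T(0,x,v)=\lim_{T\to+\infty}\inf_{\gamma\in\Gamma_0(x,v)}\frac1T J^T(\gamma)$$ exist and are independent of $(x,v)$. Moreover, if in addition there exists $C_F\ge 0$ such that $|D_xF(x,v)|+|D_vF(x,v)|\le C_F(1+|v|^\alpha)$ for all $(x,v)\in\mathbb{T}^d\times\mathbb{R}^d$, then $$\lim_{T\to\infty}\frac1T V^T(0,x,v)=\inf_{\mu\in\mathcal{C}}\int_{\mathbb{T}^d\times\mathbb{R}^d\times\mathbb{R}^d}\Big(\frac12|w|^2+F(x,v)\Big)\,\mu(dx,dv,dw).$$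
   Context: The dimension $d\ge1$ is fixed and $\mathbb{T}^d$ is the flat torus. $\Gamma$ is the set of $C^1$ curves $\gamma:[0,+\infty)\to\mathbb{T}^d$, and $\Gamma_0(x,v)$ is the set of $\gamma\in\Gamma$ with $\gamma(0)=x$ and $\dot\gamma(0)=v$. For $T>0$ and $\gamma\in\Gamma$, $J^T(\gamma)=\int_0^T\big(\frac12|\ddot\gamma(s)|^2+F(\gamma(s),\dot\gamma(s))\big)ds$ if $\gamma\in H^2(0,T;\mathbb{T}^d)$ and $J^T(\gamma)=+\infty$ otherwise. The value function is $V^T(0,x,v)=\inf_{\gamma\in\Gamma_0(x,v)}J^T(\gamma)$. $\mathcal{P}_{\alpha,2}(\mathbb{T}^d\times\mathbb{R}^d\times\mathbb{R}^d)$ is the set of Borel probability measures $\mu$ on $\mathbb{T}^d\times\mathbb{R}^d\times\mathbb{R}^d$ with $\int(|w|^2+|v|^\alpha)\,\mu(dx,dv,dw)<+\infty$. A measure $\eta\in\mathcal{P}_{\alpha,2}(\mathbb{T}^d\times\mathbb{R}^d\times\mathbb{R}^d)$ is closed if $\int\big(\langle D_x\varphi(x,v),v\rangle+\langle D_v\varphi(x,v),w\rangle\big)\,\eta(dx,dv,dw)=0$ for every $\varphi\in C_c^\infty(\mathbb{T}^d\times\mathbb{R}^d)$; $\mathcal{C}$ denotes the set of closed measures. *)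

theory Defs
  imports "HOL-Probability.Probability"
begin

text \<open>The flat torus is \<open>\<real>\<^sup>d / \<int>\<^sup>d\<close> with the quotient topology.\<close>

quotient_type 'd torus = "real^'d::finite" / "\<lambda>x y. \<forall>i. x $ i - y $ i \<in> \<int>"
  morphisms rep_torus torus_of
proof (rule equivpI)
  show "reflp (\<lambda>x y::real^'d. \<forall>i. x $ i - y $ i \<in> \<int>)"
    by (auto simp: reflp_def)
  show "symp (\<lambda>x y::real^'d. \<forall>i. x $ i - y $ i \<in> \<int>)"
    by (auto simp: symp_def) (metis Ints_minus minus_diff_eq)
  show "transp (\<lambda>x y::real^'d. \<forall>i. x $ i - y $ i \<in> \<int>)"
  proof (rule transpI, intro allI)
    fix x y z :: "real^'d" and i
    assume "\<forall>i. x $ i - y $ i \<in> \<int>" "\<forall>i. y $ i - z $ i \<in> \<int>"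
    then have "(x $ i - y $ i) + (y $ i - z $ i) \<in> \<int>"
      by (intro Ints_add) auto
    then show "x $ i - z $ i \<in> \<int>" by simp
  qed
qed

lemma torus_of_eq_iff: "torus_of x = torus_of y \<longleftrightarrow> (\<forall>i. x $ i - y $ i \<in> \<int>)"
  by (rule torus.abs_eq_iff)

instantiation torus :: (finite) topological_space
begin

definition open_torus :: "'a torus set \<Rightarrow> bool" where
  "open_torus U \<longleftrightarrow> open (torus_of -` U)"

instance
proof
  show "open (UNIV :: 'a torus set)"
    by (simp add: open_torus_def)
next
  fix S T :: "'a torus set"
  assume "open S" "open T"
  then show "open (S \<inter> T)"
    by (simp add: open_torus_def vimage_Int open_Int)
next
  fix K :: "'a torus set set"
  assume "\<forall>S\<in>K. open S"
  then show "open (\<Union>K)"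
    by (auto simp: open_torus_def vimage_Union)
qed

end

primrec Ck :: "nat \<Rightarrow> ('a::euclidean_space \<Rightarrow> real) \<Rightarrow> bool" where
  "Ck 0 f \<longleftrightarrow> continuous_on UNIV f"
| "Ck (Suc k) f \<longleftrightarrow>
     f differentiable_on UNIV \<and> (\<forall>b\<in>Basis. Ck k (\<lambda>x. frechet_derivative f (at x) b))"

definition smooth :: "('a::euclidean_space \<Rightarrow> real) \<Rightarrow> bool" where
  "smooth f \<longleftrightarrow> (\<forall>k. Ck k f)"

definition test_interval :: "real \<Rightarrow> (real \<Rightarrow> real) set" where
  "test_interval T = {\<phi>. smooth \<phi> \<and> closure {t. \<phi> t \<noteq> 0} \<subseteq> {0<..<T}}"

text \<open>Smoothness on the torus is smoothness of the lift along the covering map.\<close>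

definition test_phase :: "('d::finite torus \<times> (real^'d) \<Rightarrow> real) set" where
  "test_phase = {\<phi>. smooth (\<lambda>p :: (real^'d) \<times> (real^'d). \<phi> (torus_of (fst p), snd p))
                    \<and> compact (closure {q. \<phi> q \<noteq> 0})}"

text \<open>
  Gradients in \<open>x\<close> are taken along the covering map. By periodicity all lifts \<open>y\<close> of \<open>x\<close> give the
  same vector. \<open>Dx\<close> and \<open>Dv\<close> are unspecified where the gradient does not exist.
\<close>

definition has_Dx :: "('d::finite torus \<times> (real^'d) \<Rightarrow> real) \<Rightarrow> 'd torus \<Rightarrow> (real^'d) \<Rightarrow> (real^'d) \<Rightarrow> bool" where
  "has_Dx f x v g \<longleftrightarrow> (\<forall>y. torus_of y = x \<longrightarrow> GDERIV (\<lambda>z. f (torus_of z, v)) y :> g)"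

definition has_Dv :: "('d::finite torus \<times> (real^'d) \<Rightarrow> real) \<Rightarrow> 'd torus \<Rightarrow> (real^'d) \<Rightarrow> (real^'d) \<Rightarrow> bool" where
  "has_Dv f x v g \<longleftrightarrow> GDERIV (\<lambda>u. f (x, u)) v :> g"

definition Dx :: "('d::finite torus \<times> (real^'d) \<Rightarrow> real) \<Rightarrow> 'd torus \<Rightarrow> (real^'d) \<Rightarrow> real^'d" where
  "Dx f x v = (THE g. has_Dx f x v g)"

definition Dv :: "('d::finite torus \<times> (real^'d) \<Rightarrow> real) \<Rightarrow> 'd torus \<Rightarrow> (real^'d) \<Rightarrow> real^'d" where
  "Dv f x v = (THE g. has_Dv f x v g)"

text \<open>
  The velocity is read off in a local lift. Two lifts that are differentiable at \<open>t\<close> differ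
  by a constant vector of integers near \<open>t\<close>, so the velocity does not depend on the lift.
  At \<open>t = 0\<close> it is the one-sided derivative, and values of \<open>\<gamma>\<close> at negative times are irrelevant.
\<close>

definition has_velocity :: "(real \<Rightarrow> 'd::finite torus) \<Rightarrow> real \<Rightarrow> (real^'d) \<Rightarrow> bool" where
  "has_velocity \<gamma> t u \<longleftrightarrow>
     (\<exists>g :: real \<Rightarrow> (real^'d). \<gamma> t = torus_of (g t)
        \<and> (\<forall>\<^sub>F s in at t within {0..}. \<gamma> s = torus_of (g s))
        \<and> (g has_vector_derivative u) (at t within {0..}))"

definition velocity :: "(real \<Rightarrow> 'd::finite torus) \<Rightarrow> real \<Rightarrow> real^'d" where
  "velocity \<gamma> t = (THE u. has_velocity \<gamma> t u)"

definition C1_curves :: "(real \<Rightarrow> 'd::finite torus) set" where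
  "C1_curves = {\<gamma>. (\<forall>t\<ge>0. \<exists>u. has_velocity \<gamma> t u) \<and> continuous_on {0..} (velocity \<gamma>)}"

definition C1_curves_from :: "'d::finite torus \<Rightarrow> (real^'d) \<Rightarrow> (real \<Rightarrow> 'd torus) set" where
  "C1_curves_from x v = {\<gamma> \<in> C1_curves. \<gamma> 0 = x \<and> velocity \<gamma> 0 = v}"

definition L2_interval :: "real \<Rightarrow> (real \<Rightarrow> (real^'d::finite)) \<Rightarrow> bool" where
  "L2_interval T w \<longleftrightarrow> set_borel_measurable lborel {0<..<T} w
     \<and> set_integrable lborel {0<..<T} (\<lambda>t. (norm (w t))\<^sup>2)"

definition has_weak_derivative :: "real \<Rightarrow> (real \<Rightarrow> (real^'d::finite)) \<Rightarrow> (real \<Rightarrow> (real^'d)) \<Rightarrow> bool" where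
  "has_weak_derivative T u w \<longleftrightarrow>
     (\<forall>\<phi>\<in>test_interval T.
        (LBINT t:{0<..<T}. deriv \<phi> t *\<^sub>R u t) = - (LBINT t:{0<..<T}. \<phi> t *\<^sub>R w t))"

text \<open>
  A \<open>C\<^sup>1\<close> curve and its velocity are bounded on \<open>(0,T)\<close>, and the weak derivative of any lift is
  the velocity. Membership in \<open>H\<^sup>2(0,T;\<T>\<^sup>d)\<close> therefore only requires a square integrable weak
  derivative of the velocity. That derivative is unique up to null sets, so the choice in
  \<open>acceleration\<close> does not affect the action.
\<close>

definition H2_curve :: "real \<Rightarrow> (real \<Rightarrow> 'd::finite torus) \<Rightarrow> bool" where
  "H2_curve T \<gamma> \<longleftrightarrow> (\<exists>w. L2_interval T w \<and> has_weak_derivative T (velocity \<gamma>) w)"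

definition acceleration :: "real \<Rightarrow> (real \<Rightarrow> 'd::finite torus) \<Rightarrow> real \<Rightarrow> real^'d" where
  "acceleration T \<gamma> = (SOME w. L2_interval T w \<and> has_weak_derivative T (velocity \<gamma>) w)"

definition action :: "('d::finite torus \<times> (real^'d) \<Rightarrow> real) \<Rightarrow> real \<Rightarrow> (real \<Rightarrow> 'd torus) \<Rightarrow> ereal" where
  "action F T \<gamma> =
     (if H2_curve T \<gamma>
      then ereal (LBINT s:{0<..<T}. (norm (acceleration T \<gamma> s))\<^sup>2 / 2 + F (\<gamma> s, velocity \<gamma> s))
      else \<infinity>)"

definition value_fun :: "('d::finite torus \<times> (real^'d) \<Rightarrow> real) \<Rightarrow> real \<Rightarrow> 'd torus \<Rightarrow> (real^'d) \<Rightarrow> ereal" where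
  "value_fun F T x v = (INF \<gamma>\<in>C1_curves_from x v. action F T \<gamma>)"

text \<open>
  For measures in \<open>prob_moments \<alpha>\<close> the integrand in \<open>closed_measures\<close> is integrable, since
  \<open>\<phi>\<close> has compact support and \<open>norm w\<close> has a finite second moment.
\<close>

definition prob_moments :: "real \<Rightarrow> ('d::finite torus \<times> (real^'d) \<times> (real^'d)) measure set" where
  "prob_moments \<alpha> = {\<mu>. sets \<mu> = sets borel \<and> prob_space \<mu>
     \<and> (\<integral>\<^sup>+ (x, v, w). ennreal ((norm w)\<^sup>2 + norm v powr \<alpha>) \<partial>\<mu>) < \<infinity>}"

definition closed_measures :: "real \<Rightarrow> ('d::finite torus \<times> (real^'d) \<times> (real^'d)) measure set" where
  "closed_measures \<alpha> = {\<eta> \<in> prob_moments \<alpha>.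
     \<forall>\<phi>\<in>test_phase. (\<integral>(x, v, w). Dx \<phi> x v \<bullet> v + Dv \<phi> x v \<bullet> w \<partial>\<eta>) = 0}"

end

theory Submission
  imports Defs
begin

text \<open>
  The problem is lifted from the torus to \<open>\<real>\<^sup>d \<times> \<real>\<^sup>d\<close>: a \<open>C\<^sup>1\<close> curve of finite action is the same as a
  controlled trajectory \<open>x' = v\<close>, \<open>v' = w\<close> with a square integrable control \<open>w\<close>
  (\<open>H2_curve_traj\<close>, \<open>traj_curve\<close>), and the lift of \<open>F\<close> is periodic in \<open>x\<close>.

  \<^bold>\<open>The constant.\<close> Let \<open>m T\<close> be the least cost over \<open>[0,T]\<close> when both endpoints are free. Cutting
  a trajectory in two shows that \<open>m\<close> is superadditive, and a curve at rest shows that \<open>m T\<close> grows at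
  most linearly; so \<open>m T / T\<close> converges to its supremum, called \<open>rate\<close>.

  \<^bold>\<open>The limit.\<close> Prescribing the initial state only raises the least cost. Conversely, along a near
  minimiser for \<open>m T\<close> the mean of \<open>|v|\<^sup>\<alpha>\<close> is bounded independently of \<open>T\<close>, so close to both ends of
  the interval, relative to \<open>T\<close>, there are times with a speed bound that does not depend on \<open>T\<close>
  (\<open>near_optimal_piece\<close>). Two states with bounded speed are joined in unit time by a cubic polynomial
  of bounded cost, once one of them has been moved by an integer vector (\<open>bounded_cost_connection\<close>).
  Joining the prescribed state to the beginning of the piece between those times gives the upper
  bound for the value function (\<open>min_cost_limit\<close>).

  \<^bold>\<open>Closed measures, upper bound.\<close> Joining the end of the same piece to its own beginning gives a
  periodic trajectory of mean cost close to \<open>rate\<close>. Its occupation measure is closed, because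
  the integral of \<open>\<langle>D\<^sub>x\<phi>,v\<rangle> + \<langle>D\<^sub>v\<phi>,w\<rangle>\<close> over a period is the increment of \<open>\<phi>\<close>, which vanishes.

  \<^bold>\<open>Closed measures, lower bound.\<close> Fix \<open>c' < rate\<close> and let \<open>u z\<close> be the infimum of the cost minus
  \<open>c' T\<close> over all \<open>T \<ge> 0\<close> and all trajectories on \<open>[0,T]\<close> that leave \<open>z\<close>. This \<open>u\<close> is bounded, since
  \<open>m T - c' T\<close> is bounded below, and concatenation gives
  \<open>u z\<^sub>0 \<le> cost - c' T + u z\<^sub>T\<close> along every trajectory, an integrated form of the inequality
  \<open>c' \<le> \<langle>D\<^sub>xu,v\<rangle> + \<langle>D\<^sub>vu,w\<rangle> + |w|\<^sup>2/2 + F\<close>. It remains to make \<open>u\<close> smooth. A shift of the phase space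
  variables does not preserve the constraint \<open>x' = v\<close>, but adding \<open>p cos t + q sin t\<close> to a trajectory
  does; the perturbation \<open>(p, q)\<close> of the state then rotates in phase space. Averaging over \<open>(p, q)\<close>
  with a rotation invariant kernel is therefore a mollification that keeps the inequality up to a
  small error (\<open>mollified_subsolution\<close>). As the mollified function is bounded, multiplying it by a
  cutoff at speed \<open>R\<close> costs only \<open>O(|w| / R)\<close>. The product is a test function; integrating the
  inequality against a closed measure and letting \<open>R \<rightarrow> \<infinity>\<close> gives \<open>c' \<le> \<integral>(|w|\<^sup>2/2 + F) d\<mu>\<close>
  (\<open>rate_le_closed_measure\<close>).
\<close>

section \<open>Smooth functions\<close>

lemma Ck_SucI:
  assumes "\<And>x. (f has_derivative f' x) (at x)" "\<And>b. b \<in> Basis \<Longrightarrow> Ck k (\<lambda>x. f' x b)"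
  shows "Ck (Suc k) f"
proof -
  have "frechet_derivative f (at x) = f' x" for x
    using assms(1) frechet_derivative_at by metis
  then show ?thesis
    using assms by (auto simp: differentiable_on_def differentiable_def)
qed

lemma Ck_Suc_has_derivative:
  assumes "Ck (Suc k) f"
  shows "(f has_derivative frechet_derivative f (at x)) (at x)"
  using assms by (auto simp: differentiable_on_def frechet_derivative_works[symmetric])

lemma Ck_Suc_imp_Ck: "Ck (Suc k) f \<Longrightarrow> Ck k f"
proof (induction k arbitrary: f)
  case 0
  then show ?case by (auto simp: differentiable_imp_continuous_on)
next
  case (Suc k)
  then show ?case by (simp only: Ck.simps) blast
qed

lemma Ck_continuous: "Ck k f \<Longrightarrow> continuous_on UNIV f"
  by (cases k) (auto simp: differentiable_imp_continuous_on)

lemma Ck_const: "Ck k (\<lambda>x. c)"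
proof (induction k arbitrary: c)
  case (Suc k)
  show ?case by (rule Ck_SucI[where f' = "\<lambda>x h. 0"]) (auto intro: Suc)
qed simp

lemma Ck_bounded_linear:
  assumes "bounded_linear f" shows "Ck k f"
proof (cases k)
  case 0
  then show ?thesis using assms by (auto simp: linear_continuous_on)
next
  case (Suc n)
  show ?thesis unfolding Suc
    by (rule Ck_SucI[where f' = "\<lambda>x. f"]) (auto intro: Ck_const bounded_linear_imp_has_derivative assms)
qed

lemma Ck_add: "Ck k f \<Longrightarrow> Ck k g \<Longrightarrow> Ck k (\<lambda>x. f x + g x)"
proof (induction k arbitrary: f g)
  case 0
  then show ?case by (auto intro: continuous_on_add)
next
  case (Suc k)
  have "Ck k (\<lambda>x. frechet_derivative f (at x) b)" "Ck k (\<lambda>x. frechet_derivative g (at x) b)"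
    if "b \<in> Basis" for b using Suc.prems that by auto
  then show ?case
    by (intro Ck_SucI[OF has_derivative_add[OF Ck_Suc_has_derivative[OF Suc.prems(1)]
            Ck_Suc_has_derivative[OF Suc.prems(2)]]] Suc.IH)
qed

lemma Ck_mult: "Ck k f \<Longrightarrow> Ck k g \<Longrightarrow> Ck k (\<lambda>x. f x * g x)"
proof (induction k arbitrary: f g)
  case 0
  then show ?case by (auto intro: continuous_on_mult)
next
  case (Suc k)
  have "Ck k f" "Ck k g" using Suc.prems Ck_Suc_imp_Ck by blast+
  moreover have "Ck k (\<lambda>x. frechet_derivative f (at x) b)" "Ck k (\<lambda>x. frechet_derivative g (at x) b)"
    if "b \<in> Basis" for b using Suc.prems that by auto
  ultimately show ?case
    by (intro Ck_SucI[OF has_derivative_mult[OF Ck_Suc_has_derivative[OF Suc.prems(1)]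
            Ck_Suc_has_derivative[OF Suc.prems(2)]]] Ck_add Suc.IH)
qed

lemma Ck_cmult: "Ck k f \<Longrightarrow> Ck k (\<lambda>x. c * f x)"
  by (rule Ck_mult[OF Ck_const])

lemma Ck_diff: "Ck k f \<Longrightarrow> Ck k g \<Longrightarrow> Ck k (\<lambda>x. f x - g x)"
  using Ck_add[of k f "\<lambda>x. (-1) * g x"] Ck_cmult[of k g "-1"] by simp

lemma Ck_sum: "(\<And>i. i \<in> I \<Longrightarrow> Ck k (f i)) \<Longrightarrow> Ck k (\<lambda>x. \<Sum>i\<in>I. f i x)"
  by (induction I rule: infinite_finite_induct) (auto intro: Ck_add Ck_const)

lemma Ck_inner_self:
  fixes g :: "'a::euclidean_space \<Rightarrow> 'b::euclidean_space"
  shows "bounded_linear g \<Longrightarrow> Ck k (\<lambda>x. g x \<bullet> g x)"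
proof -
  assume g: "bounded_linear g"
  have *: "(\<lambda>x. g x \<bullet> g x) = (\<lambda>x. \<Sum>b\<in>Basis. (g x \<bullet> b) * (g x \<bullet> b))"
    by (rule ext) (rule euclidean_inner)
  show ?thesis unfolding *
    by (intro Ck_sum Ck_mult Ck_bounded_linear bounded_linear_inner_left_comp g)
qed

lemma smooth_frechet_derivative:
  assumes "smooth f" "b \<in> Basis"
  shows "smooth (\<lambda>x. frechet_derivative f (at x) b)"
  using assms unfolding smooth_def by (metis Ck.simps(2))

lemma smooth_has_derivative: "smooth f \<Longrightarrow> (f has_derivative frechet_derivative f (at x)) (at x)"
  using Ck_Suc_has_derivative smooth_def by blast

lemma Ck_compose_real:
  fixes h :: "real \<Rightarrow> real" and f :: "'a::euclidean_space \<Rightarrow> real"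
  assumes "smooth h" "Ck k f"
  shows "Ck k (\<lambda>x. h (f x))"
  using assms
proof (induction k arbitrary: h)
  case 0
  have "continuous_on UNIV h" using 0 by (meson Ck_continuous smooth_def)
  then show ?case using 0 by (auto intro: continuous_on_compose2)
next
  case (Suc k)
  let ?h = "\<lambda>s. frechet_derivative h (at s) 1"
  have h': "(h has_derivative (\<lambda>t. ?h s * t)) (at s)" for s
  proof -
    have "frechet_derivative h (at s) t = ?h s * t" for t
      using linear_scale[of "frechet_derivative h (at s)" t 1]
        smooth_has_derivative[OF Suc.prems(1), of s] has_derivative_linear by force
    then show ?thesis using smooth_has_derivative[OF Suc.prems(1), of s]
      by (metis (no_types, lifting) ext)
  qed
  have "smooth ?h" using smooth_frechet_derivative[OF Suc.prems(1), of 1] by simp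
  then have k: "Ck k (\<lambda>x. ?h (f x))" using Suc Ck_Suc_imp_Ck by blast
  have "Ck k (\<lambda>x. ?h (f x) * frechet_derivative f (at x) b)" if "b \<in> Basis" for b
    by (rule Ck_mult[OF k]) (use Suc.prems that in simp)
  then show ?case
    by (rule Ck_SucI[OF has_derivative_compose[OF Ck_Suc_has_derivative[OF Suc.prems(2)] h']])
qed

lemma smooth_compose_real: 
  fixes h :: "real \<Rightarrow> real"
  shows "smooth h \<Longrightarrow> smooth f \<Longrightarrow> smooth (\<lambda>x. h (f x))"
  using Ck_compose_real[of h _ f] unfolding smooth_def[of f] smooth_def[of "\<lambda>x. h (f x)"] by blast

lemma smooth_mult: "smooth f \<Longrightarrow> smooth g \<Longrightarrow> smooth (\<lambda>x. f x * g x)"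
  by (simp add: smooth_def Ck_mult)

lemma smooth_diff: "smooth f \<Longrightarrow> smooth g \<Longrightarrow> smooth (\<lambda>x. f x - g x)"
  by (simp add: smooth_def Ck_diff)

lemma smooth_const: "smooth (\<lambda>x. c)"
  by (simp add: smooth_def Ck_const)

lemma smooth_continuous: "smooth f \<Longrightarrow> continuous_on UNIV f"
  by (meson smooth_def Ck_continuous)

definition grad :: "('a::euclidean_space \<Rightarrow> real) \<Rightarrow> 'a \<Rightarrow> 'a" where
  "grad f x = (\<Sum>b\<in>Basis. frechet_derivative f (at x) b *\<^sub>R b)"

lemma has_derivative_grad:
  assumes "smooth f" shows "(f has_derivative (\<lambda>h. grad f x \<bullet> h)) (at x)"
proof -
  let ?D = "frechet_derivative f (at x)"
  have d: "(f has_derivative ?D) (at x)" by (rule smooth_has_derivative[OF assms])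
  then have l: "linear ?D" by (rule has_derivative_linear)
  have "?D h = grad f x \<bullet> h" for h
  proof -
    have "?D h = ?D (\<Sum>b\<in>Basis. (h \<bullet> b) *\<^sub>R b)" by (simp add: euclidean_representation)
    also have "\<dots> = (\<Sum>b\<in>Basis. (h \<bullet> b) * ?D b)" by (simp add: linear_sum[OF l] linear_scale[OF l])
    finally show ?thesis by (simp add: grad_def inner_sum_left inner_commute[of h] mult.commute)
  qed
  then show ?thesis using d by (metis (no_types, lifting) ext)
qed

lemma continuous_grad: "smooth f \<Longrightarrow> continuous_on UNIV (grad f)"
  unfolding grad_def
  by (intro continuous_on_sum continuous_on_scaleR smooth_continuous smooth_frechet_derivative
      continuous_on_const)

lemma grad_inner_Basis:
  assumes "smooth f" "b \<in> Basis" shows "grad f x \<bullet> b = frechet_derivative f (at x) b"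
  using has_derivative_grad[OF assms(1), of x] smooth_has_derivative[OF assms(1), of x]
  by (metis has_derivative_unique)

text \<open>
  Smoothness on the line follows from a set of functions that is stable under differentiation; the
  set used below consists of the functions \<open>P(1/s) e\<^bsup>-1/s\<^esup>\<close> with polynomials \<open>P\<close>.
\<close>

lemma smooth_realI:
  fixes D :: "(real \<Rightarrow> real) set"
  assumes "\<And>f. f \<in> D \<Longrightarrow> \<exists>f'\<in>D. \<forall>x. (f has_real_derivative f' x) (at x)" "f \<in> D"
  shows "smooth f"
proof -
  have "Ck k f" for k
    using assms(2)
  proof (induction k arbitrary: f)
    case 0
    then obtain f' where "\<forall>x. (f has_real_derivative f' x) (at x)" using assms(1) by blast
    then show ?case by (auto simp: continuous_on_eq_continuous_at intro: DERIV_isCont)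
  next
    case (Suc k)
    then obtain f' where f': "f' \<in> D" "\<forall>x. (f has_real_derivative f' x) (at x)" using assms(1) by blast
    show ?case
      by (rule Ck_SucI[where f' = "\<lambda>x h. f' x * h"])
       (use Suc.IH[OF f'(1)] f' in \<open>auto simp: has_field_derivative_def\<close>)
  qed
  then show ?thesis by (simp add: smooth_def)
qed

lemma smooth_antiderivative:
  fixes f g :: "real \<Rightarrow> real"
  assumes "\<And>x. (f has_real_derivative g x) (at x)" "smooth g"
  shows "smooth f"
proof -
  have "Ck (Suc k) f" for k
    by (rule Ck_SucI[where f' = "\<lambda>x h. g x * h"])
      (use assms in \<open>auto simp: has_field_derivative_def smooth_def\<close>)
  then show ?thesis unfolding smooth_def using Ck_Suc_imp_Ck by blast
qed

definition flat_exp :: "real poly \<Rightarrow> real \<Rightarrow> real" where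
  "flat_exp p s = (if s > 0 then poly p (1 / s) * exp (- (1 / s)) else 0)"

lemma poly_over_exp_tendsto_0: "((\<lambda>x::real. poly p x * exp (- x)) \<longlongrightarrow> 0) at_top"
proof -
  have "((\<lambda>x::real. \<Sum>i\<le>degree p. coeff p i * (x ^ i / exp x)) \<longlongrightarrow> (\<Sum>i\<le>degree p. coeff p i * 0)) at_top"
    by (intro tendsto_intros tendsto_power_div_exp_0)
  then show ?thesis by (simp add: poly_altdef sum_distrib_right exp_minus divide_inverse mult.assoc)
qed

text \<open>
  The factor \<open>[:0, 0, 1:] = X\<^sup>2\<close> comes from the derivative \<open>-1/s\<^sup>2\<close> of \<open>1/s\<close>. At \<open>0\<close> the exponential
  decay beats every polynomial in \<open>1/s\<close>.
\<close>

lemma flat_exp_derivative: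
  "(flat_exp p has_real_derivative flat_exp ([:0,0,1:] * (p - pderiv p)) s) (at s)"
proof -
  let ?q = "[:0,0,1:] * (p - pderiv p)"
  consider "s > 0" | "s < 0" | "s = 0" by linarith
  then show ?thesis
  proof cases
    case 1
    have "((\<lambda>s. poly p (1 / s) * exp (- (1 / s))) has_real_derivative
        (poly (pderiv p) (1/s) * (-1/s^2) * exp (-(1/s)) + exp (-(1/s)) * (1/s^2) * poly p (1/s))) (at s)"
      using 1 by (auto intro!: derivative_eq_intros poly_DERIV[THEN DERIV_chain2] simp: power2_eq_square)
    also have "(poly (pderiv p) (1/s) * (-1/s^2) * exp (-(1/s)) + exp (-(1/s)) * (1/s^2) * poly p (1/s))
        = flat_exp ?q s"
      using 1 by (simp add: flat_exp_def power2_eq_square field_simps)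
    finally have *: "((\<lambda>s. poly p (1 / s) * exp (- (1 / s))) has_real_derivative flat_exp ?q s) (at s)" .
    show ?thesis
      by (rule has_field_derivative_transform_within_open[OF *, of "{0<..}"])
        (use 1 in \<open>auto simp: flat_exp_def\<close>)
  next
    case 2
    have "((\<lambda>s. 0) has_real_derivative flat_exp ?q s) (at s)"
      using 2 by (simp add: flat_exp_def)
    then show ?thesis
      by (rule has_field_derivative_transform_within_open[of _ _ _ "{..<0}"])
        (use 2 in \<open>auto simp: flat_exp_def\<close>)
  next
    case 3
    have r: "((\<lambda>h. flat_exp p h / h) \<longlongrightarrow> 0) (at_right 0)"
    proof -
      have "((\<lambda>h. (poly ([:0,1:] * p) (inverse h) * exp (- inverse h))) \<longlongrightarrow> 0) (at_right (0::real))"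
        by (rule filterlim_compose[OF poly_over_exp_tendsto_0 filterlim_inverse_at_top_right])
      then show ?thesis
        by (rule Lim_transform_eventually)
          (auto simp: eventually_at_filter flat_exp_def field_simps intro!: always_eventually)
    qed
    have l: "((\<lambda>h. flat_exp p h / h) \<longlongrightarrow> 0) (at_left 0)"
      by (rule Lim_transform_eventually[OF tendsto_const])
        (auto simp: eventually_at_filter flat_exp_def intro!: always_eventually)
    have "((\<lambda>h. flat_exp p h / h) \<longlongrightarrow> 0) (at 0)"
      using l r by (simp add: filterlim_split_at)
    then have "(flat_exp p has_real_derivative 0) (at 0)"
      by (simp add: has_field_derivative_iff flat_exp_def)
    then show ?thesis using 3 by (simp add: flat_exp_def)
  qed
qed

lemma smooth_flat_exp: "smooth (flat_exp p)"
  by (rule smooth_realI[of "range flat_exp"]) (use flat_exp_derivative in blast)+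

definition bump :: "real \<Rightarrow> real" where
  "bump s = flat_exp 1 (1 - s)"

lemma smooth_bump: "smooth bump"
  unfolding bump_def
  by (rule smooth_compose_real[OF smooth_flat_exp])
    (intro smooth_diff smooth_const, simp add: smooth_def Ck_bounded_linear)

lemma bump_pos: "s < 1 \<Longrightarrow> bump s > 0" and bump_zero: "s \<ge> 1 \<Longrightarrow> bump s = 0"
  and bump_nonneg: "bump s \<ge> 0"
  by (auto simp: bump_def flat_exp_def)

lemma smooth_bump_square: "smooth (\<lambda>t. bump (t\<^sup>2))"
  using smooth_compose_real[OF smooth_bump, of "\<lambda>t::real. t\<^sup>2"]
    Ck_inner_self[of "\<lambda>t::real. t"]
  by (simp add: smooth_def power2_eq_square)

lemma bump_square_outside: "\<bar>t\<bar> \<ge> 1 \<Longrightarrow> bump (t\<^sup>2) = 0"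
  by (rule bump_zero) (metis abs_le_square_iff abs_one one_power2)

text \<open>
  The normalised antiderivative of the even bump \<open>bump (t\<^sup>2)\<close>, which is supported in \<open>[-1,1]\<close>. It
  serves twice: differences of rescaled steps are the test functions for weak derivatives, and
  composed with \<open>|v|\<^sup>2\<close> it cuts off large velocities.
\<close>

lemma smooth_step_exists:
  obtains H :: "real \<Rightarrow> real"
  where "smooth H" "mono H" "\<And>s. s \<le> -1 \<Longrightarrow> H s = 0" "\<And>s. s \<ge> 1 \<Longrightarrow> H s = 1"
    "\<And>s. 0 \<le> H s" "\<And>s. H s \<le> 1"
proof -
  have "\<exists>A. \<forall>x. -\<infinity> < ereal x \<longrightarrow> ereal x < \<infinity> \<longrightarrow> (A has_vector_derivative bump (x\<^sup>2)) (at x)"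
    by (rule einterval_antiderivative)
      (use smooth_continuous[OF smooth_bump_square] in \<open>auto simp: continuous_on_eq_continuous_at\<close>)
  then obtain A where A: "(A has_real_derivative bump (x\<^sup>2)) (at x)" for x
    by (auto simp: has_real_derivative_iff_has_vector_derivative)
  have mono: "A s \<le> A t" if "s \<le> t" for s t
    by (rule DERIV_nonneg_imp_nondecreasing[OF that]) (use A bump_nonneg in blast)
  have left: "A s = A (-1)" if "s \<le> -1" for s
  proof (cases "s = -1")
    case False
    then have lt: "s < -1" using that by simp
    obtain z where "s < z" "z < -1" "A (-1) - A s = (-1 - s) * bump (z\<^sup>2)"
      using MVT2[OF lt, of A "\<lambda>x. bump (x\<^sup>2)"] A by auto
    then show ?thesis using bump_square_outside[of z] by simp
  qed simp
  have right: "A s = A 1" if "s \<ge> 1" for s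
  proof (cases "s = 1")
    case False
    then have lt: "1 < s" using that by simp
    obtain z where "1 < z" "z < s" "A s - A 1 = (s - 1) * bump (z\<^sup>2)"
      using MVT2[OF lt, of A "\<lambda>x. bump (x\<^sup>2)"] A by auto
    then show ?thesis using bump_square_outside[of z] by simp
  qed simp
  have pos: "A 1 - A (-1) > 0"
  proof -
    obtain z where "-1 < z" "z < 1" "A 1 - A (-1) = (1 - (-1)) * bump (z\<^sup>2)"
      using MVT2[of "-1" 1 A "\<lambda>x. bump (x\<^sup>2)"] A by auto
    moreover from this have "z\<^sup>2 < 1" by (simp add: abs_square_less_1)
    ultimately show ?thesis using bump_pos by simp
  qed
  define H where "H s = (1 / (A 1 - A (-1))) * (A s - A (-1))" for s
  show thesis
  proof
    show "smooth H"
      unfolding H_def[abs_def]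
      by (rule smooth_mult[OF smooth_const smooth_diff[OF
              smooth_antiderivative[OF A smooth_bump_square] smooth_const]])
    show mono_H: "mono H"
      unfolding H_def[abs_def] using mono pos by (intro monoI mult_left_mono diff_right_mono) auto
    show zero: "H s = 0" if "s \<le> -1" for s using left[OF that] by (simp only: H_def) simp
    show one: "H s = 1" if "s \<ge> 1" for s using right[OF that] pos by (simp only: H_def) simp
    show "0 \<le> H s" for s
      using monoD[OF mono_H, of "min s (-1)" s] zero[of "min s (-1)"] by simp
    show "H s \<le> 1" for s
      using monoD[OF mono_H, of s "max s 1"] one[of "max s 1"] by simp
  qed
qed

section \<open>The chain rule along absolutely continuous curves\<close>

lemma grad_linearization:
  assumes "smooth f" "\<And>\<xi>. \<xi> \<in> closed_segment a b \<Longrightarrow> norm (grad f \<xi> - grad f a) \<le> B"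
  shows "\<bar>f b - f a - grad f a \<bullet> (b - a)\<bar> \<le> norm (b - a) * B"
proof -
  have "norm (f b - f a - grad f a \<bullet> (b - a)) \<le> norm (b - a) * B"
  proof (rule differentiable_bound_linearization[where S = "closed_segment a b" and
        f' = "\<lambda>x h. grad f x \<bullet> h"])
    show "a + t *\<^sub>R (b - a) \<in> closed_segment a b" if "t \<in> {0..1}" for t
      using that by (auto simp: closed_segment_def algebra_simps intro!: exI[of _ t])
    show "(f has_derivative (\<lambda>h. grad f x \<bullet> h)) (at x within closed_segment a b)" for x
      using has_derivative_at_withinI has_derivative_grad assms(1) by blast
    show "onorm ((\<lambda>h. grad f x \<bullet> h) - (\<lambda>h. grad f a \<bullet> h)) \<le> B" if "x \<in> closed_segment a b" for x
    proof (rule onorm_le)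
      fix h
      have "norm (((\<lambda>h. grad f x \<bullet> h) - (\<lambda>h. grad f a \<bullet> h)) h) = \<bar>(grad f x - grad f a) \<bullet> h\<bar>"
        by (simp add: inner_diff_left)
      also have "\<dots> \<le> norm (grad f x - grad f a) * norm h" by (rule Cauchy_Schwarz_ineq2)
      also have "\<dots> \<le> B * norm h" by (rule mult_right_mono) (use assms(2)[OF that] in auto)
      finally show "norm (((\<lambda>h. grad f x \<bullet> h) - (\<lambda>h. grad f a \<bullet> h)) h) \<le> B * norm h" .
    qed
  qed auto
  then show ?thesis by simp
qed

lemma grad_uniformly_continuous_cball:
  fixes f :: "'a::euclidean_space \<Rightarrow> real"
  assumes "smooth f" "e > 0"
  obtains d where "d > 0"
    "\<And>x y. norm x \<le> R \<Longrightarrow> norm y \<le> R \<Longrightarrow> dist x y < d \<Longrightarrow> norm (grad f y - grad f x) < e"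
proof -
  have "uniformly_continuous_on (cball 0 R) (grad f)"
    by (rule compact_uniformly_continuous[OF continuous_on_subset[OF continuous_grad[OF assms(1)]]]) auto
  then show ?thesis
    using assms(2) that unfolding uniformly_continuous_on_def
    by (metis dist_commute dist_norm mem_cball_0)
qed

text \<open>
  The interval is divided into pieces shorter than \<open>\<eta>\<close> and the increments are added up.
\<close>

lemma local_increment_bound:
  fixes G N :: "real \<Rightarrow> real"
  assumes "0 \<le> T" "\<eta> > 0"
    and inc: "\<And>a b. 0 \<le> a \<Longrightarrow> a \<le> b \<Longrightarrow> b \<le> T \<Longrightarrow> b - a < \<eta> \<Longrightarrow> \<bar>G b - G a\<bar> \<le> c * (N b - N a)"
  shows "\<bar>G T - G 0\<bar> \<le> c * (N T - N 0)"
proof -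
  obtain n :: nat where n: "T / \<eta> < real n" using reals_Archimedean2 by blast
  then have n0: "real n > 0" using assms by (meson divide_nonneg_pos le_less_trans)
  have step: "T / real n < \<eta>" using n n0 assms(2) by (simp add: field_simps)
  have "k \<le> n \<Longrightarrow> \<bar>G (k * (T / n)) - G 0\<bar> \<le> c * (N (k * (T / n)) - N 0)" for k :: nat
  proof (induction k)
    case (Suc k)
    let ?a = "k * (T / n)" and ?b = "Suc k * (T / n)"
    have eq: "?b = ?a + T / n" by (simp add: distrib_right add_divide_distrib)
    have "?b \<le> real n * (T / n)"
      using Suc.prems assms(1) by (intro mult_right_mono) auto
    then have "?b \<le> T" using n0 by simp
    then have "\<bar>G ?b - G ?a\<bar> \<le> c * (N ?b - N ?a)"
      by (intro inc) (use assms(1) n0 step eq in auto)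
    moreover have "\<bar>G ?a - G 0\<bar> \<le> c * (N ?a - N 0)" using Suc by simp
    ultimately show ?case unfolding right_diff_distrib by linarith
  qed simp
  from this[of n] show ?thesis using n0 by simp
qed

lemma absolutely_integrable_continuous_inner:
  fixes g h :: "real \<Rightarrow> 'a::euclidean_space"
  assumes "h absolutely_integrable_on {a..b}" "continuous_on {a..b} g"
  shows "(\<lambda>t. g t \<bullet> h t) absolutely_integrable_on {a..b}"
proof (rule absolutely_integrable_bounded_measurable_product[where h = "\<lambda>x y. x \<bullet> y" and f = g and g = h])
  show "bilinear (\<lambda>x y::'a. x \<bullet> y)"
    by (simp add: bilinear_conv_bounded_bilinear bounded_bilinear_inner)
  show "g \<in> borel_measurable (lebesgue_on {a..b})"
    by (rule continuous_imp_measurable_on_sets_lebesgue[OF assms(2)]) auto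
  show "bounded (g ` {a..b})"
    by (simp add: assms(2) compact_continuous_image compact_imp_bounded)
qed (use assms(1) in auto)

text \<open>
  The fundamental theorem of calculus along a curve that is only an indefinite integral. On short
  intervals \<open>grad f\<close> is almost constant along the curve, so that the increment of \<open>f\<close> differs from the
  integral of \<open>grad f \<bullet> dz\<close> by at most \<open>2 e\<close> times the arc length; by \<open>local_increment_bound\<close> the same
  bound holds on the whole interval, for every \<open>e > 0\<close>.
\<close>

lemma chain_rule_absolutely_continuous:
  fixes f :: "'a::euclidean_space \<Rightarrow> real" and z dz :: "real \<Rightarrow> 'a"
  assumes "smooth f" "0 \<le> T" and dz: "dz absolutely_integrable_on {0..T}"
    and z: "\<And>t. 0 \<le> t \<Longrightarrow> t \<le> T \<Longrightarrow> (dz has_integral (z t - z 0)) {0..t}"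
  shows "((\<lambda>t. grad f (z t) \<bullet> dz t) has_integral (f (z T) - f (z 0))) {0..T}"
proof -
  have dzi: "dz absolutely_integrable_on {a..b}" if "0 \<le> a" "b \<le> T" for a b
    using dz by (rule absolutely_integrable_on_subinterval) (use that in auto)
  have zint: "integral {a..b} dz = z b - z a" if "0 \<le> a" "a \<le> b" "b \<le> T" for a b
  proof -
    have "integral {0..a} dz + integral {a..b} dz = integral {0..b} dz"
      using that dzi[of 0 b] by (intro Henstock_Kurzweil_Integration.integral_combine)
        (auto simp: absolutely_integrable_on_def)
    then show ?thesis
      using z[of a] z[of b] that by (auto dest!: integral_unique simp: algebra_simps)
  qed
  have contz: "continuous_on {0..T} z"
  proof -
    have "continuous_on {0..T} (\<lambda>t. z 0 + integral {0..t} dz)"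
      using dz by (intro continuous_intros indefinite_integral_continuous_1)
        (auto simp: absolutely_integrable_on_def)
    then show ?thesis
      by (rule continuous_on_eq) (use zint in auto)
  qed
  obtain R where R: "\<And>t. t \<in> {0..T} \<Longrightarrow> norm (z t) \<le> R"
    using compact_imp_bounded[OF compact_continuous_image[OF contz compact_Icc]] unfolding bounded_iff by blast
  define g where "g = (\<lambda>t. grad f (z t) \<bullet> dz t)"
  have gi: "g absolutely_integrable_on {0..T}"
    unfolding g_def
    by (intro absolutely_integrable_continuous_inner dz
        continuous_on_compose2[OF continuous_grad[OF assms(1)] contz]) auto
  have gi': "g integrable_on {a..b}" if "0 \<le> a" "b \<le> T" for a b
    using gi integrable_on_subinterval[of g "{0..T}" a b] that by (auto simp: absolutely_integrable_on_def)
  define N where "N t = integral {0..t} (\<lambda>t. norm (dz t))" for t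
  have ni: "(\<lambda>t. norm (dz t)) integrable_on {a..b}" if "0 \<le> a" "b \<le> T" for a b
    using dzi[OF that] by (simp add: absolutely_integrable_on_def)
  have Ninc: "integral {a..b} (\<lambda>t. norm (dz t)) = N b - N a" if "0 \<le> a" "a \<le> b" "b \<le> T" for a b
    using Henstock_Kurzweil_Integration.integral_combine[of 0 a b "\<lambda>t. norm (dz t)"] that ni[of 0 b]
    by (simp add: N_def)
  \<comment> \<open>\<open>G\<close> is the defect of the claimed identity and \<open>N\<close> the arc length.\<close>
  define G where "G t = f (z t) - integral {0..t} g" for t
  have Ginc: "G b - G a = f (z b) - f (z a) - integral {a..b} g" if "0 \<le> a" "a \<le> b" "b \<le> T" for a b
    using Henstock_Kurzweil_Integration.integral_combine[of 0 a b g] that gi'[of 0 b]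
    by (simp add: G_def)
  have "\<bar>G T - G 0\<bar> \<le> (2 * e) * (N T - N 0)" if e: "e > 0" for e
  proof -
    obtain d where d: "d > 0" "\<And>x y. norm x \<le> R \<Longrightarrow> norm y \<le> R \<Longrightarrow> dist x y < d \<Longrightarrow>
        norm (grad f y - grad f x) < e"
      using grad_uniformly_continuous_cball[OF assms(1) e] by metis
    have "uniformly_continuous_on {0..T} z"
      by (rule compact_uniformly_continuous[OF contz]) simp
    then obtain \<eta> where \<eta>: "\<eta> > 0"
      "\<And>s t. s \<in> {0..T} \<Longrightarrow> t \<in> {0..T} \<Longrightarrow> dist s t < \<eta> \<Longrightarrow> dist (z s) (z t) < d"
      unfolding uniformly_continuous_on_def using d(1) by metis
    show ?thesis
    proof (rule local_increment_bound[OF assms(2) \<eta>(1)])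
      fix a b :: real assume ab: "0 \<le> a" "a \<le> b" "b \<le> T" "b - a < \<eta>"
      have near: "norm (grad f (z s) - grad f (z a)) \<le> e" if "s \<in> {a..b}" for s
        by (rule less_imp_le[OF d(2)]) (use that ab \<eta>(2)[of a s] R in \<open>auto simp: dist_real_def\<close>)
      have "\<bar>f (z b) - f (z a) - grad f (z a) \<bullet> (z b - z a)\<bar> \<le> norm (z b - z a) * e"
      proof (rule grad_linearization[OF assms(1)])
        fix \<xi> assume \<xi>: "\<xi> \<in> closed_segment (z a) (z b)"
        have "closed_segment (z a) (z b) \<subseteq> cball 0 R"
          using R ab by (intro closed_segment_subset) auto
        moreover have "dist \<xi> (z a) \<le> dist (z b) (z a)"
          using \<xi> dist_in_closed_segment[OF \<xi>] by (simp add: dist_commute)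
        moreover have "dist (z b) (z a) < d" using \<eta>(2)[of b a] ab by (auto simp: dist_real_def)
        ultimately show "norm (grad f \<xi> - grad f (z a)) \<le> e"
          using \<xi> R[of a] ab by (intro less_imp_le[OF d(2)]) (auto simp: dist_commute)
      qed
      moreover have "norm (z b - z a) \<le> N b - N a"
      proof -
        have "norm (integral {a..b} dz) \<le> integral {a..b} (\<lambda>t. norm (dz t))"
          using dzi[of a b] ab
          by (intro integral_norm_bound_integral) (auto simp: absolutely_integrable_on_def)
        then show ?thesis using zint Ninc ab by simp
      qed
      moreover have "\<bar>integral {a..b} g - grad f (z a) \<bullet> (z b - z a)\<bar> \<le> e * (N b - N a)"
      proof -
        have i1: "(\<lambda>t. grad f (z a) \<bullet> dz t) integrable_on {a..b}"
          using dzi[of a b] ab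
          by (intro integrable_linear[OF _ bounded_linear_inner_right, unfolded o_def])
            (auto simp: absolutely_integrable_on_def)
        have "grad f (z a) \<bullet> (z b - z a) = integral {a..b} (\<lambda>t. grad f (z a) \<bullet> dz t)"
          using zint[OF ab(1-3)] integral_linear[OF _ bounded_linear_inner_right, of dz "{a..b}" "grad f (z a)"]
            dzi[of a b] ab by (auto simp: absolutely_integrable_on_def o_def)
        then have "integral {a..b} g - grad f (z a) \<bullet> (z b - z a)
            = integral {a..b} (\<lambda>t. g t - grad f (z a) \<bullet> dz t)"
          using i1 gi'[of a b] ab by (simp add: Henstock_Kurzweil_Integration.integral_diff)
        also have "norm \<dots> \<le> integral {a..b} (\<lambda>t. e * norm (dz t))"
        proof (rule integral_norm_bound_integral)
          fix t assume t: "t \<in> {a..b}"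
          have "norm (g t - grad f (z a) \<bullet> dz t) = \<bar>(grad f (z t) - grad f (z a)) \<bullet> dz t\<bar>"
            by (simp add: g_def inner_diff_left)
          also have "\<dots> \<le> norm (grad f (z t) - grad f (z a)) * norm (dz t)" by (rule Cauchy_Schwarz_ineq2)
          also have "\<dots> \<le> e * norm (dz t)" using near[OF t] by (intro mult_right_mono) auto
          finally show "norm (g t - grad f (z a) \<bullet> dz t) \<le> e * norm (dz t)" .
        qed (use i1 gi'[of a b] ni[of a b] ab in \<open>auto intro!: integrable_diff integrable_on_mult_right\<close>)
        finally show ?thesis using Ninc ab by simp
      qed
      ultimately show "\<bar>G b - G a\<bar> \<le> (2 * e) * (N b - N a)"
        using Ginc[OF ab(1-3)] mult_left_mono[of "norm (z b - z a)" "N b - N a" e] e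
        unfolding mult.assoc mult.commute[of "norm _" e] by linarith
    qed
  qed
  then have *: "\<bar>G T - G 0\<bar> \<le> e * (N T - N 0)" if "e > 0" for e
    using that by (metis half_gt_zero field_sum_of_halves mult_2)
  have "G T - G 0 = 0"
  proof (rule ccontr)
    assume n: "G T - G 0 \<noteq> 0"
    define k where "k = \<bar>N T - N 0\<bar> + 1"
    have k: "k > 0" "N T - N 0 \<le> k" by (auto simp: k_def)
    let ?e = "\<bar>G T - G 0\<bar> / (2 * k)"
    have "?e > 0" using n k by simp
    then have "\<bar>G T - G 0\<bar> \<le> ?e * (N T - N 0)" by (rule *)
    also have "\<dots> \<le> ?e * k" using k by (intro mult_left_mono) auto
    also have "\<dots> = \<bar>G T - G 0\<bar> / 2" using k by simp
    finally show False using n by simp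
  qed
  then have "integral {0..T} g = f (z T) - f (z 0)" using Ginc[of 0 T] assms(2) by simp
  then show ?thesis using gi'[of 0 T] unfolding g_def by (metis integrable_integral order_refl)
qed

section \<open>Mollification\<close>

text \<open>
  Correlation rather than convolution: the kernel is evaluated at \<open>\<zeta> - z\<close>, which makes
  \<open>correlation u \<rho> z\<close> the mean of \<open>u (z + \<zeta>)\<close> with weight \<open>\<rho> \<zeta>\<close>.
\<close>

definition correlation :: "('a::euclidean_space \<Rightarrow> real) \<Rightarrow> ('a \<Rightarrow> real) \<Rightarrow> 'a \<Rightarrow> real" where
  "correlation u \<rho> z = (\<integral>\<zeta>. u \<zeta> * \<rho> (\<zeta> - z) \<partial>lborel)"

lemma integrable_bounded_support:
  fixes f :: "'a::euclidean_space \<Rightarrow> real"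
  assumes "f \<in> borel_measurable borel" "\<And>\<zeta>. \<bar>f \<zeta>\<bar> \<le> C * indicator (cball z r) \<zeta>"
  shows "integrable lborel f" "\<bar>\<integral>\<zeta>. f \<zeta> \<partial>lborel\<bar> \<le> C * measure lborel (cball z r)"
proof -
  have fin: "emeasure lborel (cball z r) < \<infinity>"
    by (rule emeasure_lborel_cball_finite)
  then have i: "integrable lborel (\<lambda>\<zeta>. C * indicator (cball z r) \<zeta> :: real)"
    by (intro integrable_mult_right integrable_real_indicator) auto
  show f: "integrable lborel f"
    by (rule Bochner_Integration.integrable_bound[OF i])
      (use assms(1) in \<open>auto intro!: AE_I2 order.trans[OF assms(2)]\<close>)
  have "\<bar>\<integral>\<zeta>. f \<zeta> \<partial>lborel\<bar> \<le> (\<integral>\<zeta>. \<bar>f \<zeta>\<bar> \<partial>lborel)"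
    by (rule integral_abs_bound)
  also have "\<dots> \<le> (\<integral>\<zeta>. C * indicator (cball z r) \<zeta> \<partial>lborel)"
    by (rule integral_mono[OF integrable_abs[OF f] i assms(2)])
  also have "\<dots> = C * measure lborel (cball z r)"
    by simp
  finally show "\<bar>\<integral>\<zeta>. f \<zeta> \<partial>lborel\<bar> \<le> C * measure lborel (cball z r)" .
qed

lemma smooth_measurable: "smooth f \<Longrightarrow> f \<in> borel_measurable borel"
  by (rule borel_measurable_continuous_onI[OF smooth_continuous])

lemma grad_outside_support:
  fixes f :: "'a::euclidean_space \<Rightarrow> real"
  assumes "smooth f" "\<And>y. norm y > r \<Longrightarrow> f y = 0" "norm y > r"
  shows "frechet_derivative f (at y) = (\<lambda>h. 0)" "grad f y = 0"
proof -
  have o: "open {y::'a. norm y > r}" by (intro open_Collect_less continuous_intros)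
  have "((\<lambda>x. 0) has_derivative (\<lambda>h. 0)) (at y)" by simp
  then have "(f has_derivative (\<lambda>h. 0)) (at y)"
    by (rule has_derivative_transform_within_open[OF _ o]) (use assms in auto)
  then show *: "frechet_derivative f (at y) = (\<lambda>h. 0)"
    using frechet_derivative_at by metis
  show "grad f y = 0" by (simp add: grad_def *)
qed

lemma smooth_cutoff_bounded:
  fixes f :: "'a::euclidean_space \<Rightarrow> real"
  assumes "continuous_on UNIV f" "\<And>y. norm y > r \<Longrightarrow> f y = 0"
  obtains C where "C \<ge> 0" "\<And>y. \<bar>f y\<bar> \<le> C"
proof -
  have "bounded (f ` cball 0 r)"
    by (intro compact_imp_bounded compact_continuous_image continuous_on_subset[OF assms(1)]) auto
  then obtain C where C: "\<forall>y\<in>cball 0 r. \<bar>f y\<bar> \<le> C" by (auto simp: bounded_iff)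
  have "\<bar>f y\<bar> \<le> \<bar>C\<bar>" for y
    using C assms(2)[of y] by (cases "norm y \<le> r") force+
  then show thesis by (intro that[of "\<bar>C\<bar>"]) auto
qed

lemma correlation_integrable:
  fixes u \<rho> :: "'a::euclidean_space \<Rightarrow> real"
  assumes u: "u \<in> borel_measurable borel" "\<And>\<zeta>. \<bar>u \<zeta>\<bar> \<le> M"
    and \<rho>: "continuous_on UNIV \<rho>" "\<And>y. norm y > r \<Longrightarrow> \<rho> y = 0"
  shows "integrable lborel (\<lambda>\<zeta>. u \<zeta> * \<rho> (\<zeta> - z))"
proof -
  obtain C where C: "C \<ge> 0" "\<And>y. \<bar>\<rho> y\<bar> \<le> C" using smooth_cutoff_bounded[OF \<rho>] by metis
  have M: "M \<ge> 0" using u(2)[of 0] by linarith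
  have m: "\<rho> \<in> borel_measurable borel" by (rule borel_measurable_continuous_onI[OF \<rho>(1)])
  show ?thesis
  proof (rule integrable_bounded_support(1)[of _ "M * C" z r])
    show "(\<lambda>\<zeta>. u \<zeta> * \<rho> (\<zeta> - z)) \<in> borel_measurable borel"
      using u(1) m by measurable
    show "\<bar>u \<zeta> * \<rho> (\<zeta> - z)\<bar> \<le> M * C * indicator (cball z r) \<zeta>" for \<zeta>
      using u(2)[of \<zeta>] C M \<rho>(2)[of "\<zeta> - z"]
      by (cases "norm (\<zeta> - z) \<le> r")
        (auto simp: abs_mult dist_norm norm_minus_commute indicator_def intro!: mult_mono)
  qed
qed

text \<open>
  The remainder of the linearisation of \<open>\<rho>\<close> is uniformly small because \<open>grad \<rho>\<close> is uniformly
  continuous, and it lives in a fixed ball; the function \<open>u\<close> only has to be bounded and measurable.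
\<close>

lemma correlation_has_derivative:
  fixes u \<rho> :: "'a::euclidean_space \<Rightarrow> real"
  assumes u: "u \<in> borel_measurable borel" "\<And>\<zeta>. \<bar>u \<zeta>\<bar> \<le> M"
    and \<rho>: "smooth \<rho>" "\<And>y. norm y > r \<Longrightarrow> \<rho> y = 0"
  shows "(correlation u \<rho> has_derivative (\<lambda>h. \<integral>\<zeta>. u \<zeta> * - (grad \<rho> (\<zeta> - z) \<bullet> h) \<partial>lborel)) (at z)"
proof -
  let ?D = "\<lambda>h. \<integral>\<zeta>. u \<zeta> * - (grad \<rho> (\<zeta> - z) \<bullet> h) \<partial>lborel"
  have grad0: "grad \<rho> y = 0" if "norm y > r" for y
    by (rule grad_outside_support(2)[OF \<rho>(1) _ that]) (rule \<rho>(2))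
  have iD: "integrable lborel (\<lambda>\<zeta>. u \<zeta> * - (grad \<rho> (\<zeta> - z) \<bullet> h))" for h
    by (rule correlation_integrable[OF u, of "\<lambda>y. - (grad \<rho> y \<bullet> h)" r])
      (auto intro!: continuous_intros continuous_grad \<rho>(1) simp: grad0)
  have i\<rho>: "integrable lborel (\<lambda>\<zeta>. u \<zeta> * \<rho> (\<zeta> - z))" for z
    by (rule correlation_integrable[OF u smooth_continuous[OF \<rho>(1)] \<rho>(2)])
  have M: "M \<ge> 0" using u(2)[of 0] by linarith
  have lin: "linear ?D"
  proof (rule linearI)
    show "?D (x + y) = ?D x + ?D y" for x y
      by (subst Bochner_Integration.integral_add[OF iD iD, symmetric])
        (simp add: inner_add_right algebra_simps)
    show "?D (c *\<^sub>R x) = c *\<^sub>R ?D x" for c x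
      unfolding real_scaleR_def
      by (subst integral_mult_right_zero[symmetric]) (simp add: mult.left_commute)
  qed
  show ?thesis
    unfolding has_derivative_at_alt
  proof (intro conjI allI impI)
    show "bounded_linear ?D" using lin by (simp add: linear_conv_bounded_linear)
    fix e :: real assume e: "e > 0"
    define V where "V = measure lborel (cball z (r + 1))"
    have V: "V \<ge> 0" by (simp add: V_def)
    define e' where "e' = e / (M * V + 1)"
    have e': "e' > 0" using e V M by (simp add: e'_def add_nonneg_pos)
    obtain d where d: "d > 0" "\<And>x y. norm x \<le> r + 2 \<Longrightarrow> norm y \<le> r + 2 \<Longrightarrow> dist x y < d \<Longrightarrow>
        norm (grad \<rho> y - grad \<rho> x) < e'"
      using grad_uniformly_continuous_cball[OF \<rho>(1) e'] by metis
    show "\<exists>d>0. \<forall>y. norm (y - z) < d \<longrightarrow>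
        norm (correlation u \<rho> y - correlation u \<rho> z - ?D (y - z)) \<le> e * norm (y - z)"
    proof (intro exI[of _ "min d 1"] conjI allI impI)
      show "min d 1 > 0" using d by simp
      fix y assume y: "norm (y - z) < min d 1"
      let ?h = "y - z"
      let ?R = "\<lambda>\<zeta>. u \<zeta> * (\<rho> (\<zeta> - y) - \<rho> (\<zeta> - z) + grad \<rho> (\<zeta> - z) \<bullet> ?h)"
      have "correlation u \<rho> y - correlation u \<rho> z - ?D ?h = (\<integral>\<zeta>. ?R \<zeta> \<partial>lborel)"
        unfolding correlation_def
        by (subst Bochner_Integration.integral_diff[OF i\<rho> i\<rho>, symmetric],
            subst Bochner_Integration.integral_diff[OF Bochner_Integration.integrable_diff[OF i\<rho> i\<rho>] iD, symmetric])
          (simp add: algebra_simps)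
      also have "\<bar>\<dots>\<bar> \<le> (M * (norm ?h * e')) * measure lborel (cball z (r + 1))"
      proof (rule integrable_bounded_support(2))
        have "continuous_on UNIV (\<lambda>\<zeta>. \<rho> (\<zeta> - y) - \<rho> (\<zeta> - z) + grad \<rho> (\<zeta> - z) \<bullet> ?h)"
          by (intro continuous_intros continuous_on_compose2[OF smooth_continuous[OF \<rho>(1)]]
              continuous_on_compose2[OF continuous_grad[OF \<rho>(1)]]) auto
        then show "?R \<in> borel_measurable borel"
          using u(1) borel_measurable_continuous_onI by (intro borel_measurable_times) blast+
        fix \<zeta>
        show "\<bar>?R \<zeta>\<bar> \<le> M * (norm ?h * e') * indicator (cball z (r + 1)) \<zeta>"
        proof (cases "norm (\<zeta> - z) \<le> r + 1")
          case True
          have "\<bar>\<rho> (\<zeta> - y) - \<rho> (\<zeta> - z) - grad \<rho> (\<zeta> - z) \<bullet> (\<zeta> - y - (\<zeta> - z))\<bar>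
              \<le> norm (\<zeta> - y - (\<zeta> - z)) * e'"
          proof (rule grad_linearization[OF \<rho>(1)])
            fix \<xi> assume \<xi>: "\<xi> \<in> closed_segment (\<zeta> - z) (\<zeta> - y)"
            then have "dist \<xi> (\<zeta> - z) \<le> dist (\<zeta> - y) (\<zeta> - z)"
              using dist_in_closed_segment[OF \<xi>] by (simp add: dist_commute)
            also have "\<dots> = norm (y - z)" by (simp add: dist_norm norm_minus_commute)
            finally have \<xi>': "dist \<xi> (\<zeta> - z) < min d 1" using y by simp
            have "norm \<xi> \<le> norm (\<zeta> - z) + dist \<xi> (\<zeta> - z)"
              by (metis add.commute dist_norm norm_triangle_sub)
            then have "norm \<xi> \<le> r + 2" using \<xi>' True by simp
            then show "norm (grad \<rho> \<xi> - grad \<rho> (\<zeta> - z)) \<le> e'"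
              using \<xi>' True by (intro less_imp_le[OF d(2)]) (auto simp: dist_commute)
          qed
          then have "\<bar>\<rho> (\<zeta> - y) - \<rho> (\<zeta> - z) + grad \<rho> (\<zeta> - z) \<bullet> ?h\<bar> \<le> norm ?h * e'"
            by (simp add: inner_diff_right norm_minus_commute algebra_simps)
          then show ?thesis using True u(2)[of \<zeta>] M e'
            by (auto simp: abs_mult dist_norm norm_minus_commute intro!: mult_mono)
        next
          case False
          have "norm (\<zeta> - y) > r"
            using False y norm_triangle_ineq[of "\<zeta> - y" "y - z"] by auto
          then show ?thesis
            using False \<rho>(2) grad0[of "\<zeta> - z"] M e' by simp
        qed
      qed
      also have "\<dots> = e' * (M * V) * norm ?h" by (simp add: V_def)
      also have "\<dots> \<le> e' * (M * V + 1) * norm ?h"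
        using e' by (intro mult_right_mono mult_left_mono) auto
      also have "e' * (M * V + 1) = e" using V M by (simp add: e'_def add_nonneg_eq_0_iff)
      finally show "norm (correlation u \<rho> y - correlation u \<rho> z - ?D (y - z)) \<le> e * norm (y - z)"
        by simp
    qed
  qed
qed

text \<open>
  Every partial derivative of a correlation is again a correlation, with a partial derivative of the
  kernel.
\<close>

lemma smooth_correlation:
  fixes u \<rho> :: "'a::euclidean_space \<Rightarrow> real"
  assumes u: "u \<in> borel_measurable borel" "\<And>\<zeta>. \<bar>u \<zeta>\<bar> \<le> M"
    and "smooth \<rho>" "\<And>y. norm y > r \<Longrightarrow> \<rho> y = 0"
  shows "smooth (correlation u \<rho>)"
proof -
  have "Ck k (correlation u \<rho>)" for k
    using assms(3,4)
  proof (induction k arbitrary: \<rho>)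
    case 0
    then show ?case
      by (auto simp: continuous_on_eq_continuous_at
          intro!: has_derivative_continuous[OF correlation_has_derivative[OF u]])
  next
    case (Suc k)
    show ?case
    proof (rule Ck_SucI[OF correlation_has_derivative[OF u Suc.prems]])
      fix b :: 'a assume b: "b \<in> Basis"
      let ?\<rho> = "\<lambda>y. 0 - frechet_derivative \<rho> (at y) b"
      have "smooth ?\<rho>"
        by (intro smooth_diff smooth_const smooth_frechet_derivative Suc.prems(1) b)
      then have "Ck k (correlation u ?\<rho>)"
        by (rule Suc.IH) (subst grad_outside_support(1)[OF Suc.prems], auto)
      then show "Ck k (\<lambda>z. \<integral>\<zeta>. u \<zeta> * - (grad \<rho> (\<zeta> - z) \<bullet> b) \<partial>lborel)"
        by (simp add: correlation_def[abs_def] grad_inner_Basis[OF Suc.prems(1) b])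
    qed
  qed
  then show ?thesis by (simp add: smooth_def)
qed

section \<open>Controlled trajectories\<close>

text \<open>
  This says that \<open>f\<close> is absolutely continuous on \<open>[0,T]\<close> with derivative \<open>g\<close> (when \<open>g\<close> is absolutely
  integrable). The integral form makes gluing and time shifts immediate.
\<close>

definition antideriv :: "real \<Rightarrow> (real \<Rightarrow> 'a::euclidean_space) \<Rightarrow> (real \<Rightarrow> 'a) \<Rightarrow> bool" where
  "antideriv T f g \<longleftrightarrow> (\<forall>t. 0 \<le> t \<and> t \<le> T \<longrightarrow> (g has_integral (f t - f 0)) {0..t})"

lemma antideriv_interval:
  assumes "antideriv T f g" "0 \<le> a" "a \<le> b" "b \<le> T"
  shows "(g has_integral (f b - f a)) {a..b}"
proof -
  have b: "(g has_integral (f b - f 0)) {0..b}" and a: "(g has_integral (f a - f 0)) {0..a}"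
    using assms by (auto simp: antideriv_def)
  have "g integrable_on {a..b}"
    using integrable_on_subinterval[of g "{0..b}" a b] b assms by auto
  then obtain I where I: "(g has_integral I) {a..b}" by auto
  have "(g has_integral (f a - f 0 + I)) {0..b}"
    by (rule has_integral_combine[OF _ _ a I]) (use assms in auto)
  then have "f a - f 0 + I = f b - f 0" using b has_integral_unique by blast
  then have "I = f b - f a" by (simp add: algebra_simps)
  then show ?thesis using I by simp
qed

lemma antideriv_restrict: "antideriv T f g \<Longrightarrow> S \<le> T \<Longrightarrow> antideriv S f g"
  by (auto simp: antideriv_def)

lemma antideriv_shift:
  assumes "antideriv T f g" "0 \<le> a" "a + S \<le> T"
  shows "antideriv S (\<lambda>t. f (t + a)) (\<lambda>t. g (t + a))"
  unfolding antideriv_def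
proof (intro allI impI)
  fix t assume t: "0 \<le> t \<and> t \<le> S"
  have "(g has_integral (f (t + a) - f a)) {a..t + a}"
    by (rule antideriv_interval[OF assms(1)]) (use t assms in auto)
  then show "((\<lambda>t. g (t + a)) has_integral (f (t + a) - f (0 + a))) {0..t}"
    using has_integral_shift_real_ivl[of g "f (t + a) - f a" a "t + a" a] by simp
qed

lemma antideriv_cong:
  assumes "antideriv T f g" "\<And>t. 0 \<le> t \<Longrightarrow> t \<le> T \<Longrightarrow> f t = f' t"
    and "\<And>t. 0 < t \<Longrightarrow> t < T \<Longrightarrow> g t = g' t"
  shows "antideriv T f' g'"
  unfolding antideriv_def
proof (intro allI impI)
  fix t assume t: "0 \<le> t \<and> t \<le> T"
  have "(g has_integral (f t - f 0)) {0..t}" using assms(1) t by (auto simp: antideriv_def)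
  then have "(g has_integral (f' t - f' 0)) {0..t}" using assms(2)[of t] assms(2)[of 0] t by auto
  then show "(g' has_integral (f' t - f' 0)) {0..t}"
    using has_integral_spike_interior[of g _ 0 t g'] assms(3) t by (auto simp: box_real)
qed

lemma antideriv_glue:
  assumes "antideriv S f1 g1" "antideriv T f2 g2" "f1 S = f2 0" "0 \<le> S"
  shows "antideriv (S + T) (\<lambda>t. if t < S then f1 t else f2 (t - S)) (\<lambda>t. if t < S then g1 t else g2 (t - S))"
    (is "antideriv _ ?f ?g")
  unfolding antideriv_def
proof (intro allI impI)
  have f: "?f t = f1 t" if "t \<le> S" for t using assms(3) that by (cases "t = S") auto
  have left: "(?g has_integral (?f t - ?f 0)) {0..t}" if "0 \<le> t" "t \<le> S" for t
  proof -
    have "(g1 has_integral (?f t - ?f 0)) {0..t}"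
      using antideriv_interval[OF assms(1), of 0 t] that f[of t] f[of 0] by simp
    then show ?thesis
      using has_integral_spike_interior[of g1 _ 0 t ?g] that by (auto simp: box_real)
  qed
  fix t assume t: "0 \<le> t \<and> t \<le> S + T"
  show "(?g has_integral (?f t - ?f 0)) {0..t}"
  proof (cases "t \<le> S")
    case True
    then show ?thesis using left t by blast
  next
    case False
    have "(g2 has_integral (f2 (t - S) - f2 0)) {0..t - S}"
      by (rule antideriv_interval[OF assms(2)]) (use False t in auto)
    then have "((\<lambda>s. g2 (s - S)) has_integral (f2 (t - S) - f2 0)) {S..t}"
      using has_integral_shift_real_ivl[of g2 _ 0 "t - S" "- S"] by simp
    then have "(?g has_integral (?f t - ?f S)) {S..t}"
      using has_integral_spike_interior[of "\<lambda>s. g2 (s - S)" _ S t ?g] False by (auto simp: box_real)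
    from has_integral_combine[OF _ _ left[of S] this]
    show ?thesis using False assms(4) by simp
  qed
qed

lemma antideriv_add:
  "antideriv T f1 g1 \<Longrightarrow> antideriv T f2 g2 \<Longrightarrow> antideriv T (\<lambda>t. f1 t + f2 t) (\<lambda>t. g1 t + g2 t)"
  unfolding antideriv_def
proof (intro allI impI)
  fix t assume "\<forall>t. 0 \<le> t \<and> t \<le> T \<longrightarrow> (g1 has_integral f1 t - f1 0) {0..t}"
    "\<forall>t. 0 \<le> t \<and> t \<le> T \<longrightarrow> (g2 has_integral f2 t - f2 0) {0..t}" "0 \<le> t \<and> t \<le> T"
  then have "((\<lambda>t. g1 t + g2 t) has_integral ((f1 t - f1 0) + (f2 t - f2 0))) {0..t}"
    by (intro has_integral_add) auto
  then show "((\<lambda>t. g1 t + g2 t) has_integral (f1 t + f2 t - (f1 0 + f2 0))) {0..t}"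
    by (simp add: algebra_simps)
qed

lemma antideriv_has_vector_derivative:
  assumes "\<And>t. 0 \<le> t \<Longrightarrow> t \<le> T \<Longrightarrow> (f has_vector_derivative g t) (at t)"
  shows "antideriv T f g"
  unfolding antideriv_def
proof (intro allI impI)
  fix t assume t: "0 \<le> t \<and> t \<le> T"
  show "(g has_integral (f t - f 0)) {0..t}"
    by (rule fundamental_theorem_of_calculus)
      (use t assms in \<open>auto intro: has_vector_derivative_at_within\<close>)
qed

lemma antideriv_continuous:
  assumes "antideriv T f g" shows "continuous_on {0..T} f"
proof (cases "0 \<le> T")
  case True
  have "g integrable_on {0..T}" using assms True by (auto simp: antideriv_def)
  then have "continuous_on {0..T} (\<lambda>t. f 0 + integral {0..t} g)"
    by (intro continuous_intros indefinite_integral_continuous_1)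
  then show ?thesis
  proof (rule continuous_on_eq)
    fix t assume "t \<in> {0..T}"
    then have "(g has_integral (f t - f 0)) {0..t}" using assms by (auto simp: antideriv_def)
    then show "f 0 + integral {0..t} g = f t" by (simp add: integral_unique)
  qed
qed auto

text \<open>
  Trajectories of the control system \<open>x' = v\<close>, \<open>v' = w\<close> on \<open>[0,T]\<close>. The control is Borel on the whole
  line so that shifted and glued controls stay measurable without reference to the interval.
\<close>

definition traj :: "real \<Rightarrow> (real \<Rightarrow> 'a::euclidean_space) \<Rightarrow> (real \<Rightarrow> 'a) \<Rightarrow> (real \<Rightarrow> 'a) \<Rightarrow> bool" where
  "traj T x v w \<longleftrightarrow> w \<in> borel_measurable borel \<and> set_integrable lborel {0..T} (\<lambda>s. (norm (w s))\<^sup>2)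
     \<and> antideriv T v w \<and> antideriv T x v"

lemma traj_measurable: "traj T x v w \<Longrightarrow> w \<in> borel_measurable borel"
  and traj_square: "traj T x v w \<Longrightarrow> set_integrable lborel {0..T} (\<lambda>s. (norm (w s))\<^sup>2)"
  and traj_v: "traj T x v w \<Longrightarrow> antideriv T v w"
  and traj_x: "traj T x v w \<Longrightarrow> antideriv T x v"
  by (auto simp: traj_def)

lemma traj_restrict:
  assumes "traj T x v w" "S \<le> T" shows "traj S x v w"
  using assms unfolding traj_def
  by (auto intro: antideriv_restrict set_integrable_subset)

lemma set_integrable_shift:
  fixes g :: "real \<Rightarrow> 'a::euclidean_space"
  assumes "set_integrable lborel {a + c..b + c} g"
  shows "set_integrable lborel {a..b} (\<lambda>t. g (t + c))"
proof -
  have "integrable lborel (\<lambda>x. indicator {a + c..b + c} (c + 1 *\<^sub>R x) *\<^sub>R g (c + 1 *\<^sub>R x))"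
    using assms lborel_integrable_real_affine[of "\<lambda>x. indicator {a + c..b + c} x *\<^sub>R g x" 1 c]
    by (simp add: set_integrable_def)
  moreover have "indicator {a + c..b + c} (c + x) = (indicator {a..b} x :: real)" for x
    by (auto simp: indicator_def)
  ultimately show ?thesis by (simp add: set_integrable_def add.commute)
qed

lemma traj_shift:
  assumes "traj T x v w" "0 \<le> a" "a + S \<le> T"
  shows "traj S (\<lambda>t. x (t + a)) (\<lambda>t. v (t + a)) (\<lambda>t. w (t + a))"
  unfolding traj_def
proof (intro conjI antideriv_shift[OF _ assms(2,3)])
  show "(\<lambda>t. w (t + a)) \<in> borel_measurable borel"
    using traj_measurable[OF assms(1)] by measurable
  show "set_integrable lborel {0..S} (\<lambda>s. (norm (w (s + a)))\<^sup>2)"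
    by (rule set_integrable_shift, rule set_integrable_subset[OF traj_square[OF assms(1)]])
      (use assms in auto)
qed (use assms in \<open>auto intro: traj_v traj_x\<close>)

definition glue :: "real \<Rightarrow> (real \<Rightarrow> 'a) \<Rightarrow> (real \<Rightarrow> 'a) \<Rightarrow> real \<Rightarrow> 'a" where
  "glue S f g t = (if t < S then f t else g (t - S))"

lemma traj_glue:
  assumes 1: "traj S x1 v1 w1" and 2: "traj T x2 v2 w2"
    and "x1 S = x2 0" "v1 S = v2 0" "0 \<le> S" "0 \<le> T"
  shows "traj (S + T) (glue S x1 x2) (glue S v1 v2) (glue S w1 w2)"
  unfolding traj_def
proof (intro conjI)
  show "glue S w1 w2 \<in> borel_measurable borel"
    using traj_measurable[OF 1] traj_measurable[OF 2] unfolding glue_def[abs_def] by measurable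
  show "antideriv (S + T) (glue S v1 v2) (glue S w1 w2)" "antideriv (S + T) (glue S x1 x2) (glue S v1 v2)"
    using antideriv_glue[OF traj_v[OF 1] traj_v[OF 2]] antideriv_glue[OF traj_x[OF 1] traj_x[OF 2]] assms(3-)
    by (auto simp: glue_def[abs_def])
  have "set_integrable lborel {S..S + T} (\<lambda>s. (norm (w2 (s + (- S))))\<^sup>2)"
    by (rule set_integrable_shift) (use traj_square[OF 2] in simp)
  then have "set_integrable lborel {S..S + T} (\<lambda>s. (norm (glue S w1 w2 s))\<^sup>2)"
    by (rule set_integrable_cong[THEN iffD1, rotated -1]) (auto simp: glue_def)
  moreover have "set_integrable lborel {0..<S} (\<lambda>s. (norm (w1 s))\<^sup>2)"
    by (rule set_integrable_subset[OF traj_square[OF 1]]) auto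
  then have "set_integrable lborel {0..<S} (\<lambda>s. (norm (glue S w1 w2 s))\<^sup>2)"
    by (rule set_integrable_cong[THEN iffD1, rotated -1]) (auto simp: glue_def)
  ultimately have "set_integrable lborel ({0..<S} \<union> {S..S + T}) (\<lambda>s. (norm (glue S w1 w2 s))\<^sup>2)"
    by (intro set_integrable_Un) auto
  then show "set_integrable lborel {0..S + T} (\<lambda>s. (norm (glue S w1 w2 s))\<^sup>2)"
    using assms by (simp add: ivl_disj_un_two)
qed

lemma glue_0 [simp]: "0 \<le> S \<Longrightarrow> f S = g 0 \<Longrightarrow> glue S f g 0 = f 0"
  by (auto simp: glue_def)

lemma glue_end [simp]: "0 \<le> T \<Longrightarrow> glue S f g (S + T) = g T"
  by (auto simp: glue_def)

lemma le_one_plus_square: "n \<le> 1 + n\<^sup>2" for n :: real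
proof -
  have "0 \<le> (n - 1)\<^sup>2" "0 \<le> n\<^sup>2" by simp_all
  then show ?thesis unfolding power2_diff one_power2 mult_1_right by linarith
qed

lemma borel_square_integrable_imp_integrable:
  fixes w :: "real \<Rightarrow> 'a::euclidean_space"
  assumes "w \<in> borel_measurable borel" "set_integrable lborel {0..T} (\<lambda>s. (norm (w s))\<^sup>2)"
  shows "set_integrable lborel {0..T} w"
proof -
  have "set_integrable lborel {0..T} (\<lambda>s. 1 + (norm (w s))\<^sup>2)"
    by (intro set_integral_add assms(2) borel_integrable_atLeastAtMost') auto
  then have "integrable lborel (\<lambda>s. indicator {0..T} s *\<^sub>R (1 + (norm (w s))\<^sup>2))"
    by (simp add: set_integrable_def)
  then have "integrable lborel (\<lambda>s. indicator {0..T} s *\<^sub>R w s)"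
  proof (rule Bochner_Integration.integrable_bound)
    show "(\<lambda>s. indicator {0..T} s *\<^sub>R w s) \<in> borel_measurable lborel"
      using assms(1) by measurable
    show "AE s in lborel. norm (indicator {0..T} s *\<^sub>R w s)
        \<le> norm (indicator {0..T} s *\<^sub>R (1 + (norm (w s))\<^sup>2))"
      using le_one_plus_square by (intro AE_I2) (simp add: indicator_def)
  qed
  then show ?thesis by (simp add: set_integrable_def)
qed

lemma traj_integrable: "traj T x v w \<Longrightarrow> set_integrable lborel {0..T} w"
  by (rule borel_square_integrable_imp_integrable[OF traj_measurable traj_square])

lemma set_integrable_imp_absolutely_integrable:
  fixes f :: "real \<Rightarrow> 'a::euclidean_space"
  assumes "set_integrable lborel S f" "S \<in> sets borel"
  shows "f absolutely_integrable_on S"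
proof -
  have "(\<lambda>x. indicator S x *\<^sub>R f x) \<in> borel_measurable lborel"
    using assms(1) unfolding set_integrable_def by (rule borel_measurable_integrable)
  then show ?thesis
    using assms(1) by (simp add: set_integrable_def integrable_completion)
qed

definition running_cost :: "('a::euclidean_space \<times> 'a \<Rightarrow> real) \<Rightarrow> (real \<Rightarrow> 'a) \<Rightarrow> (real \<Rightarrow> 'a) \<Rightarrow> (real \<Rightarrow> 'a) \<Rightarrow> real \<Rightarrow> real" where
  "running_cost f x v w s = (norm (w s))\<^sup>2 / 2 + f (x s, v s)"

definition cost :: "('a::euclidean_space \<times> 'a \<Rightarrow> real) \<Rightarrow> real \<Rightarrow> (real \<Rightarrow> 'a) \<Rightarrow> (real \<Rightarrow> 'a) \<Rightarrow> (real \<Rightarrow> 'a) \<Rightarrow> real" where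
  "cost f T x v w = integral {0..T} (running_cost f x v w)"

lemma traj_continuous:
  assumes "traj T x v w" "continuous_on UNIV f"
  shows "continuous_on {0..T} (\<lambda>s. f (x s, v s))"
  by (rule continuous_on_compose2[OF assms(2)])
    (auto intro!: continuous_intros antideriv_continuous[OF traj_v[OF assms(1)]]
      antideriv_continuous[OF traj_x[OF assms(1)]])

lemma running_cost_set_integrable:
  assumes "traj T x v w" "continuous_on UNIV f"
  shows "set_integrable lborel {0..T} (running_cost f x v w)"
  unfolding running_cost_def
  by (intro set_integral_add borel_integrable_atLeastAtMost' traj_continuous[OF assms]
      set_integrable_divide traj_square[OF assms(1)])

lemma running_cost_integrable:
  assumes "traj T x v w" "continuous_on UNIV f" "0 \<le> a" "b \<le> T"
  shows "running_cost f x v w integrable_on {a..b}"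
  using set_borel_integral_eq_integral(1)[OF set_integrable_subset[OF
      running_cost_set_integrable[OF assms(1,2)], of "{a..b}"]] assms(3,4) by auto

lemma cost_glue:
  assumes 1: "traj S x1 v1 w1" and 2: "traj T x2 v2 w2" and f: "continuous_on UNIV f"
    and "x1 S = x2 0" "v1 S = v2 0" "0 \<le> S" "0 \<le> T"
  shows "cost f (S + T) (glue S x1 x2) (glue S v1 v2) (glue S w1 w2)
    = cost f S x1 v1 w1 + cost f T x2 v2 w2"
proof -
  let ?L = "running_cost f (glue S x1 x2) (glue S v1 v2) (glue S w1 w2)"
  let ?L1 = "running_cost f x1 v1 w1" and ?L2 = "running_cost f x2 v2 w2"
  have "(?L1 has_integral cost f S x1 v1 w1) {0..S}"
    unfolding cost_def using running_cost_integrable[OF 1 f] by (intro integrable_integral) auto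
  then have a: "(?L has_integral cost f S x1 v1 w1) {0..S}"
    using has_integral_spike_interior[of ?L1 _ 0 S ?L] by (auto simp: box_real running_cost_def glue_def)
  have "(?L2 has_integral cost f T x2 v2 w2) {0..T}"
    unfolding cost_def using running_cost_integrable[OF 2 f] by (intro integrable_integral) auto
  then have "((\<lambda>s. ?L2 (s - S)) has_integral cost f T x2 v2 w2) {S..S + T}"
    using has_integral_shift_real_ivl[of ?L2 _ 0 T "- S"] by (simp add: add.commute)
  then have b: "(?L has_integral cost f T x2 v2 w2) {S..S + T}"
    using has_integral_spike_interior[of "\<lambda>s. ?L2 (s - S)" _ S "S + T" ?L]
    by (auto simp: box_real running_cost_def glue_def)
  show ?thesis
    using has_integral_combine[OF _ _ a b] assms unfolding cost_def by (intro integral_unique) auto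
qed

lemma cost_split:
  assumes "traj T x v w" "continuous_on UNIV f" "0 \<le> a" "a \<le> T"
  shows "cost f T x v w = cost f a x v w + cost f (T - a) (\<lambda>t. x (t + a)) (\<lambda>t. v (t + a)) (\<lambda>t. w (t + a))"
proof -
  let ?L = "running_cost f x v w"
  have "integral {0..a} ?L + integral {a..T} ?L = integral {0..T} ?L"
    by (rule Henstock_Kurzweil_Integration.integral_combine)
      (use assms running_cost_integrable[OF assms(1,2)] in auto)
  moreover have "((\<lambda>t. ?L (t + a)) has_integral integral {a..T} ?L) {0..T - a}"
    using has_integral_shift_real_ivl[of ?L "integral {a..T} ?L" a T a]
      integrable_integral[OF running_cost_integrable[OF assms(1,2), of a T]] assms by simp
  ultimately show ?thesis
    unfolding cost_def running_cost_def[abs_def] by (auto dest!: integral_unique)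
qed

lemma cost_nonneg:
  assumes "\<And>z. f z \<ge> 0" shows "cost f T x v w \<ge> 0"
proof (cases "running_cost f x v w integrable_on {0..T}")
  case True
  then show ?thesis
    unfolding cost_def using assms
    by (intro Henstock_Kurzweil_Integration.integral_nonneg) (auto simp: running_cost_def)
next
  case False
  then show ?thesis by (simp add: cost_def not_integrable_integral)
qed

text \<open>
  The sets over which the integral of \<open>f\<close> vanishes form a Dynkin system, and the open half lines are
  an intersection-stable generator of the Borel sets.
\<close>

lemma AE_eq_0_of_integrals_Ioi:
  fixes f :: "real \<Rightarrow> real"
  assumes f: "integrable lborel f" and 0: "\<And>a. (LBINT t:{a<..}. f t) = 0"
  shows "AE t in lborel. f t = 0"
proof -
  have si: "set_integrable lborel A f" if "A \<in> sets borel" for A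
    using integrable_mult_indicator[OF _ f, of A] that by (simp add: set_integrable_def)
  have univ: "(LBINT t:UNIV. f t) = 0"
  proof -
    have "((\<lambda>n::nat. LBINT t:{- real n<..}. f t) \<longlonglongrightarrow> (LBINT t:(\<Union>n. {- real n<..}). f t))"
      by (rule set_integral_cont_up) (auto intro!: si simp: incseq_def)
    moreover have "(\<Union>n. {- real n<..}) = (UNIV::real set)"
      by (auto simp: minus_less_iff reals_Archimedean2)
    ultimately have "(\<lambda>n::nat. 0) \<longlonglongrightarrow> (LBINT t:UNIV. f t)" using 0 by simp
    then show ?thesis by (simp add: LIMSEQ_const_iff)
  qed
  have "(LBINT t:A. f t) = 0" if "A \<in> sigma_sets UNIV (range greaterThan)" for A
  proof (rule sigma_sets_induct_disjoint[OF _ _ that])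
    show "Int_stable (range (greaterThan::real \<Rightarrow> _))"
      by (auto simp: Int_stable_def lessThan_Int_lessThan greaterThan_Int_greaterThan)
    fix A assume A: "A \<in> sigma_sets UNIV (range (greaterThan::real \<Rightarrow> _))" "(LBINT t:A. f t) = 0"
    then have Ab: "A \<in> sets borel" by (simp add: borel_Ioi)
    have "(LBINT t:A \<union> (UNIV - A). f t) = (LBINT t:A. f t) + (LBINT t:(UNIV - A). f t)"
      by (rule set_integral_Un) (use Ab in \<open>auto intro!: si\<close>)
    then show "(LBINT t:UNIV - A. f t) = 0" using A univ by simp
  next
    fix A :: "nat \<Rightarrow> real set"
    assume A: "disjoint_family A" "range A \<subseteq> sigma_sets UNIV (range greaterThan)" "\<And>i. (LBINT t:A i. f t) = 0"
    then have Ab: "A i \<in> sets borel" for i by (auto simp: borel_Ioi)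
    have "(LBINT t:(\<Union>i. A i). f t) = (\<Sum>i. LBINT t:A i. f t)"
      by (rule lebesgue_integral_countable_add) (use A Ab in \<open>auto intro!: si simp: disjoint_family_on_def\<close>)
    then show "(LBINT t:(\<Union>i. A i). f t) = 0" using A by simp
  qed (use 0 in \<open>auto simp: set_lebesgue_integral_def\<close>)
  then have "(LBINT t:A. f t) = (LBINT t:A. 0)" if "A \<in> sets lborel" for A
    using that by (simp add: borel_Ioi set_lebesgue_integral_def)
  then show ?thesis using density_unique_real[of lborel f "\<lambda>_. 0"] f by simp
qed

text \<open>
  The cost of a trajectory does not depend on the choice of the control within its class. This is
  needed because the action of a curve is defined with a chosen weak derivative.
\<close>

lemma antideriv_unique_AE:
  fixes w1 w2 :: "real \<Rightarrow> 'a::euclidean_space"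
  assumes 1: "antideriv T v w1" "set_integrable lborel {0..T} w1"
    and 2: "antideriv T v w2" "set_integrable lborel {0..T} w2" and "0 \<le> T"
  shows "AE t in lborel. t \<in> {0..T} \<longrightarrow> w1 t = w2 t"
proof -
  have "AE t in lborel. indicator {0..T} t * ((w1 t - w2 t) \<bullet> b) = 0" if "b \<in> Basis" for b
  proof (rule AE_eq_0_of_integrals_Ioi)
    let ?d = "\<lambda>t. (w1 t - w2 t) \<bullet> b"
    have "set_integrable lborel {0..T} (\<lambda>t. w1 t - w2 t)" using 1 2 by auto
    then have "integrable lborel (\<lambda>t. (indicator {0..T} t *\<^sub>R (w1 t - w2 t)) \<bullet> b)"
      unfolding set_integrable_def by (rule integrable_inner_left)
    then show *: "integrable lborel (\<lambda>t. indicator {0..T} t * ?d t)" by simp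
    then have si: "set_integrable lborel {0..T} ?d" by (simp add: set_integrable_def)
    fix a :: real
    have d: "(?d has_integral 0) {a..b}" if "0 \<le> a" "a \<le> b" "b \<le> T" for a b
    proof -
      have "((\<lambda>t. w1 t - w2 t) has_integral ((v b - v a) - (v b - v a))) {a..b}"
        by (intro has_integral_diff antideriv_interval[OF 1(1)] antideriv_interval[OF 2(1)] that)
      from has_integral_linear[OF this bounded_linear_inner_left] show ?thesis by (simp add: o_def)
    qed
    define c where "c = max 0 a"
    have "(LBINT t:{a<..}. indicator {0..T} t * ?d t) = (LBINT t:{c..T}. ?d t)"
      unfolding set_lebesgue_integral_def
    proof (rule integral_cong_AE)
      show "AE t in lborel. indicator {a<..} t *\<^sub>R (indicator {0..T} t * ?d t) = indicator {c..T} t *\<^sub>R ?d t"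
        using AE_lborel_singleton[of a] by eventually_elim (auto simp: indicator_def c_def)
      have "(\<lambda>t. indicator {0..T} t * ?d t) \<in> borel_measurable lborel"
        using * by (rule borel_measurable_integrable)
      then show "(\<lambda>t. indicator {a<..} t *\<^sub>R (indicator {0..T} t * ?d t)) \<in> borel_measurable lborel"
        by (intro borel_measurable_scaleR) auto
      have "set_integrable lborel {c..T} ?d"
        by (rule set_integrable_subset[OF si]) (auto simp: c_def)
      then show "(\<lambda>t. indicator {c..T} t *\<^sub>R ?d t) \<in> borel_measurable lborel"
        unfolding set_integrable_def by (rule borel_measurable_integrable)
    qed
    also have "\<dots> = integral {c..T} ?d"
      by (rule set_borel_integral_eq_integral(2), rule set_integrable_subset[OF si]) (auto simp: c_def)
    also have "\<dots> = 0"
      using d[of c T] by (cases "c \<le> T") (auto simp: c_def intro: integral_unique)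
    finally show "(LBINT t:{a<..}. indicator {0..T} t * ?d t) = 0" .
  qed
  then have "AE t in lborel. \<forall>b\<in>Basis. indicator {0..T} t * ((w1 t - w2 t) \<bullet> b) = 0"
    by (intro AE_finite_allI) auto
  then show ?thesis
  proof eventually_elim
    case (elim t)
    show ?case
    proof
      assume "t \<in> {0..T}"
      then have "\<forall>b\<in>Basis. (w1 t - w2 t) \<bullet> b = 0" using elim by auto
      then have "w1 t - w2 t = 0" by (simp add: euclidean_all_zero_iff)
      then show "w1 t = w2 t" by simp
    qed
  qed
qed

section \<open>Weak derivatives of continuous functions\<close>

lemma real_smooth_deriv:
  fixes \<phi> :: "real \<Rightarrow> real"
  assumes "smooth \<phi>"
  shows "(\<phi> has_real_derivative deriv \<phi> t) (at t)" "continuous_on UNIV (deriv \<phi>)"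
proof -
  have *: "(\<phi> has_real_derivative grad \<phi> t) (at t)" for t
    using has_derivative_grad[OF assms, of t] by (simp add: has_field_derivative_def)
  then have "deriv \<phi> = grad \<phi>" by (auto intro: DERIV_imp_deriv)
  then show "(\<phi> has_real_derivative deriv \<phi> t) (at t)" "continuous_on UNIV (deriv \<phi>)"
    using * continuous_grad[OF assms] by auto
qed

lemma test_interval_zero:
  assumes "\<phi> \<in> test_interval T" "t \<notin> {0<..<T}"
  shows "\<phi> t = 0"
  using assms closure_subset[of "{t. \<phi> t \<noteq> 0}"] by (auto simp: test_interval_def)

lemma set_integrable_Pair:
  fixes f :: "real \<Rightarrow> 'a::euclidean_space" and g :: "real \<Rightarrow> 'b::euclidean_space"
  assumes "set_integrable lborel A f" "set_integrable lborel A g"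
  shows "set_integrable lborel A (\<lambda>t. (f t, g t))"
proof -
  have "integrable lborel (\<lambda>t. (indicator A t *\<^sub>R f t, 0::'b))"
    using integrable_bounded_linear[OF bounded_linear_Pair[OF bounded_linear_ident bounded_linear_zero]
        assms(1)[unfolded set_integrable_def]] .
  moreover have "integrable lborel (\<lambda>t. (0::'a, indicator A t *\<^sub>R g t))"
    using integrable_bounded_linear[OF bounded_linear_Pair[OF bounded_linear_zero bounded_linear_ident]
        assms(2)[unfolded set_integrable_def]] .
  ultimately have "integrable lborel (\<lambda>t. (indicator A t *\<^sub>R f t, 0::'b) + (0::'a, indicator A t *\<^sub>R g t))"
    by (rule Bochner_Integration.integrable_add)
  then show ?thesis by (simp add: set_integrable_def)
qed

lemma antideriv_Pair:
  fixes f1 :: "real \<Rightarrow> 'a::euclidean_space" and f2 :: "real \<Rightarrow> 'b::euclidean_space"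
  assumes "antideriv T f1 g1" "antideriv T f2 g2"
  shows "antideriv T (\<lambda>t. (f1 t, f2 t)) (\<lambda>t. (g1 t, g2 t))"
  unfolding antideriv_def
proof (intro allI impI)
  fix t assume t: "0 \<le> t \<and> t \<le> T"
  have "((\<lambda>t. (g1 t, 0::'b)) has_integral (f1 t - f1 0, 0)) {0..t}"
    using has_integral_linear[OF _ bounded_linear_Pair[OF bounded_linear_ident bounded_linear_zero], of g1]
      assms(1) t by (auto simp: antideriv_def o_def)
  moreover have "((\<lambda>t. (0::'a, g2 t)) has_integral (0, f2 t - f2 0)) {0..t}"
    using has_integral_linear[OF _ bounded_linear_Pair[OF bounded_linear_zero bounded_linear_ident], of g2]
      assms(2) t by (auto simp: antideriv_def o_def)
  ultimately have "((\<lambda>t. (g1 t, 0) + (0, g2 t)) has_integral ((f1 t - f1 0, 0) + (0, f2 t - f2 0))) {0..t}"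
    by (rule has_integral_add)
  then show "((\<lambda>t. (g1 t, g2 t)) has_integral ((f1 t, f2 t) - (f1 0, f2 0))) {0..t}" by simp
qed

text \<open>
  The chain rule for \<open>(t, y) \<mapsto> \<phi> t * (y \<bullet> b)\<close> along the curve \<open>t \<mapsto> (t, v t)\<close>.
\<close>

lemma antideriv_by_parts:
  fixes v w :: "real \<Rightarrow> 'a::euclidean_space"
  assumes "antideriv T v w" "set_integrable lborel {0..T} w" "0 \<le> T" "smooth \<phi>"
  shows "((\<lambda>t. deriv \<phi> t * (v t \<bullet> b) + \<phi> t * (w t \<bullet> b)) has_integral
    (\<phi> T * (v T \<bullet> b) - \<phi> 0 * (v 0 \<bullet> b))) {0..T}"
proof -
  let ?f = "\<lambda>p::real \<times> 'a. \<phi> (fst p) * (snd p \<bullet> b)"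
  have lin: "smooth (fst :: real \<times> 'a \<Rightarrow> real)" "smooth (\<lambda>p::real \<times> 'a. snd p \<bullet> b)"
    by (simp_all add: smooth_def Ck_bounded_linear bounded_linear_fst bounded_linear_inner_left_comp
        bounded_linear_snd)
  have sm: "smooth ?f"
    by (rule smooth_mult[OF smooth_compose_real[OF assms(4) lin(1)] lin(2)])
  have g: "grad ?f (t, y) \<bullet> (1, z) = deriv \<phi> t * (y \<bullet> b) + \<phi> t * (z \<bullet> b)" for t y z
  proof -
    have "(?f has_derivative (\<lambda>h. \<phi> t * (snd h \<bullet> b) + (deriv \<phi> t * fst h) * (y \<bullet> b))) (at (t, y))"
    proof -
      have "((\<lambda>p::real \<times> 'a. \<phi> (fst p)) has_derivative (\<lambda>h. deriv \<phi> t * fst h)) (at (t, y))"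
        by (rule has_derivative_compose[OF has_derivative_fst[OF has_derivative_ident]])
          (use real_smooth_deriv(1)[OF assms(4), of t] in \<open>simp add: has_field_derivative_def\<close>)
      moreover have "((\<lambda>p::real \<times> 'a. snd p \<bullet> b) has_derivative (\<lambda>h. snd h \<bullet> b)) (at (t, y))"
        by (intro bounded_linear_imp_has_derivative bounded_linear_inner_left_comp bounded_linear_snd)
      ultimately show ?thesis
        using has_derivative_mult[of "\<lambda>p::real \<times> 'a. \<phi> (fst p)" _ "(t, y)" UNIV "\<lambda>p. snd p \<bullet> b"] by auto
    qed
    then have "(\<lambda>h. grad ?f (t, y) \<bullet> h) = (\<lambda>h. \<phi> t * (snd h \<bullet> b) + (deriv \<phi> t * fst h) * (y \<bullet> b))"
      using has_derivative_grad[OF sm] has_derivative_unique by blast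
    from fun_cong[OF this, of "(1, z)"] show ?thesis by simp
  qed
  have "((\<lambda>t. grad ?f (t, v t) \<bullet> (1, w t)) has_integral (?f (T, v T) - ?f (0, v 0))) {0..T}"
  proof (rule chain_rule_absolutely_continuous[OF sm assms(3)])
    have "set_integrable lborel {0..T} (\<lambda>t. (1::real, w t))"
      by (intro set_integrable_Pair borel_integrable_atLeastAtMost' assms(2)) auto
    then show "(\<lambda>t. (1::real, w t)) absolutely_integrable_on {0..T}"
      by (rule set_integrable_imp_absolutely_integrable) auto
    have "antideriv T (\<lambda>t. t) (\<lambda>_. 1::real)"
      by (rule antideriv_has_vector_derivative) (auto intro!: derivative_eq_intros)
    then have "antideriv T (\<lambda>t. (t, v t)) (\<lambda>t. (1, w t))" using assms(1) by (rule antideriv_Pair)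
    then show "((\<lambda>t. (1::real, w t)) has_integral ((t, v t) - (0, v 0))) {0..t}" if "0 \<le> t" "t \<le> T" for t
      using that by (auto simp: antideriv_def)
  qed
  then show ?thesis by (simp add: g)
qed

lemma set_integral_Ioo_Icc:
  fixes g :: "real \<Rightarrow> 'a::euclidean_space"
  shows "(LBINT t:{0<..<T}. g t) = (LBINT t:{0..T}. g t)"
    and "set_integrable lborel {0<..<T} g \<longleftrightarrow> set_integrable lborel {0..T} g"
proof -
  define A where "A = {0..T} - {0<..<T}"
  have A: "finite A" by (rule finite_subset[of _ "{0, T}"]) (auto simp: A_def)
  define h where "h t = (\<Sum>a\<in>A. indicator {a} t *\<^sub>R g a)" for t
  have h: "integrable lborel h"
    unfolding h_def by (intro Bochner_Integration.integrable_sum integrable_scaleR_left integrable_real_indicator) auto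
  have "integral\<^sup>L lborel h = (\<Sum>a\<in>A. integral\<^sup>L lborel (\<lambda>t. indicator {a} t *\<^sub>R g a))"
    unfolding h_def by (intro Bochner_Integration.integral_sum integrable_scaleR_left integrable_real_indicator) auto
  then have h0: "integral\<^sup>L lborel h = 0" by simp
  have "h t = indicator A t *\<^sub>R g t" for t
  proof -
    have "h t = (\<Sum>a\<in>A. if t = a then g a else 0)"
      unfolding h_def by (rule sum.cong) (auto simp: indicator_def)
    then show ?thesis using A by (simp add: indicator_def)
  qed
  then have eq: "(\<lambda>t. indicator {0..T} t *\<^sub>R g t) = (\<lambda>t. indicator {0<..<T} t *\<^sub>R g t + h t)"
    by (intro ext) (auto simp: A_def indicator_def of_bool_def)
  have eq': "(\<lambda>t. indicator {0<..<T} t *\<^sub>R g t) = (\<lambda>t. indicator {0..T} t *\<^sub>R g t - h t)"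
    by (rule ext) (simp add: fun_cong[OF eq])
  show *: "set_integrable lborel {0<..<T} g \<longleftrightarrow> set_integrable lborel {0..T} g"
    unfolding set_integrable_def
  proof
    assume "integrable lborel (\<lambda>t. indicator {0<..<T} t *\<^sub>R g t)"
    then show "integrable lborel (\<lambda>t. indicator {0..T} t *\<^sub>R g t)"
      unfolding eq using h by (rule Bochner_Integration.integrable_add)
  next
    assume "integrable lborel (\<lambda>t. indicator {0..T} t *\<^sub>R g t)"
    then show "integrable lborel (\<lambda>t. indicator {0<..<T} t *\<^sub>R g t)"
      unfolding eq' using h by (rule Bochner_Integration.integrable_diff)
  qed
  show "(LBINT t:{0<..<T}. g t) = (LBINT t:{0..T}. g t)"
  proof (cases "set_integrable lborel {0<..<T} g")
    case True
    then show ?thesis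
      unfolding set_lebesgue_integral_def eq
      using Bochner_Integration.integral_add[OF True[unfolded set_integrable_def] h] h0 by simp
  next
    case False
    then show ?thesis
      using * unfolding set_lebesgue_integral_def set_integrable_def
      by (simp add: not_integrable_integral_eq)
  qed
qed

lemma set_integrable_continuous_scaleR:
  fixes w :: "real \<Rightarrow> 'a::euclidean_space"
  assumes "set_integrable lborel {a..b} w" "continuous_on {a..b} \<phi>"
  shows "set_integrable lborel {a..b} (\<lambda>t. \<phi> t *\<^sub>R w t)"
proof -
  obtain C where C: "\<And>t. t \<in> {a..b} \<Longrightarrow> \<bar>\<phi> t\<bar> \<le> C"
    using compact_imp_bounded[OF compact_continuous_image[OF assms(2) compact_Icc]]
    unfolding bounded_iff by (metis image_eqI real_norm_def)
  have "integrable lborel (\<lambda>t. C *\<^sub>R (indicator {a..b} t *\<^sub>R w t))"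
    using assms(1) unfolding set_integrable_def by (rule integrable_scaleR_right)
  then have "integrable lborel (\<lambda>t. (indicator {a..b} t *\<^sub>R \<phi> t) *\<^sub>R (indicator {a..b} t *\<^sub>R w t))"
  proof (rule Bochner_Integration.integrable_bound)
    have "(\<lambda>t. indicator {a..b} t *\<^sub>R \<phi> t) \<in> borel_measurable lborel"
      using borel_integrable_atLeastAtMost'[OF assms(2)] unfolding set_integrable_def
      by (rule borel_measurable_integrable)
    moreover have "(\<lambda>t. indicator {a..b} t *\<^sub>R w t) \<in> borel_measurable lborel"
      using assms(1) unfolding set_integrable_def by (rule borel_measurable_integrable)
    ultimately show "(\<lambda>t. (indicator {a..b} t *\<^sub>R \<phi> t) *\<^sub>R (indicator {a..b} t *\<^sub>R w t)) \<in> borel_measurable lborel"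
      by (rule borel_measurable_scaleR)
    show "AE t in lborel. norm ((indicator {a..b} t *\<^sub>R \<phi> t) *\<^sub>R (indicator {a..b} t *\<^sub>R w t))
        \<le> norm (C *\<^sub>R (indicator {a..b} t *\<^sub>R w t))"
      using C by (intro AE_I2) (force simp: indicator_def intro!: mult_right_mono)
  qed
  then show ?thesis unfolding set_integrable_def
    by (rule back_subst[of "integrable lborel"]) (auto simp: indicator_def)
qed

lemma set_integrable_continuous_inner:
  fixes f g :: "real \<Rightarrow> 'a::euclidean_space"
  assumes "continuous_on {a..b} f" "set_integrable lborel {a..b} g"
  shows "set_integrable lborel {a..b} (\<lambda>t. f t \<bullet> g t)"
proof -
  have "set_integrable lborel {a..b} (\<lambda>t. (f t \<bullet> i) *\<^sub>R (g t \<bullet> i))" if "i \<in> Basis" for i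
  proof (rule set_integrable_continuous_scaleR)
    have "integrable lborel (\<lambda>t. (indicator {a..b} t *\<^sub>R g t) \<bullet> i)"
      using assms(2) unfolding set_integrable_def by (rule integrable_inner_left)
    then show "set_integrable lborel {a..b} (\<lambda>t. g t \<bullet> i)" by (simp add: set_integrable_def)
  qed (intro continuous_intros assms(1))
  then have "set_integrable lborel {a..b} (\<lambda>t. \<Sum>i\<in>Basis. (f t \<bullet> i) *\<^sub>R (g t \<bullet> i))"
    unfolding set_integrable_def scaleR_sum_right by (rule Bochner_Integration.integrable_sum)
  moreover have "(\<lambda>t. f t \<bullet> g t) = (\<lambda>t. \<Sum>i\<in>Basis. (f t \<bullet> i) *\<^sub>R (g t \<bullet> i))"
    by (rule ext) (unfold real_scaleR_def, rule euclidean_inner)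
  ultimately show ?thesis by simp
qed

lemma antideriv_imp_weak_derivative:
  fixes v w :: "real \<Rightarrow> real^'d::finite"
  assumes "antideriv T v w" "set_integrable lborel {0..T} w" "0 \<le> T"
  shows "has_weak_derivative T v w"
  unfolding has_weak_derivative_def
proof
  fix \<phi> assume \<phi>: "\<phi> \<in> test_interval T"
  then have sm: "smooth \<phi>" by (simp add: test_interval_def)
  have i1: "set_integrable lborel {0..T} (\<lambda>t. deriv \<phi> t *\<^sub>R v t)"
    by (intro borel_integrable_atLeastAtMost' continuous_intros antideriv_continuous[OF assms(1)]
        continuous_on_subset[OF real_smooth_deriv(2)[OF sm]]) auto
  have i2: "set_integrable lborel {0..T} (\<lambda>t. \<phi> t *\<^sub>R w t)"
    by (rule set_integrable_continuous_scaleR[OF assms(2) continuous_on_subset[OF smooth_continuous[OF sm]]]) auto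
  let ?f = "\<lambda>t. deriv \<phi> t *\<^sub>R v t + \<phi> t *\<^sub>R w t"
  have i: "set_integrable lborel {0..T} ?f" using i1 i2 by (rule set_integral_add)
  have "integral {0..T} ?f \<bullet> b = 0" for b
  proof -
    have "((\<lambda>t. ?f t \<bullet> b) has_integral 0) {0..T}"
      using antideriv_by_parts[OF assms sm, of b] test_interval_zero[OF \<phi>]
      by (simp add: inner_add_left)
    moreover have "((\<lambda>t. ?f t \<bullet> b) has_integral (integral {0..T} ?f \<bullet> b)) {0..T}"
      using has_integral_linear[OF integrable_integral[OF set_borel_integral_eq_integral(1)[OF i]]
          bounded_linear_inner_left, of b] by (simp add: o_def)
    ultimately show ?thesis using has_integral_unique by blast
  qed
  then have "(LBINT t:{0..T}. ?f t) = 0"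
    using set_borel_integral_eq_integral(2)[OF i] by (metis inner_eq_zero_iff)
  then show "(LBINT t:{0<..<T}. deriv \<phi> t *\<^sub>R v t) = - (LBINT t:{0<..<T}. \<phi> t *\<^sub>R w t)"
    unfolding set_integral_Ioo_Icc set_integral_add(2)[OF i1 i2] by (simp add: eq_neg_iff_add_eq_0)
qed

lemma deriv_step_outside:
  fixes H :: "real \<Rightarrow> real"
  assumes "\<And>s. s \<le> -1 \<Longrightarrow> H s = 0" "\<And>s. s \<ge> 1 \<Longrightarrow> H s = 1" "\<bar>s\<bar> > 1"
  shows "deriv H s = 0"
proof (cases "s > 1")
  case True
  have "((\<lambda>_. 1) has_real_derivative 0) (at s)" by simp
  then have "(H has_real_derivative 0) (at s)"
    by (rule has_field_derivative_transform_within_open[of _ _ _ "{1<..}"]) (use True assms(2) in auto)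
  then show ?thesis by (rule DERIV_imp_deriv)
next
  case False
  have "((\<lambda>_. 0) has_real_derivative 0) (at s)" by simp
  then have "(H has_real_derivative 0) (at s)"
    by (rule has_field_derivative_transform_within_open[of _ _ _ "{..<-1}"]) (use assms(1,3) False in auto)
  then show ?thesis by (rule DERIV_imp_deriv)
qed

text \<open>
  The functions \<open>n H'(n (s - c))\<close> have integral one and concentrate at \<open>c\<close>.
\<close>

lemma approximate_identity:
  fixes u :: "real \<Rightarrow> 'a::euclidean_space"
  assumes H: "smooth H" "mono H" "\<And>s. s \<le> -1 \<Longrightarrow> H s = 0" "\<And>s. s \<ge> 1 \<Longrightarrow> H s = (1::real)"
    and u: "continuous_on {0..T} u" and c: "0 < c" "c < T"
  shows "(\<lambda>n::nat. integral {0..T} (\<lambda>s. (real n * deriv H (real n * (s - c))) *\<^sub>R u s)) \<longlonglongrightarrow> u c"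
proof (rule LIMSEQ_I)
  let ?\<eta> = "\<lambda>(n::nat) s. real n * deriv H (real n * (s - c))"
  have "deriv H y \<ge> 0" for y
    using mono_on_imp_deriv_nonneg[of UNIV H "deriv H y" y] H(2) real_smooth_deriv(1)[OF H(1)] by simp
  then have pos: "?\<eta> n s \<ge> 0" for n s by simp
  have zero: "?\<eta> n s = 0" if "real n * \<bar>s - c\<bar> > 1" for n s
    using deriv_step_outside[of H "real n * (s - c)"] H(3,4) that by (simp add: abs_mult)
  have cont: "continuous_on S (?\<eta> n)" for S n
    by (intro continuous_intros continuous_on_compose2[OF real_smooth_deriv(2)[OF H(1)]]) auto
  fix e :: real assume e: "e > 0"
  then obtain d where d: "d > 0" "\<And>s. s \<in> {0..T} \<Longrightarrow> dist s c < d \<Longrightarrow> dist (u s) (u c) < e / 2"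
    using u c unfolding continuous_on_iff by (metis atLeastAtMost_iff half_gt_zero less_imp_le)
  define r where "r = min d (min c (T - c))"
  have r: "r > 0" "r \<le> d" "r \<le> c" "r \<le> T - c" using d c by (auto simp: r_def)
  obtain N :: nat where N: "real N > 1 / r" using reals_Archimedean2 by blast
  show "\<exists>no. \<forall>n\<ge>no. norm (integral {0..T} (\<lambda>s. ?\<eta> n s *\<^sub>R u s) - u c) < e"
  proof (intro exI allI impI)
    fix n assume "n \<ge> N"
    then have nr: "real n * r > 1" using N r by (simp add: field_simps) (meson less_le_trans mult_left_mono of_nat_mono order.strict_implies_order)
    have one: "(?\<eta> n has_integral 1) {0..T}"
    proof -
      have "(?\<eta> n has_integral (H (real n * (T - c)) - H (real n * (0 - c)))) {0..T}"
      proof (rule fundamental_theorem_of_calculus)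
        show "((\<lambda>s. H (real n * (s - c))) has_vector_derivative ?\<eta> n s) (at s within {0..T})" for s
        proof -
          have "((\<lambda>s. H (real n * (s - c))) has_real_derivative deriv H (real n * (s - c)) * real n) (at s)"
            by (rule DERIV_chain2[OF real_smooth_deriv(1)[OF H(1)]]) (auto intro!: derivative_eq_intros)
          then show ?thesis
            by (simp add: has_real_derivative_iff_has_vector_derivative mult.commute has_vector_derivative_at_within)
        qed
      qed (use c in auto)
      moreover have "real n * (T - c) \<ge> 1" "real n * c \<ge> 1"
        using nr mult_left_mono[OF r(3), of "real n"] mult_left_mono[OF r(4), of "real n"] by auto
      ultimately show ?thesis using H(3)[of "real n * (0 - c)"] H(4)[of "real n * (T - c)"] by simp
    qed
    have i1: "(\<lambda>s. ?\<eta> n s *\<^sub>R u s) integrable_on {0..T}"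
      by (intro integrable_continuous_real continuous_intros cont u)
    have "((\<lambda>s. ?\<eta> n s *\<^sub>R u c) has_integral (1 *\<^sub>R u c)) {0..T}"
      using has_integral_linear[OF one bounded_linear_scaleR_left, of "u c"] by (simp add: o_def)
    then have i2: "((\<lambda>s. ?\<eta> n s *\<^sub>R u c) has_integral u c) {0..T}" by simp
    have "integral {0..T} (\<lambda>s. ?\<eta> n s *\<^sub>R u s) - u c = integral {0..T} (\<lambda>s. ?\<eta> n s *\<^sub>R (u s - u c))"
      using Henstock_Kurzweil_Integration.integral_diff[OF i1 has_integral_integrable[OF i2]] integral_unique[OF i2]
      by (simp add: scaleR_diff_right)
    also have "norm \<dots> \<le> integral {0..T} (\<lambda>s. (e / 2) * ?\<eta> n s)"
    proof (rule integral_norm_bound_integral)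
      show "(\<lambda>s. ?\<eta> n s *\<^sub>R (u s - u c)) integrable_on {0..T}"
        by (intro integrable_continuous_real continuous_intros cont u)
      show "(\<lambda>s. (e / 2) * ?\<eta> n s) integrable_on {0..T}"
        by (intro integrable_continuous_real continuous_intros cont)
      fix s assume s: "s \<in> {0..T}"
      show "norm (?\<eta> n s *\<^sub>R (u s - u c)) \<le> (e / 2) * ?\<eta> n s"
      proof (cases "real n * \<bar>s - c\<bar> > 1")
        case True
        then show ?thesis unfolding zero[OF True] by simp
      next
        case False
        then have "real n * \<bar>s - c\<bar> < real n * r" using nr by linarith
        then have "dist s c < d" using r(2) by (auto simp: dist_real_def mult_less_cancel_left)
        then have "norm (u s - u c) \<le> e / 2" using d(2)[OF s] by (simp add: dist_norm)
        then show ?thesis using pos[of n s] mult_right_mono[of "norm (u s - u c)" "e / 2" "?\<eta> n s"]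
          by (simp only: norm_scaleR abs_of_nonneg mult.commute)
      qed
    qed
    also have "\<dots> = e / 2"
      using integral_unique[OF has_integral_mult_right[OF one, of "e / 2"]] by simp
    also have "\<dots> < e" using e by simp
    finally show "norm (integral {0..T} (\<lambda>s. ?\<eta> n s *\<^sub>R u s) - u c) < e" .
  qed
qed

text \<open>
  The converse of \<open>antideriv_imp_weak_derivative\<close> for continuous \<open>u\<close>. For \<open>0 < a < b < T\<close> the test
  functions \<open>H(n (s - a)) - H(n (s - b))\<close> tend to the indicator of \<open>[a,b]\<close>, and their derivatives are
  approximate identities at \<open>a\<close> and \<open>b\<close>; so the weak formulation becomes
  \<open>u a - u b = - \<integral>\<^sub>a\<^sup>b w\<close> in the limit. Continuity extends this to the closed interval.
\<close>

lemma weak_derivative_imp_antideriv: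
  fixes u w :: "real \<Rightarrow> real^'d::finite"
  assumes w: "set_integrable lborel {0..T} w"
    and wd: "has_weak_derivative T u w" and u: "continuous_on {0..T} u" and T: "0 < T"
  shows "antideriv T u w"
proof -
  obtain H :: "real \<Rightarrow> real" where H: "smooth H" "mono H"
    "\<And>s. s \<le> -1 \<Longrightarrow> H s = 0" "\<And>s. s \<ge> 1 \<Longrightarrow> H s = 1" and H01: "\<And>s. 0 \<le> H s" "\<And>s. H s \<le> 1"
    using smooth_step_exists by metis
  have wi: "w integrable_on {a..b}" if "0 \<le> a" "b \<le> T" for a b
    using set_borel_integral_eq_integral(1)[OF set_integrable_subset[OF w, of "{a..b}"]] that by auto
  have inner: "u b - u a = integral {a..b} w" if ab: "0 < a" "a < b" "b < T" for a b
  proof -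
    let ?\<phi> = "\<lambda>(n::nat) s. H (real n * (s - a)) - H (real n * (s - b))"
    let ?\<eta> = "\<lambda>(n::nat) c s. real n * deriv H (real n * (s - c))"
    have aff: "smooth (\<lambda>s. real n * (s - c))" for n c
      by (intro smooth_mult smooth_const smooth_diff, simp add: smooth_def Ck_bounded_linear)
    have sm: "smooth (?\<phi> n)" for n
      by (rule smooth_diff[OF smooth_compose_real[OF H(1) aff] smooth_compose_real[OF H(1) aff]])
    have der: "deriv (?\<phi> n) = (\<lambda>s. ?\<eta> n a s - ?\<eta> n b s)" for n
    proof
      fix s
      have "(?\<phi> n has_real_derivative (deriv H (real n * (s - a)) * real n - deriv H (real n * (s - b)) * real n)) (at s)"
        by (intro DERIV_diff DERIV_chain2[OF real_smooth_deriv(1)[OF H(1)]]) (auto intro!: derivative_eq_intros)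
      then show "deriv (?\<phi> n) s = ?\<eta> n a s - ?\<eta> n b s" by (simp add: DERIV_imp_deriv mult.commute)
    qed
    have cont: "continuous_on S (?\<eta> n c)" for S n c
      by (intro continuous_intros continuous_on_compose2[OF real_smooth_deriv(2)[OF H(1)]]) auto
    have out: "?\<phi> n s = 0" if "s \<notin> {a - 1 / real n..b + 1 / real n}" "n > 0" for n s
    proof -
      have n: "real n > 0" using that by simp
      have "s < a - 1 / real n \<or> s > b + 1 / real n" using that(1) by auto
      then consider "s < a - 1 / real n" | "s > b + 1 / real n" by blast
      then show ?thesis
      proof cases
        case 1
        then have "real n * (s - a) \<le> -1" using n by (simp add: field_simps)
        moreover have "real n * (s - b) \<le> real n * (s - a)" using ab n by (intro mult_left_mono) auto
        ultimately show ?thesis using H(3) by simp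
      next
        case 2
        then have "real n * (s - b) \<ge> 1" using n by (simp add: field_simps)
        moreover have "real n * (s - b) \<le> real n * (s - a)" using ab n by (intro mult_left_mono) auto
        ultimately show ?thesis using H(4) by simp
      qed
    qed
    define r where "r = min a (T - b)"
    have r: "r > 0" "r \<le> a" "r \<le> T - b" using ab by (auto simp: r_def)
    obtain N :: nat where N: "real N > 1 / r" using reals_Archimedean2 by blast
    have eq: "integral {0..T} (\<lambda>s. ?\<eta> n a s *\<^sub>R u s) - integral {0..T} (\<lambda>s. ?\<eta> n b s *\<^sub>R u s)
        = - (LBINT s:{0..T}. ?\<phi> n s *\<^sub>R w s)" if "n \<ge> N" for n
    proof -
      have "1 / r < real n" using N that by (meson less_le_trans of_nat_mono)
      moreover have "0 < 1 / r" using r by simp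
      ultimately have n0: "real n > 0" by linarith
      then have n: "real n > 0" "1 / real n < r" using \<open>1 / r < real n\<close> r by (auto simp: field_simps)
      have "closure {s. ?\<phi> n s \<noteq> 0} \<subseteq> {a - 1 / real n..b + 1 / real n}"
      proof (rule closure_minimal)
        have "n > 0" using n by simp
        then show "{s. ?\<phi> n s \<noteq> 0} \<subseteq> {a - 1 / real n..b + 1 / real n}" using out by blast
      qed simp
      also have "\<dots> \<subseteq> {0<..<T}" using n r by auto
      finally have "?\<phi> n \<in> test_interval T" using sm by (simp add: test_interval_def)
      then have "(LBINT s:{0..T}. deriv (?\<phi> n) s *\<^sub>R u s) = - (LBINT s:{0..T}. ?\<phi> n s *\<^sub>R w s)"
        using wd unfolding has_weak_derivative_def set_integral_Ioo_Icc by blast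
      moreover have "(LBINT s:{0..T}. deriv (?\<phi> n) s *\<^sub>R u s) = integral {0..T} (\<lambda>s. deriv (?\<phi> n) s *\<^sub>R u s)"
        unfolding der
        by (intro set_borel_integral_eq_integral(2) borel_integrable_atLeastAtMost' continuous_intros cont u)
      moreover have "\<dots> = integral {0..T} (\<lambda>s. ?\<eta> n a s *\<^sub>R u s) - integral {0..T} (\<lambda>s. ?\<eta> n b s *\<^sub>R u s)"
        unfolding der scaleR_diff_left
        by (intro Henstock_Kurzweil_Integration.integral_diff integrable_continuous_real continuous_intros cont u)
      ultimately show ?thesis by simp
    qed
    have "(\<lambda>n. integral {0..T} (\<lambda>s. ?\<eta> n a s *\<^sub>R u s) - integral {0..T} (\<lambda>s. ?\<eta> n b s *\<^sub>R u s)) \<longlonglongrightarrow> u a - u b"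
      by (intro tendsto_diff approximate_identity[OF H u]) (use ab in auto)
    then have l1: "(\<lambda>n. - (LBINT s:{0..T}. ?\<phi> n s *\<^sub>R w s)) \<longlonglongrightarrow> u a - u b"
      by (rule Lim_transform_eventually) (use eq in \<open>auto simp: eventually_sequentially\<close>)
    have "(\<lambda>n. LBINT s:{0..T}. ?\<phi> n s *\<^sub>R w s) \<longlonglongrightarrow> (LBINT s:{a..b}. w s)"
      unfolding set_lebesgue_integral_def
    proof (rule integral_dominated_convergence)
      show "integrable lborel (\<lambda>s. norm (indicator {0..T} s *\<^sub>R w s))"
        using w unfolding set_integrable_def by (rule integrable_norm)
      show "(\<lambda>s. indicator {a..b} s *\<^sub>R w s) \<in> borel_measurable lborel"
        using set_integrable_subset[OF w, of "{a..b}"] ab unfolding set_integrable_def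
        by (intro borel_measurable_integrable) auto
      show "(\<lambda>s. indicator {0..T} s *\<^sub>R ?\<phi> n s *\<^sub>R w s) \<in> borel_measurable lborel" for n
        using set_integrable_continuous_scaleR[OF w continuous_on_subset[OF smooth_continuous[OF sm[of n]]]]
        unfolding set_integrable_def by (intro borel_measurable_integrable) auto
      show "AE s in lborel. norm (indicator {0..T} s *\<^sub>R ?\<phi> n s *\<^sub>R w s) \<le> norm (indicator {0..T} s *\<^sub>R w s)" for n
      proof (rule AE_I2)
        fix s
        have "\<bar>?\<phi> n s\<bar> \<le> 1" using H01[of "real n * (s - a)"] H01[of "real n * (s - b)"] by linarith
        then show "norm (indicator {0..T} s *\<^sub>R ?\<phi> n s *\<^sub>R w s) \<le> norm (indicator {0..T} s *\<^sub>R w s)"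
          by (auto simp: indicator_def intro: mult_left_le_one_le)
      qed
      show "AE s in lborel. (\<lambda>n. indicator {0..T} s *\<^sub>R ?\<phi> n s *\<^sub>R w s) \<longlonglongrightarrow> indicator {a..b} s *\<^sub>R w s"
        using AE_lborel_singleton[of a] AE_lborel_singleton[of b]
      proof eventually_elim
        case (elim s)
        have lim: "(\<lambda>n. H (real n * (s - c))) \<longlonglongrightarrow> indicator {c..} s" if "s \<noteq> c" for c
        proof -
          obtain M :: nat where M: "real M > 1 / \<bar>s - c\<bar>" using reals_Archimedean2 by blast
          have "H (real n * (s - c)) = indicator {c..} s" if n: "n \<ge> M" for n
          proof -
            have "real n \<ge> real M" using n by simp
            then have "1 / \<bar>s - c\<bar> < real n" using M by linarith
            then have "1 < real n * \<bar>s - c\<bar>" using \<open>s \<noteq> c\<close> by (simp add: field_simps)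
            then show ?thesis using H(3)[of "real n * (s - c)"] H(4)[of "real n * (s - c)"] \<open>s \<noteq> c\<close>
              by (auto simp: indicator_def abs_if algebra_simps split: if_splits)
          qed
          then show ?thesis by (intro tendsto_eventually) (auto simp: eventually_sequentially)
        qed
        have "(\<lambda>n. ?\<phi> n s) \<longlonglongrightarrow> indicator {a..} s - indicator {b..} s"
          by (intro tendsto_diff lim elim)
        then have "(\<lambda>n. indicator {0..T} s *\<^sub>R ?\<phi> n s *\<^sub>R w s)
            \<longlonglongrightarrow> indicator {0..T} s *\<^sub>R (indicator {a..} s - indicator {b..} s) *\<^sub>R w s"
          by (rule tendsto_scaleR[OF tendsto_const tendsto_scaleR[OF _ tendsto_const]])
        moreover have "indicator {0..T} s *\<^sub>R (indicator {a..} s - indicator {b..} s) *\<^sub>R w s = indicator {a..b} s *\<^sub>R w s"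
          using ab elim by (auto simp: indicator_def)
        ultimately show ?case by (simp only:)
      qed
    qed
    then have "(\<lambda>n. - (LBINT s:{0..T}. ?\<phi> n s *\<^sub>R w s)) \<longlonglongrightarrow> - (LBINT s:{a..b}. w s)"
      by (rule tendsto_minus)
    then have "u a - u b = - (LBINT s:{a..b}. w s)" using l1 LIMSEQ_unique by blast
    moreover have "(LBINT s:{a..b}. w s) = integral {a..b} w"
      by (rule set_borel_integral_eq_integral(2), rule set_integrable_subset[OF w]) (use ab in auto)
    ultimately show ?thesis by (simp add: algebra_simps)
  qed
  let ?D = "\<lambda>t. u t - integral {0..t} w"
  have contD: "continuous_on {0..T} ?D"
    by (intro continuous_intros u indefinite_integral_continuous_1 wi) auto
  have D: "?D b = ?D a" if "0 < a" "a < b" "b < T" for a b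
    using inner[OF that] Henstock_Kurzweil_Integration.integral_combine[of 0 a b w] wi[of 0 b] that
    by (simp add: algebra_simps)
  have const: "?D t = ?D (T / 2)" if "t \<in> {0..T}" for t
  proof (rule continuous_constant_on_closure[of "{0<..<T}" ?D])
    show "continuous_on (closure {0<..<T}) ?D" using contD T by simp
    show "?D x = ?D (T / 2)" if "x \<in> {0<..<T}" for x
      using D[of x "T / 2"] D[of "T / 2" x] that T by (cases x "T / 2" rule: linorder_cases) auto
    show "t \<in> closure {0<..<T}" using that T by simp
  qed
  have "(w has_integral (u t - u 0)) {0..t}" if t: "0 \<le> t" "t \<le> T" for t
  proof -
    have "?D t = ?D 0" using const[of t] const[of 0] t T by (simp only: atLeastAtMost_iff) simp
    then have "integral {0..t} w = u t - u 0" by (simp add: algebra_simps)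
    then show ?thesis using integrable_integral[OF wi[of 0 t]] t by simp
  qed
  then show ?thesis by (simp add: antideriv_def)
qed

section \<open>Curves on the torus and their lifts\<close>

lemma torus_of_rep_torus [simp]: "torus_of (rep_torus p) = p"
  using Quotient3_abs_rep[OF Quotient3_torus] .

definition lift :: "('d::finite torus \<times> (real^'d) \<Rightarrow> real) \<Rightarrow> (real^'d) \<times> (real^'d) \<Rightarrow> real" where
  "lift F z = F (torus_of (fst z), snd z)"

lemma trig_torus_of:
  assumes "torus_of y = torus_of y'"
  shows "cos (2 * pi * (y $ i - a)) = cos (2 * pi * (y' $ i - a))"
    and "sin (2 * pi * (y $ i - a)) = sin (2 * pi * (y' $ i - a))"
proof -
  obtain n :: int where "y $ i - y' $ i = of_int n"
    using assms by (metis torus_of_eq_iff Ints_cases)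
  then have "y $ i = y' $ i + of_int n" by simp
  then have "2 * pi * (y $ i - a) = 2 * pi * (y' $ i - a) + 2 * pi * of_int n"
    by (simp add: algebra_simps)
  then show "cos (2 * pi * (y $ i - a)) = cos (2 * pi * (y' $ i - a))"
    "sin (2 * pi * (y $ i - a)) = sin (2 * pi * (y' $ i - a))"
    by (simp_all add: cos_add sin_add)
qed

lemma within_Ici_nontrivial:
  fixes t :: real
  assumes "t \<ge> 0" shows "at t within {0..} \<noteq> bot"
proof
  assume "at t within {0..} = bot"
  moreover have "at_right t \<le> at t within {0..}" using assms by (intro at_le) auto
  ultimately show False by (simp add: bot_unique trivial_limit_at_right_real)
qed

text \<open>
  A local lift of \<open>\<gamma>\<close> differs from \<open>rep_torus \<circ> \<gamma>\<close> by integer vectors that may jump. Sine and cosine of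
  period one do not see them, so these functions of \<open>\<gamma>\<close> are differentiable although
  \<open>rep_torus \<circ> \<gamma>\<close> need not be continuous.
\<close>

lemma has_velocity_trig:
  assumes "has_velocity \<gamma> t u" "(a has_real_derivative a') (at t within {0..})"
  shows "((\<lambda>s. cos (2 * pi * (rep_torus (\<gamma> s) $ i - a s))) has_real_derivative
      - sin (2 * pi * (rep_torus (\<gamma> t) $ i - a t)) * (2 * pi * (u $ i - a'))) (at t within {0..})"
    and "((\<lambda>s. sin (2 * pi * (rep_torus (\<gamma> s) $ i - a s))) has_real_derivative
      cos (2 * pi * (rep_torus (\<gamma> t) $ i - a t)) * (2 * pi * (u $ i - a'))) (at t within {0..})"
proof -
  obtain g where g: "\<gamma> t = torus_of (g t)" "\<forall>\<^sub>F s in at t within {0..}. \<gamma> s = torus_of (g s)"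
    "(g has_vector_derivative u) (at t within {0..})"
    using assms(1) by (auto simp: has_velocity_def)
  have gi: "((\<lambda>s. g s $ i) has_real_derivative u $ i) (at t within {0..})"
    using bounded_linear.has_vector_derivative[OF bounded_linear_vec_nth g(3)]
    by (simp add: has_real_derivative_iff_has_vector_derivative)
  have eq: "cos (2 * pi * (g s $ i - a s)) = cos (2 * pi * (rep_torus (\<gamma> s) $ i - a s))"
    "sin (2 * pi * (g s $ i - a s)) = sin (2 * pi * (rep_torus (\<gamma> s) $ i - a s))"
    if "\<gamma> s = torus_of (g s)" for s
    using trig_torus_of[of "g s" "rep_torus (\<gamma> s)"] that by auto
  have 1: "((\<lambda>s. cos (2 * pi * (g s $ i - a s))) has_real_derivative
      - sin (2 * pi * (g t $ i - a t)) * (2 * pi * (u $ i - a'))) (at t within {0..})"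
    by (auto intro!: derivative_eq_intros gi assms(2))
  have 2: "\<forall>\<^sub>F s in at t within {0..}. cos (2 * pi * (g s $ i - a s)) = cos (2 * pi * (rep_torus (\<gamma> s) $ i - a s))"
    using g(2) by eventually_elim (rule eq)
  show "((\<lambda>s. cos (2 * pi * (rep_torus (\<gamma> s) $ i - a s))) has_real_derivative
      - sin (2 * pi * (rep_torus (\<gamma> t) $ i - a t)) * (2 * pi * (u $ i - a'))) (at t within {0..})"
    using 1 unfolding has_field_derivative_cong_eventually[OF 2 eq(1)[OF g(1)]] eq[OF g(1)] .
  have 1: "((\<lambda>s. sin (2 * pi * (g s $ i - a s))) has_real_derivative
      cos (2 * pi * (g t $ i - a t)) * (2 * pi * (u $ i - a'))) (at t within {0..})"
    by (auto intro!: derivative_eq_intros gi assms(2))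
  have 2: "\<forall>\<^sub>F s in at t within {0..}. sin (2 * pi * (g s $ i - a s)) = sin (2 * pi * (rep_torus (\<gamma> s) $ i - a s))"
    using g(2) by eventually_elim (rule eq)
  show "((\<lambda>s. sin (2 * pi * (rep_torus (\<gamma> s) $ i - a s))) has_real_derivative
      cos (2 * pi * (rep_torus (\<gamma> t) $ i - a t)) * (2 * pi * (u $ i - a'))) (at t within {0..})"
    using 1 unfolding has_field_derivative_cong_eventually[OF 2 eq(2)[OF g(1)]] eq[OF g(1)] .
qed

text \<open>
  The velocity can be read off from the derivatives of the cosine and the sine, as one of the two
  coefficients is nonzero.
\<close>

lemma has_velocity_unique:
  assumes "has_velocity \<gamma> t u" "has_velocity \<gamma> t u'" "t \<ge> 0"
  shows "u = u'"
proof -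
  have "u $ i = u' $ i" for i
  proof -
    let ?a = "2 * pi * (rep_torus (\<gamma> t) $ i - 0)"
    have c: "((\<lambda>_. 0) has_real_derivative 0) (at t within {0..})" by simp
    have "- sin ?a * (2 * pi * (u $ i - 0)) = - sin ?a * (2 * pi * (u' $ i - 0))"
      using has_field_derivative_unique[OF has_velocity_trig(1)[OF assms(1) c, of i]
          has_velocity_trig(1)[OF assms(2) c, of i] within_Ici_nontrivial[OF assms(3)]] .
    then have 1: "sin ?a * u $ i = sin ?a * u' $ i" by simp
    have "cos ?a * (2 * pi * (u $ i - 0)) = cos ?a * (2 * pi * (u' $ i - 0))"
      using has_field_derivative_unique[OF has_velocity_trig(2)[OF assms(1) c, of i]
          has_velocity_trig(2)[OF assms(2) c, of i] within_Ici_nontrivial[OF assms(3)]] .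
    then have 2: "cos ?a * u $ i = cos ?a * u' $ i" by simp
    show ?thesis
    proof (cases "sin ?a = 0")
      case True
      then have "cos ?a \<noteq> 0" using sin_cos_squared_add[of ?a] by auto
      then show ?thesis using 2 by simp
    next
      case False
      then show ?thesis using 1 by simp
    qed
  qed
  then show ?thesis by (simp add: vec_eq_iff)
qed

lemma velocity_eq: "has_velocity \<gamma> t u \<Longrightarrow> t \<ge> 0 \<Longrightarrow> velocity \<gamma> t = u"
  unfolding velocity_def using has_velocity_unique by (intro the_equality) auto

lemma velocity_torus_of:
  assumes "(X has_vector_derivative u) (at t within {0..})" "t \<ge> 0"
  shows "has_velocity (\<lambda>s. torus_of (X s)) t u" "velocity (\<lambda>s. torus_of (X s)) t = u"
proof -
  show *: "has_velocity (\<lambda>s. torus_of (X s)) t u"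
    unfolding has_velocity_def using assms(1) by (intro exI[of _ X]) auto
  show "velocity (\<lambda>s. torus_of (X s)) t = u" by (rule velocity_eq[OF * assms(2)])
qed

lemma primitive_within_Ici:
  fixes V :: "real \<Rightarrow> 'a::euclidean_space"
  assumes "continuous_on {0..} V" "t \<ge> 0"
  shows "((\<lambda>t. x0 + integral {0..t} V) has_vector_derivative V t) (at t within {0..})"
proof -
  have "((\<lambda>t. integral {0..t} V) has_vector_derivative V t) (at t within {0..t + 1})"
    by (rule integral_has_vector_derivative[OF continuous_on_subset[OF assms(1)]]) (use assms(2) in auto)
  moreover have "at t within {0..t + 1} = at t within {0..}"
    by (rule at_within_nhd[of _ "{t - 1<..<t + 1}"]) auto
  ultimately have "((\<lambda>t. integral {0..t} V) has_vector_derivative V t) (at t within {0..})" by simp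
  from has_vector_derivative_add[OF has_vector_derivative_const[of x0] this] show ?thesis by simp
qed

text \<open>
  A global lift is found by integrating the velocity. The cosine of the difference to \<open>\<gamma>\<close> has
  derivative zero and equals one initially, so that the difference stays an integer vector.
\<close>

lemma C1_curve_lift:
  fixes \<gamma> :: "real \<Rightarrow> 'd::finite torus"
  assumes "\<gamma> \<in> C1_curves" "torus_of x0 = \<gamma> 0" "t \<ge> 0"
  shows "torus_of (x0 + integral {0..t} (velocity \<gamma>)) = \<gamma> t"
proof -
  define X where "X t = x0 + integral {0..t} (velocity \<gamma>)" for t
  have cont: "continuous_on {0..} (velocity \<gamma>)" and vel: "has_velocity \<gamma> s (velocity \<gamma> s)" if "s \<ge> 0" for s
    using assms(1) that by (auto simp: C1_curves_def) (metis velocity_eq)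
  have X: "(X has_vector_derivative velocity \<gamma> s) (at s within {0..})" if "s \<ge> 0" for s
    unfolding X_def using primitive_within_Ici[OF cont that] that by blast
  have "rep_torus (\<gamma> t) $ i - X t $ i \<in> \<int>" for i
  proof -
    let ?c = "\<lambda>s. cos (2 * pi * (rep_torus (\<gamma> s) $ i - X s $ i))"
    have "(?c has_real_derivative 0) (at s within {0..})" if "s \<in> {0..}" for s
    proof -
      have "((\<lambda>s. X s $ i) has_real_derivative velocity \<gamma> s $ i) (at s within {0..})"
        using bounded_linear.has_vector_derivative[OF bounded_linear_vec_nth X[of s]] that
        by (simp add: has_real_derivative_iff_has_vector_derivative)
      from has_velocity_trig(1)[OF vel this, of i] that show ?thesis by simp
    qed
    then obtain k where k: "\<And>s. s \<in> {0..} \<Longrightarrow> ?c s = k"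
      using has_field_derivative_zero_constant[of "{0..}" ?c] by auto
    have "?c 0 = cos (2 * pi * (x0 $ i - X 0 $ i))"
      by (rule trig_torus_of(1)) (use assms(2) in simp)
    then have "k = 1" using k[of 0] by (simp add: X_def)
    then have "?c t = 1" using k assms(3) by simp
    then obtain n :: int where "2 * pi * (rep_torus (\<gamma> t) $ i - X t $ i) = of_int n * 2 * pi"
      unfolding cos_one_2pi_int by blast
    then have "rep_torus (\<gamma> t) $ i - X t $ i = of_int n" by simp
    then show ?thesis by simp
  qed
  then have "torus_of (rep_torus (\<gamma> t)) = torus_of (X t)" unfolding torus_of_eq_iff by blast
  then show ?thesis by (simp add: X_def)
qed

lemma continuous_torus_of: "continuous_on UNIV (torus_of :: real^'d::finite \<Rightarrow> _)"
  by (auto simp: continuous_on_open_vimage open_torus_def)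

lemma continuous_lift:
  fixes F :: "'d::finite torus \<times> (real^'d) \<Rightarrow> real"
  assumes "continuous_on UNIV F" shows "continuous_on UNIV (lift F)"
  unfolding lift_def[abs_def]
  by (rule continuous_on_compose2[OF assms])
    (auto intro!: continuous_intros continuous_on_compose2[OF continuous_torus_of])

lemma L2_interval_cutoff:
  fixes w :: "real \<Rightarrow> real^'d::finite"
  assumes "L2_interval T w"
  defines "w' \<equiv> \<lambda>t. indicator {0<..<T} t *\<^sub>R w t"
  shows "w' \<in> borel_measurable borel" "set_integrable lborel {0..T} (\<lambda>s. (norm (w' s))\<^sup>2)"
proof -
  show "w' \<in> borel_measurable borel"
    using assms(1) by (simp add: L2_interval_def set_borel_measurable_def w'_def)
  have "set_integrable lborel {0<..<T} (\<lambda>s. (norm (w s))\<^sup>2)"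
    using assms(1) by (simp add: L2_interval_def)
  then have "set_integrable lborel {0<..<T} (\<lambda>s. (norm (w' s))\<^sup>2)"
    by (rule set_integrable_cong[THEN iffD1, rotated -1]) (auto simp: w'_def)
  then show "set_integrable lborel {0..T} (\<lambda>s. (norm (w' s))\<^sup>2)"
    using set_integral_Ioo_Icc(2) by blast
qed

lemma has_weak_derivative_cong:
  assumes "\<And>t. 0 < t \<Longrightarrow> t < T \<Longrightarrow> u t = u' t" "\<And>t. 0 < t \<Longrightarrow> t < T \<Longrightarrow> w t = w' t"
  shows "has_weak_derivative T u w \<longleftrightarrow> has_weak_derivative T u' w'"
proof -
  have "(LBINT t:{0<..<T}. deriv \<phi> t *\<^sub>R u t) = (LBINT t:{0<..<T}. deriv \<phi> t *\<^sub>R u' t)"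
    "(LBINT t:{0<..<T}. \<phi> t *\<^sub>R w t) = (LBINT t:{0<..<T}. \<phi> t *\<^sub>R w' t)" for \<phi>
    using assms by (auto intro!: set_lebesgue_integral_cong)
  then show ?thesis by (simp add: has_weak_derivative_def)
qed

lemma weak_derivative_cutoff_antideriv:
  fixes u w :: "real \<Rightarrow> real^'d::finite"
  assumes "L2_interval T w" "has_weak_derivative T u w" "continuous_on {0..T} u" "0 < T"
  shows "antideriv T u (\<lambda>t. indicator {0<..<T} t *\<^sub>R w t)"
proof (rule weak_derivative_imp_antideriv[OF _ _ assms(3,4)])
  show "set_integrable lborel {0..T} (\<lambda>t. indicator {0<..<T} t *\<^sub>R w t)"
    by (rule borel_square_integrable_imp_integrable[OF L2_interval_cutoff[OF assms(1)]])
  show "has_weak_derivative T u (\<lambda>t. indicator {0<..<T} t *\<^sub>R w t)"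
    using assms(2) by (rule has_weak_derivative_cong[THEN iffD1, rotated -1]) auto
qed

lemma H2_curve_traj:
  fixes \<gamma> :: "real \<Rightarrow> 'd::finite torus"
  assumes F: "continuous_on UNIV F"
    and \<gamma>: "\<gamma> \<in> C1_curves" "torus_of x0 = \<gamma> 0" "H2_curve T \<gamma>" "0 < T"
  defines "x \<equiv> \<lambda>t. x0 + integral {0..t} (velocity \<gamma>)"
    and "w \<equiv> \<lambda>t. indicator {0<..<T} t *\<^sub>R acceleration T \<gamma> t"
  shows "traj T x (velocity \<gamma>) w" "action F T \<gamma> = ereal (cost (lift F) T x (velocity \<gamma>) w)"
proof -
  have "L2_interval T (acceleration T \<gamma>) \<and> has_weak_derivative T (velocity \<gamma>) (acceleration T \<gamma>)"
    using \<gamma>(3) unfolding H2_curve_def acceleration_def by (rule someI_ex)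
  then have acc: "L2_interval T (acceleration T \<gamma>)" "has_weak_derivative T (velocity \<gamma>) (acceleration T \<gamma>)"
    by auto
  have cont: "continuous_on {0..} (velocity \<gamma>)" using \<gamma>(1) by (simp add: C1_curves_def)
  then have contT: "continuous_on {0..T} (velocity \<gamma>)" by (rule continuous_on_subset) auto
  have x: "antideriv T x (velocity \<gamma>)"
    unfolding antideriv_def
  proof (intro allI impI)
    fix t assume t: "0 \<le> t \<and> t \<le> T"
    have "velocity \<gamma> integrable_on {0..t}"
      by (intro integrable_continuous_real continuous_on_subset[OF cont]) auto
    then show "(velocity \<gamma> has_integral (x t - x 0)) {0..t}"
      by (simp add: x_def integrable_integral)
  qed
  show traj: "traj T x (velocity \<gamma>) w"
    unfolding traj_def w_def
    using L2_interval_cutoff[OF acc(1)] weak_derivative_cutoff_antideriv[OF acc contT \<gamma>(4)] x by auto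
  have "action F T \<gamma> = ereal (LBINT s:{0<..<T}. (norm (acceleration T \<gamma> s))\<^sup>2 / 2 + F (\<gamma> s, velocity \<gamma> s))"
    using \<gamma>(3) by (simp add: action_def)
  also have "(LBINT s:{0<..<T}. (norm (acceleration T \<gamma> s))\<^sup>2 / 2 + F (\<gamma> s, velocity \<gamma> s))
      = (LBINT s:{0<..<T}. running_cost (lift F) x (velocity \<gamma>) w s)"
    using C1_curve_lift[OF \<gamma>(1,2)]
    by (intro set_lebesgue_integral_cong) (auto simp: running_cost_def lift_def x_def w_def)
  also have "\<dots> = cost (lift F) T x (velocity \<gamma>) w"
    unfolding set_integral_Ioo_Icc cost_def
    by (rule set_borel_integral_eq_integral(2)[OF running_cost_set_integrable[OF traj continuous_lift[OF F]]])
  finally show "action F T \<gamma> = ereal (cost (lift F) T x (velocity \<gamma>) w)" .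
qed

text \<open>
  A trajectory is continued after time \<open>T\<close> with constant velocity to obtain a curve on the half line.
  The action of this curve is computed with the weak derivative chosen in its definition, which
  agrees with the control almost everywhere.
\<close>

lemma traj_curve:
  fixes x v w :: "real \<Rightarrow> real^'d::finite"
  assumes F: "continuous_on UNIV F" and traj: "traj T x v w" and T: "0 < T"
  obtains \<gamma> where "\<gamma> \<in> C1_curves_from (torus_of (x 0)) (v 0)" "action F T \<gamma> = ereal (cost (lift F) T x v w)"
proof -
  define V where "V t = v (min t T)" for t
  define X where "X t = x 0 + integral {0..t} V" for t
  define \<gamma> where "\<gamma> t = torus_of (X t)" for t
  have cV: "continuous_on {0..} V"
    unfolding V_def
    by (rule continuous_on_compose2[OF antideriv_continuous[OF traj_v[OF traj]]])
      (use T in \<open>auto intro!: continuous_intros\<close>)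
  have vel: "has_velocity \<gamma> t (V t)" "velocity \<gamma> t = V t" if "t \<ge> 0" for t
    using velocity_torus_of[OF primitive_within_Ici[OF cV that] that] that
    unfolding \<gamma>_def[abs_def] X_def[abs_def] by auto
  have cvel: "continuous_on {0..} (velocity \<gamma>)"
    using cV by (rule continuous_on_eq) (simp add: vel)
  have C1: "\<gamma> \<in> C1_curves"
    using vel(1) cvel by (auto simp: C1_curves_def)
  have X: "X t = x t" if "0 \<le> t" "t \<le> T" for t
  proof -
    have "(v has_integral (x t - x 0)) {0..t}" using traj_x[OF traj] that by (auto simp: antideriv_def)
    then have "(V has_integral (x t - x 0)) {0..t}"
      by (rule has_integral_eq[rotated]) (use that in \<open>auto simp: V_def\<close>)
    then show ?thesis by (simp add: X_def integral_unique)
  qed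
  have x0: "X 0 = x 0" by (simp add: X_def)
  have v: "velocity \<gamma> t = v t" if "0 \<le> t" "t \<le> T" for t
    using vel(2)[of t] that by (simp add: V_def)
  have "has_weak_derivative T v w"
    using antideriv_imp_weak_derivative[OF traj_v[OF traj] traj_integrable[OF traj]] T by simp
  then have wd: "has_weak_derivative T (velocity \<gamma>) w"
    by (rule has_weak_derivative_cong[THEN iffD1, rotated -1]) (auto simp: v)
  have "L2_interval T w"
    using traj_measurable[OF traj] traj_square[OF traj] set_integral_Ioo_Icc(2)
    by (auto simp: L2_interval_def set_borel_measurable_def)
  then have H2: "H2_curve T \<gamma>" using wd by (auto simp: H2_curve_def)
  define acc where "acc t = indicator {0<..<T} t *\<^sub>R acceleration T \<gamma> t" for t
  have "torus_of (x 0) = \<gamma> 0" by (simp add: \<gamma>_def x0)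
  from H2_curve_traj[OF F C1 this H2 T] obtain y where
    y: "y = (\<lambda>t. x 0 + integral {0..t} (velocity \<gamma>))" "traj T y (velocity \<gamma>) acc"
      "action F T \<gamma> = ereal (cost (lift F) T y (velocity \<gamma>) acc)"
    unfolding acc_def[abs_def] by metis
  have yx: "y t = x t" if "0 \<le> t" "t \<le> T" for t
  proof -
    have "integral {0..t} (velocity \<gamma>) = integral {0..t} V"
      by (rule Henstock_Kurzweil_Integration.integral_cong) (simp add: vel)
    then show ?thesis using X[OF that] by (simp add: y(1) X_def)
  qed
  have "antideriv T v acc"
    using traj_v[OF y(2)] by (rule antideriv_cong) (auto simp: v)
  then have ae: "AE t in lborel. t \<in> {0..T} \<longrightarrow> acc t = w t"
    using antideriv_unique_AE[OF _ traj_integrable[OF y(2)] traj_v[OF traj] traj_integrable[OF traj]] T by simp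
  have "cost (lift F) T y (velocity \<gamma>) acc = (LBINT s:{0..T}. running_cost (lift F) y (velocity \<gamma>) acc s)"
    unfolding cost_def
    by (rule set_borel_integral_eq_integral(2)[OF running_cost_set_integrable[OF y(2) continuous_lift[OF F]], symmetric])
  also have "\<dots> = (LBINT s:{0..T}. running_cost (lift F) x v w s)"
    unfolding set_lebesgue_integral_def
  proof (rule integral_cong_AE)
    show "(\<lambda>s. indicator {0..T} s *\<^sub>R running_cost (lift F) y (velocity \<gamma>) acc s) \<in> borel_measurable lborel"
      using running_cost_set_integrable[OF y(2) continuous_lift[OF F]] unfolding set_integrable_def
      by (rule borel_measurable_integrable)
    show "(\<lambda>s. indicator {0..T} s *\<^sub>R running_cost (lift F) x v w s) \<in> borel_measurable lborel"
      using running_cost_set_integrable[OF traj continuous_lift[OF F]] unfolding set_integrable_def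
      by (rule borel_measurable_integrable)
    show "AE s in lborel. indicator {0..T} s *\<^sub>R running_cost (lift F) y (velocity \<gamma>) acc s
        = indicator {0..T} s *\<^sub>R running_cost (lift F) x v w s"
      using ae by eventually_elim (auto simp: indicator_def running_cost_def v yx)
  qed
  also have "\<dots> = cost (lift F) T x v w"
    unfolding cost_def
    by (rule set_borel_integral_eq_integral(2)[OF running_cost_set_integrable[OF traj continuous_lift[OF F]]])
  finally have "action F T \<gamma> = ereal (cost (lift F) T x v w)" using y(3) by simp
  moreover have "\<gamma> \<in> C1_curves_from (torus_of (x 0)) (v 0)"
    using C1 v[of 0] T by (simp add: C1_curves_from_def \<gamma>_def x0)
  ultimately show thesis using that by blast
qed

definition costs :: "('a::euclidean_space \<times> 'a \<Rightarrow> real) \<Rightarrow> real \<Rightarrow> 'a \<times> 'a \<Rightarrow> real set" where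
  "costs f T z = {cost f T x v w | x v w. traj T x v w \<and> (x 0, v 0) = z}"

definition min_cost :: "('a::euclidean_space \<times> 'a \<Rightarrow> real) \<Rightarrow> real \<Rightarrow> 'a \<times> 'a \<Rightarrow> real" where
  "min_cost f T z = Inf (costs f T z)"

lemma traj_const: "traj T (\<lambda>t. x + t *\<^sub>R v) (\<lambda>t. v) (\<lambda>t. 0)"
  unfolding traj_def
  by (auto intro!: antideriv_has_vector_derivative derivative_eq_intros simp: set_integrable_def)

lemma costs_nonempty: "costs f T z \<noteq> {}"
  using traj_const[of T "fst z" "snd z"] by (force simp: costs_def)

lemma costs_bdd_below: "(\<And>z. f z \<ge> 0) \<Longrightarrow> bdd_below (costs f T z)"
  by (auto simp: costs_def bdd_below_def intro!: exI[of _ 0] cost_nonneg)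

text \<open>
  The factor \<open>k\<close> covers both forms of the averaged value function: \<open>k = 1\<close> gives the value function
  itself and \<open>k = 1 / T\<close> the infimum of the averaged actions.
\<close>

lemma INF_action_eq_min_cost:
  fixes F :: "'d::finite torus \<times> (real^'d) \<Rightarrow> real"
  assumes F: "continuous_on UNIV F" "\<And>x v. F (x, v) \<ge> 0" and T: "0 < T" and k: "0 < k"
  shows "(INF \<gamma>\<in>C1_curves_from (torus_of x0) v0. ereal k * action F T \<gamma>)
    = ereal (k * min_cost (lift F) T (x0, v0))"
proof (rule antisym)
  have nn: "lift F z \<ge> 0" for z using F(2) by (simp add: lift_def)
  show "(INF \<gamma>\<in>C1_curves_from (torus_of x0) v0. ereal k * action F T \<gamma>) \<le> ereal (k * min_cost (lift F) T (x0, v0))"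
  proof (rule ereal_le_epsilon2)
    fix e :: real assume e: "e > 0"
    obtain r where r: "r \<in> costs (lift F) T (x0, v0)" "r < min_cost (lift F) T (x0, v0) + e / k"
      using cInf_lessD[OF costs_nonempty, of "lift F" T "(x0, v0)" "min_cost (lift F) T (x0, v0) + e / k"] e k
      by (auto simp: min_cost_def)
    then obtain x v w where x: "traj T x v w" "x 0 = x0" "v 0 = v0" "r = cost (lift F) T x v w"
      by (auto simp: costs_def)
    obtain \<gamma> where \<gamma>: "\<gamma> \<in> C1_curves_from (torus_of x0) v0" "action F T \<gamma> = ereal r"
      using traj_curve[OF F(1) x(1) T] x by metis
    have "(INF \<gamma>\<in>C1_curves_from (torus_of x0) v0. ereal k * action F T \<gamma>) \<le> ereal (k * r)"
      by (rule INF_lower2[OF \<gamma>(1)]) (simp add: \<gamma>(2))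
    also have "\<dots> \<le> ereal (k * min_cost (lift F) T (x0, v0)) + ereal e"
      using r(2) k mult_left_mono[of r "min_cost (lift F) T (x0, v0) + e / k" k] by (simp add: distrib_left)
    finally show "(INF \<gamma>\<in>C1_curves_from (torus_of x0) v0. ereal k * action F T \<gamma>)
        \<le> ereal (k * min_cost (lift F) T (x0, v0)) + ereal e" .
  qed
  show "ereal (k * min_cost (lift F) T (x0, v0)) \<le> (INF \<gamma>\<in>C1_curves_from (torus_of x0) v0. ereal k * action F T \<gamma>)"
  proof (rule INF_greatest)
    fix \<gamma> assume \<gamma>: "\<gamma> \<in> C1_curves_from (torus_of x0) v0"
    show "ereal (k * min_cost (lift F) T (x0, v0)) \<le> ereal k * action F T \<gamma>"
    proof (cases "H2_curve T \<gamma>")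
      case False
      then show ?thesis using k by (simp add: action_def)
    next
      case True
      have C1: "\<gamma> \<in> C1_curves" "torus_of x0 = \<gamma> 0" "velocity \<gamma> 0 = v0"
        using \<gamma> by (auto simp: C1_curves_from_def)
      note t = H2_curve_traj[OF F(1) C1(1,2) True T]
      have "cost (lift F) T (\<lambda>t. x0 + integral {0..t} (velocity \<gamma>)) (velocity \<gamma>)
          (\<lambda>t. indicator {0<..<T} t *\<^sub>R acceleration T \<gamma> t) \<in> costs (lift F) T (x0, v0)"
        unfolding costs_def using t(1) C1(3) by fastforce
      then show ?thesis
        unfolding t(2) min_cost_def times_ereal.simps ereal_less_eq
        using k by (intro mult_left_mono cInf_lower costs_bdd_below nn) auto
    qed
  qed
qed

section \<open>The ergodic constant\<close>

lemma traj_translate: "traj T x v w \<Longrightarrow> traj T (\<lambda>t. x t + a) v w"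
  by (auto simp: traj_def antideriv_def)

text \<open>
  The Hermite cubic with the given positions and velocities at times \<open>0\<close> and \<open>1\<close>.
\<close>

lemma traj_connection:
  fixes xa xb va vb :: "'a::euclidean_space"
  defines "b \<equiv> 6 *\<^sub>R (va + vb) - 12 *\<^sub>R (xb - xa)"
    and "a \<equiv> 6 *\<^sub>R (xb - xa) - 4 *\<^sub>R va - 2 *\<^sub>R vb"
  defines "w \<equiv> \<lambda>t::real. a + t *\<^sub>R b"
    and "v \<equiv> \<lambda>t::real. va + t *\<^sub>R a + (t\<^sup>2 / 2) *\<^sub>R b"
    and "x \<equiv> \<lambda>t::real. xa + t *\<^sub>R va + (t\<^sup>2 / 2) *\<^sub>R a + (t ^ 3 / 6) *\<^sub>R b"
  shows "traj T x v w" "x 0 = xa" "v 0 = va" "x 1 = xb" "v 1 = vb"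
proof -
  have cw: "continuous_on S w" for S unfolding w_def by (intro continuous_intros)
  have dv: "(v has_vector_derivative w t) (at t)" for t
    unfolding v_def w_def by (auto intro!: derivative_eq_intros)
  have dx: "(x has_vector_derivative v t) (at t)" for t
    unfolding x_def v_def by (auto intro!: derivative_eq_intros simp: power2_eq_square)
  show "traj T x v w"
    unfolding traj_def
    by (intro conjI antideriv_has_vector_derivative dv dx borel_measurable_continuous_onI cw
        borel_integrable_atLeastAtMost' continuous_intros)
  show "x 0 = xa" "v 0 = va" by (auto simp: x_def v_def)
  show "v 1 = vb"
    unfolding v_def a_def b_def
    by (rule euclidean_eqI) (simp add: inner_add_left inner_diff_left algebra_simps)
  show "x 1 = xb"
    unfolding x_def a_def b_def
    by (rule euclidean_eqI) (simp add: inner_add_left inner_diff_left algebra_simps)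
qed

lemma nearby_integer_translate:
  fixes x y :: "real^'d::finite"
  obtains n where "\<And>i. n $ i \<in> \<int>" "norm (x + n - y) \<le> real CARD('d)"
proof
  define n :: "real^'d" where "n = (\<chi> i. of_int \<lfloor>y $ i - x $ i\<rfloor>)"
  show "n $ i \<in> \<int>" for i by (simp add: n_def)
  have "norm (x + n - y) \<le> (\<Sum>i\<in>UNIV. \<bar>(x + n - y) $ i\<bar>)"
    by (rule norm_le_l1_cart)
  also have "\<dots> \<le> (\<Sum>i\<in>(UNIV::'d set). 1)"
  proof (rule sum_mono)
    fix i
    show "\<bar>(x + n - y) $ i\<bar> \<le> 1"
      by (simp add: n_def) linarith
  qed
  finally show "norm (x + n - y) \<le> real CARD('d)" by simp
qed

text \<open>
  The properties of the lift of \<open>F\<close> on which the estimates for trajectories rest.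
\<close>

locale periodic_lagrangian =
  fixes f :: "(real^'d::finite) \<times> (real^'d) \<Rightarrow> real" and \<alpha> c :: real
  assumes cont: "continuous_on UNIV f"
    and \<alpha>: "\<alpha> > 1" and c: "c \<ge> 1"
    and lower: "(1 / c) * norm v powr \<alpha> - c \<le> f (x, v)"
    and upper: "f (x, v) \<le> c * (1 + norm v powr \<alpha>)"
    and nonneg: "f z \<ge> 0"
    and periodic: "(\<And>i. n $ i \<in> \<int>) \<Longrightarrow> f (x + n, v) = f (x, v)"
begin

lemma cost_nn: "cost f T x v w \<ge> 0"
  by (rule cost_nonneg[OF nonneg])

lemma running_cost_nonneg: "running_cost f x v w t \<ge> 0"
  using nonneg by (simp add: running_cost_def)

lemma cost_mono:
  assumes "traj T x v w" "0 \<le> S" "S \<le> T"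
  shows "cost f S x v w \<le> cost f T x v w"
  using cost_split[OF assms(1) cont assms(2,3)] cost_nn[of "T - S"] by simp

lemma cost_piece:
  assumes "traj T x v w" "0 \<le> a" "a + S \<le> T" "0 \<le> S"
  shows "cost f S (\<lambda>t. x (t + a)) (\<lambda>t. v (t + a)) (\<lambda>t. w (t + a)) \<le> cost f T x v w"
proof -
  have "cost f S (\<lambda>t. x (t + a)) (\<lambda>t. v (t + a)) (\<lambda>t. w (t + a))
      \<le> cost f (T - a) (\<lambda>t. x (t + a)) (\<lambda>t. v (t + a)) (\<lambda>t. w (t + a))"
    by (rule cost_mono[OF traj_shift[OF assms(1,2)]]) (use assms in auto)
  then show ?thesis
    using cost_split[OF assms(1) cont assms(2)] assms(3,4) cost_nn[of a x v w] by simp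
qed

lemma cost_translate:
  assumes "\<And>i. n $ i \<in> \<int>" shows "cost f T (\<lambda>t. x t + n) v w = cost f T x v w"
  unfolding cost_def running_cost_def by (simp add: periodic[OF assms])

lemma min_cost_le: "traj T x v w \<Longrightarrow> min_cost f T (x 0, v 0) \<le> cost f T x v w"
  unfolding min_cost_def by (rule cInf_lower[OF _ costs_bdd_below[OF nonneg]]) (auto simp: costs_def)

lemma min_cost_greatest:
  assumes "\<And>x v w. traj T x v w \<Longrightarrow> (x 0, v 0) = z \<Longrightarrow> k \<le> cost f T x v w"
  shows "k \<le> min_cost f T z"
  unfolding min_cost_def by (rule cInf_greatest[OF costs_nonempty]) (auto simp: costs_def intro: assms)

definition least_cost :: "real \<Rightarrow> real" where
  "least_cost T = Inf (\<Union>z. costs f T z)"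

lemma all_costs_bdd: "bdd_below (\<Union>z. costs f T z)" "(\<Union>z. costs f T z) \<noteq> {}"
proof -
  show "bdd_below (\<Union>z. costs f T z)"
    by (auto simp: costs_def bdd_below_def intro!: exI[of _ 0] cost_nn)
  show "(\<Union>z. costs f T z) \<noteq> {}"
    by (simp only: UNION_empty_conv) (simp add: costs_nonempty)
qed

lemma least_cost_le: "traj T x v w \<Longrightarrow> least_cost T \<le> cost f T x v w"
  unfolding least_cost_def by (rule cInf_lower[OF _ all_costs_bdd(1)]) (auto simp: costs_def)

lemma least_cost_greatest:
  assumes "\<And>x v w. traj T x v w \<Longrightarrow> k \<le> cost f T x v w"
  shows "k \<le> least_cost T"
  unfolding least_cost_def by (rule cInf_greatest[OF all_costs_bdd(2)]) (auto simp: costs_def intro: assms)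

lemma least_cost_approx:
  assumes "e > 0"
  obtains x v w where "traj T x v w" "cost f T x v w < least_cost T + e"
proof -
  have "Inf (\<Union>z. costs f T z) < least_cost T + e" using assms by (simp add: least_cost_def)
  then obtain r z where "r \<in> costs f T z" "r < least_cost T + e"
    using cInf_lessD[OF all_costs_bdd(2)] by blast
  then show thesis using that by (auto simp: costs_def)
qed

lemma least_cost_nonneg: "least_cost T \<ge> 0"
  by (rule least_cost_greatest[OF cost_nn])

text \<open>
  Both parts of a trajectory that is cut at time \<open>S\<close> compete in the problem with free endpoints.
\<close>

lemma least_cost_superadditive:
  assumes "0 \<le> S" "0 \<le> T" shows "least_cost S + least_cost T \<le> least_cost (S + T)"
proof (rule least_cost_greatest)
  fix x v w :: "real \<Rightarrow> real^'d" assume t: "traj (S + T) x v w"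
  show "least_cost S + least_cost T \<le> cost f (S + T) x v w"
    using cost_split[OF t cont assms(1)] least_cost_le[OF traj_restrict[OF t, of S]]
      least_cost_le[OF traj_shift[OF t, of S T]] assms by simp
qed

lemma least_cost_linear_bound:
  assumes "0 \<le> T" shows "least_cost T \<le> c * T"
proof -
  have t: "traj T (\<lambda>t. 0 + t *\<^sub>R 0) (\<lambda>t. 0) (\<lambda>t. 0::real^'d)" by (rule traj_const)
  have "least_cost T \<le> cost f T (\<lambda>t. 0 + t *\<^sub>R 0) (\<lambda>t. 0) (\<lambda>t. 0)" by (rule least_cost_le[OF t])
  also have "\<dots> = T * f (0, 0)" using assms by (simp add: cost_def running_cost_def[abs_def])
  also have "\<dots> \<le> T * c" using upper[of 0 0] assms by (intro mult_left_mono) auto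
  finally show ?thesis by (simp add: mult.commute)
qed

definition rate :: real where
  "rate = (SUP T\<in>{0<..}. least_cost T / T)"

lemma rate_bdd: "bdd_above ((\<lambda>T. least_cost T / T) ` {0<..})"
  using least_cost_linear_bound by (auto simp: bdd_above_def field_simps intro!: exI[of _ c])

lemma least_cost_le_rate:
  assumes "0 \<le> T" shows "least_cost T \<le> rate * T"
proof (cases "T = 0")
  case True
  then show ?thesis using least_cost_linear_bound[of 0] by simp
next
  case False
  then have "least_cost T / T \<le> rate"
    unfolding rate_def using assms by (intro cSUP_upper rate_bdd) auto
  then show ?thesis using False assms by (simp add: field_simps)
qed

lemma rate_nonneg: "rate \<ge> 0"
  using least_cost_le_rate[of 1] least_cost_nonneg[of 1] by simp

text \<open>
  One horizon \<open>T\<^sub>0\<close> with \<open>least_cost T\<^sub>0 / T\<^sub>0 > c'\<close> suffices: by superadditivity the mean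
  cost over its multiples is no smaller, and the cost of the remaining time is nonnegative.
\<close>

lemma least_cost_lower:
  assumes "c' < rate"
  obtains K where "K \<ge> 0" "\<And>T. 0 \<le> T \<Longrightarrow> c' * T - K \<le> least_cost T"
proof -
  obtain T0 where T0: "T0 > 0" "c' < least_cost T0 / T0"
    using less_cSUP_iff[OF _ rate_bdd, of c'] assms unfolding rate_def by auto
  have mult: "real n * least_cost T0 \<le> least_cost (real n * T0)" for n :: nat
  proof (induction n)
    case 0
    then show ?case using least_cost_nonneg by simp
  next
    case (Suc n)
    then show ?case
      using least_cost_superadditive[of "real n * T0" T0] T0 by (simp add: algebra_simps)
  qed
  show thesis
  proof
    show "least_cost T0 \<ge> 0" by (rule least_cost_nonneg)
    fix T :: real assume T: "0 \<le> T"
    define n where "n = nat \<lfloor>T / T0\<rfloor>"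
    have n: "real n \<le> T / T0" "T / T0 < real n + 1"
      using T T0 unfolding n_def by (auto simp: of_nat_nat)
    then have nT: "real n * T0 \<le> T" using T0 by (simp add: field_simps)
    have "c' * T \<le> (least_cost T0 / T0) * T" using T0 T by (intro mult_right_mono) auto
    also have "\<dots> = (T / T0) * least_cost T0" by simp
    also have "\<dots> \<le> (real n + 1) * least_cost T0"
      using n least_cost_nonneg by (intro mult_right_mono) auto
    also have "\<dots> \<le> least_cost (real n * T0) + least_cost T0" using mult[of n] by (simp add: algebra_simps)
    also have "least_cost (real n * T0) \<le> least_cost T"
      using least_cost_superadditive[of "real n * T0" "T - real n * T0"] nT T0
        least_cost_nonneg[of "T - real n * T0"] by simp
    finally show "c' * T - least_cost T0 \<le> least_cost T" by simp
  qed
qed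

text \<open>
  If \<open>f\<close> were at least \<open>B\<close> along the trajectory throughout \<open>[a,b]\<close>, that interval alone
  would cost \<open>(b - a) B\<close>.
\<close>

lemma good_time:
  assumes t: "traj T x v w" and "0 \<le> a" "a < b" "b \<le> T" "cost f T x v w < (b - a) * B"
  shows "\<exists>s\<in>{a..b}. f (x s, v s) < B"
proof (rule ccontr)
  assume n: "\<not> (\<exists>s\<in>{a..b}. f (x s, v s) < B)"
  have "(b - a) * B = integral {a..b} (\<lambda>_. B)" using assms by simp
  also have "\<dots> \<le> integral {a..b} (running_cost f x v w)"
  proof (rule integral_le)
    show "running_cost f x v w integrable_on {a..b}"
      by (rule running_cost_integrable[OF t cont]) (use assms in auto)
    show "B \<le> running_cost f x v w s" if "s \<in> {a..b}" for s
    proof -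
      have "B \<le> f (x s, v s)" using n that by force
      then show ?thesis by (simp add: running_cost_def add_increasing)
    qed
  qed auto
  also have "\<dots> \<le> cost f T x v w"
    unfolding cost_def
    by (rule integral_subset_le) (use assms running_cost_integrable[OF t cont] running_cost_nonneg in auto)
  finally show False using assms(5) by simp
qed

lemma speed_bound:
  assumes "f (x, v) < B" shows "norm v \<le> (c * (B + c)) powr (1 / \<alpha>)"
proof -
  have "(1 / c) * norm v powr \<alpha> \<le> B + c" using lower[of v x] assms by linarith
  then have "norm v powr \<alpha> \<le> c * (B + c)" using c by (simp add: field_simps)
  then have "(norm v powr \<alpha>) powr (1 / \<alpha>) \<le> (c * (B + c)) powr (1 / \<alpha>)"
    using \<alpha> by (intro powr_mono2) auto
  then show ?thesis using \<alpha> by (simp add: powr_powr)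
qed

text \<open>
  A near minimiser on \<open>[0, (1 + \<delta>) T]\<close> is cut at one good time in each of the two windows of length
  \<open>\<delta> T / 2\<close> at the ends. The windows are proportional to \<open>T\<close>, as is the total cost, which is why the
  speed bound \<open>R\<close> at the cuts does not depend on \<open>T\<close>.
\<close>

lemma near_optimal_piece:
  assumes \<delta>: "\<delta> > 0"
  obtains R where "\<And>T. T \<ge> 1 \<Longrightarrow> \<exists>S x v w. T \<le> S \<and> traj S x v w \<and> norm (v 0) \<le> R \<and> norm (v S) \<le> R
    \<and> cost f S x v w \<le> rate * (1 + \<delta>) * T + 1"
proof -
  \<comment> \<open>chosen such that \<open>\<delta> T / 2 * B\<close> exceeds the cost bound \<open>rate (1 + \<delta>) T + 1\<close> for \<open>T \<ge> 1\<close>\<close>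
  define B where "B = 2 * (rate * (1 + \<delta>) + 2) / \<delta>"
  define R where "R = (c * (B + c)) powr (1 / \<alpha>)"
  have "\<exists>S x v w. T \<le> S \<and> traj S x v w \<and> norm (v 0) \<le> R \<and> norm (v S) \<le> R
    \<and> cost f S x v w \<le> rate * (1 + \<delta>) * T + 1" if T: "T \<ge> 1" for T
  proof -
    define T1 where "T1 = (1 + \<delta>) * T"
    have d: "\<delta> * T > 0" using \<delta> T by simp
    have T1: "T1 = T + \<delta> * T" by (simp add: T1_def algebra_simps)
    obtain x v w where t: "traj T1 x v w" "cost f T1 x v w < least_cost T1 + 1"
      by (rule least_cost_approx[of 1 T1]) auto
    have ct: "cost f T1 x v w \<le> rate * (1 + \<delta>) * T + 1"
      using t(2) least_cost_le_rate[of T1] T1 d T by (simp add: T1_def mult.assoc)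
    also have "\<dots> < T * (rate * (1 + \<delta>) + 2)"
      using T by (simp add: algebra_simps)
    also have "\<dots> = (\<delta> * T / 2) * B"
      using \<delta> by (simp add: B_def)
    finally have small: "cost f T1 x v w < (\<delta> * T / 2) * B" .
    have le: "\<delta> * T / 2 \<le> T1" using T1 d T by linarith
    obtain t0 where t0: "0 \<le> t0" "t0 \<le> \<delta> * T / 2" "f (x t0, v t0) < B"
      using good_time[OF t(1), of 0 "\<delta> * T / 2" B] d le T small by auto
    obtain t1 where t1: "T1 - \<delta> * T / 2 \<le> t1" "t1 \<le> T1" "f (x t1, v t1) < B"
      using good_time[OF t(1), of "T1 - \<delta> * T / 2" T1 B] d le T small by auto
    have S: "T \<le> t1 - t0" using t0 t1 T1 by linarith
    show ?thesis
    proof (intro exI conjI)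
      show "traj (t1 - t0) (\<lambda>t. x (t + t0)) (\<lambda>t. v (t + t0)) (\<lambda>t. w (t + t0))"
        by (rule traj_shift[OF t(1)]) (use t0 t1 in auto)
      show "cost f (t1 - t0) (\<lambda>t. x (t + t0)) (\<lambda>t. v (t + t0)) (\<lambda>t. w (t + t0)) \<le> rate * (1 + \<delta>) * T + 1"
        by (rule order.trans[OF cost_piece[OF t(1)] ct]) (use t0 t1 S T in auto)
    qed (use S t0 t1 speed_bound in \<open>auto simp: R_def\<close>)
  qed
  then show thesis using that by blast
qed

text \<open>
  Control and velocity of the cubic of \<open>traj_connection\<close> are bounded by a multiple of \<open>R + D\<close>, and the
  growth of \<open>f\<close> is controlled from above. The factor \<open>100\<close> is a crude choice for that multiple.
\<close>

lemma bounded_cost_connection: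
  obtains K where "\<And>x0 x1 v0 v1. norm v0 \<le> R \<Longrightarrow> norm v1 \<le> R \<Longrightarrow> norm (x1 - x0) \<le> D \<Longrightarrow>
    \<exists>x v w. traj 1 x v w \<and> x 0 = x0 \<and> v 0 = v0 \<and> x 1 = x1 \<and> v 1 = v1 \<and> cost f 1 x v w \<le> K"
proof -
  define Q where "Q = 100 * (R + D)"
  define K where "K = Q\<^sup>2 / 2 + c * (1 + Q powr \<alpha>)"
  have "\<exists>x v w. traj 1 x v w \<and> x 0 = x0 \<and> v 0 = v0 \<and> x 1 = x1 \<and> v 1 = v1 \<and> cost f 1 x v w \<le> K"
    if h: "norm v0 \<le> R" "norm v1 \<le> R" "norm (x1 - x0) \<le> D" for x0 x1 v0 v1 :: "real^'d"
  proof -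
    define b where "b = 6 *\<^sub>R (v0 + v1) - 12 *\<^sub>R (x1 - x0)"
    define a where "a = 6 *\<^sub>R (x1 - x0) - 4 *\<^sub>R v0 - 2 *\<^sub>R v1"
    let ?w = "\<lambda>t::real. a + t *\<^sub>R b"
    let ?v = "\<lambda>t::real. v0 + t *\<^sub>R a + (t\<^sup>2 / 2) *\<^sub>R b"
    let ?x = "\<lambda>t::real. x0 + t *\<^sub>R v0 + (t\<^sup>2 / 2) *\<^sub>R a + (t ^ 3 / 6) *\<^sub>R b"
    note tr = traj_connection[where xa = x0 and xb = x1 and va = v0 and vb = v1, folded a_def b_def]
    have nR: "0 \<le> R" "0 \<le> D" using h norm_ge_zero order.trans by blast+
    have "norm b \<le> norm (6 *\<^sub>R (v0 + v1)) + norm (12 *\<^sub>R (x1 - x0))" unfolding b_def by (rule norm_triangle_ineq4)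
    also have "\<dots> \<le> 6 * (R + R) + 12 * D"
      using h norm_triangle_ineq[of v0 v1] by simp
    finally have nb: "norm b \<le> 12 * (R + D)" by simp
    have "norm a \<le> norm (6 *\<^sub>R (x1 - x0)) + norm (4 *\<^sub>R v0) + norm (2 *\<^sub>R v1)"
      unfolding a_def by (intro order.trans[OF norm_triangle_ineq4] add_mono norm_triangle_ineq4) auto
    also have "\<dots> \<le> 6 * D + 4 * R + 2 * R" using h by simp
    finally have na: "norm a \<le> 6 * (R + D)" by simp
    have wb: "norm (?w t) \<le> Q" if "t \<in> {0..1}" for t
    proof -
      have "norm (?w t) \<le> norm a + norm (t *\<^sub>R b)" by (rule norm_triangle_ineq)
      also have "norm (t *\<^sub>R b) \<le> norm b" using that by (auto intro: mult_left_le_one_le)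
      finally show ?thesis using na nb nR by (simp add: Q_def)
    qed
    have vb: "norm (?v t) \<le> Q" if "t \<in> {0..1}" for t
    proof -
      have "norm (?v t) \<le> norm v0 + norm (t *\<^sub>R a) + norm ((t\<^sup>2 / 2) *\<^sub>R b)"
        by (intro order.trans[OF norm_triangle_ineq] add_mono norm_triangle_ineq) auto
      moreover have "norm (t *\<^sub>R a) \<le> norm a" using that by (auto intro: mult_left_le_one_le)
      moreover have "t\<^sup>2 \<le> 1" using that by (auto intro: power_le_one)
      then have "norm ((t\<^sup>2 / 2) *\<^sub>R b) \<le> norm b"
        using mult_right_mono[of "t\<^sup>2 / 2" 1 "norm b"] by simp
      ultimately show ?thesis using na nb nR h by (simp add: Q_def)
    qed
    have rb: "running_cost f ?x ?v ?w t \<le> K" if "t \<in> {0..1}" for t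
    proof -
      have "(norm (?w t))\<^sup>2 \<le> Q\<^sup>2" using wb[OF that] by (intro power_mono) auto
      moreover have "f (?x t, ?v t) \<le> c * (1 + norm (?v t) powr \<alpha>)" by (rule upper)
      moreover have "c * (1 + norm (?v t) powr \<alpha>) \<le> c * (1 + Q powr \<alpha>)"
        using vb[OF that] c \<alpha> by (intro mult_left_mono add_mono powr_mono2) auto
      ultimately show ?thesis by (simp add: running_cost_def K_def)
    qed
    have "cost f 1 ?x ?v ?w \<le> integral {0..1::real} (\<lambda>_. K)"
      unfolding cost_def
      by (rule integral_le) (use rb running_cost_integrable[OF tr(1) cont, of 0 1] in auto)
    then have "cost f 1 ?x ?v ?w \<le> K" by simp
    then show ?thesis using tr by blast
  qed
  then show thesis using that by blast
qed

text \<open>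
  From the given state a connection of unit length leads to a translate of a near optimal piece; the
  cost is nondecreasing in time, so the surplus length of the piece does no harm.
\<close>

lemma min_cost_upper:
  assumes \<delta>: "\<delta> > 0"
  obtains K where "\<And>T. T \<ge> 1 \<Longrightarrow> min_cost f T z \<le> rate * (1 + \<delta>) * T + K"
proof -
  obtain R where R: "\<And>T. T \<ge> 1 \<Longrightarrow> \<exists>S x v w. T \<le> S \<and> traj S x v w \<and> norm (v 0) \<le> R \<and> norm (v S) \<le> R
    \<and> cost f S x v w \<le> rate * (1 + \<delta>) * T + 1" using near_optimal_piece[OF \<delta>] by metis
  obtain K where K: "\<And>x0 x1 v0 v1. norm v0 \<le> max R (norm (snd z)) \<Longrightarrow> norm v1 \<le> max R (norm (snd z)) \<Longrightarrow>
    norm (x1 - x0) \<le> real CARD('d) \<Longrightarrow>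
    \<exists>x v w. traj 1 x v w \<and> x 0 = x0 \<and> v 0 = v0 \<and> x 1 = x1 \<and> v 1 = v1 \<and> cost f 1 x v w \<le> K"
    using bounded_cost_connection[of "max R (norm (snd z))" "real CARD('d)"] by metis
  have "min_cost f T z \<le> rate * (1 + \<delta>) * T + (1 + K)" if T: "T \<ge> 1" for T
  proof -
    obtain S x v w where p: "T \<le> S" "traj S x v w" "norm (v 0) \<le> R" "cost f S x v w \<le> rate * (1 + \<delta>) * T + 1"
      using R[OF T] by blast
    obtain n where n: "\<And>i. n $ i \<in> \<int>" "norm (x 0 + n - fst z) \<le> real CARD('d)"
      using nearby_integer_translate[of "x 0" "fst z"] by blast
    obtain x' v' w' where q: "traj 1 x' v' w'" "x' 0 = fst z" "v' 0 = snd z" "x' 1 = x 0 + n" "v' 1 = v 0"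
      "cost f 1 x' v' w' \<le> K"
      using K[of "snd z" "v 0" "x 0 + n" "fst z"] p(3) n(2) by (auto simp: le_max_iff_disj)
    let ?x = "glue 1 x' (\<lambda>t. x t + n)" and ?v = "glue 1 v' v" and ?w = "glue 1 w' w"
    have t: "traj (1 + S) ?x ?v ?w"
      by (rule traj_glue[OF q(1) traj_translate[OF p(2)]]) (use q p T in auto)
    have "cost f (1 + S) ?x ?v ?w = cost f 1 x' v' w' + cost f S (\<lambda>t. x t + n) v w"
      by (rule cost_glue[OF q(1) traj_translate[OF p(2)] cont]) (use q p T in auto)
    then have "cost f (1 + S) ?x ?v ?w \<le> K + (rate * (1 + \<delta>) * T + 1)"
      using q(6) p(4) cost_translate[OF n(1), of S x v w] by simp
    moreover have "cost f T ?x ?v ?w \<le> cost f (1 + S) ?x ?v ?w"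
      by (rule cost_mono[OF t]) (use T p in auto)
    moreover have "min_cost f T (?x 0, ?v 0) \<le> cost f T ?x ?v ?w"
      by (rule min_cost_le[OF traj_restrict[OF t]]) (use p in auto)
    moreover have "(?x 0, ?v 0) = z" using q by (simp add: glue_def)
    ultimately show ?thesis by simp
  qed
  then show thesis using that by blast
qed

lemma min_cost_limit: "((\<lambda>T. min_cost f T z / T) \<longlongrightarrow> rate) at_top"
proof (rule tendstoI)
  fix e :: real assume e: "e > 0"
  obtain K where K: "K \<ge> 0" "\<And>T. 0 \<le> T \<Longrightarrow> (rate - e / 3) * T - K \<le> least_cost T"
    using least_cost_lower[of "rate - e / 3"] e by auto
  \<comment> \<open>The error \<open>rate * \<delta> * T\<close> of \<open>min_cost_upper\<close> is then at most \<open>e T / 3\<close>.\<close>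
  define \<delta> where "\<delta> = e / (3 * (rate + 1))"
  have \<delta>: "\<delta> > 0" "rate * \<delta> \<le> e / 3"
    using e rate_nonneg by (auto simp: \<delta>_def field_simps)
  obtain L where L: "\<And>T. T \<ge> 1 \<Longrightarrow> min_cost f T z \<le> rate * (1 + \<delta>) * T + L"
    using min_cost_upper[OF \<delta>(1)] by metis
  have "\<forall>\<^sub>F T in at_top. T \<ge> 1 \<and> T > 3 * K / e \<and> T > 3 * L / e"
    using eventually_ge_at_top eventually_gt_at_top by (intro eventually_conj) auto
  then show "\<forall>\<^sub>F T in at_top. dist (min_cost f T z / T) rate < e"
  proof eventually_elim
    case (elim T)
    have b: "3 * K < e * T" "3 * L < e * T" using elim e by (auto simp: field_simps)
    have "least_cost T \<le> min_cost f T z" by (rule min_cost_greatest) (rule least_cost_le)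
    then have lo: "(rate - e) * T < min_cost f T z"
      using K(2)[of T] elim b mult_pos_pos[OF e, of T] by (simp add: algebra_simps)
    have "rate * \<delta> * T \<le> e / 3 * T" using \<delta>(2) elim by (intro mult_right_mono) auto
    then have hi: "min_cost f T z < (rate + e) * T"
    proof -
      have "rate * (1 + \<delta>) * T = rate * T + rate * \<delta> * T" "(rate + e) * T = rate * T + e * T"
        by (simp_all add: algebra_simps)
      moreover have "e / 3 * T = e * T / 3" by simp
      moreover have "min_cost f T z \<le> rate * (1 + \<delta>) * T + L" "0 < e * T" using L elim e by auto
      ultimately show ?thesis using \<open>rate * \<delta> * T \<le> e / 3 * T\<close> b by linarith
    qed
    have "rate - e < min_cost f T z / T" "min_cost f T z / T < rate + e"
      using lo hi elim by (auto simp: field_simps)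
    then show ?case by (simp add: dist_real_def abs_less_iff)
  qed
qed

end

section \<open>Rotations of phase space\<close>

text \<open>
  The flow of the harmonic oscillator \<open>x' = v\<close>, \<open>v' = -x\<close>.
\<close>

definition rot :: "real \<Rightarrow> 'a::euclidean_space \<times> 'a \<Rightarrow> 'a \<times> 'a" where
  "rot t z = (cos t *\<^sub>R fst z + sin t *\<^sub>R snd z, cos t *\<^sub>R snd z - sin t *\<^sub>R fst z)"

lemma norm_rot: "norm (rot t z) = norm z"
proof -
  have "rot t z \<bullet> rot t z = ((sin t)\<^sup>2 + (cos t)\<^sup>2) * (fst z \<bullet> fst z + snd z \<bullet> snd z)"
    unfolding rot_def inner_Pair
    by (simp only: inner_add_left inner_add_right inner_diff_left inner_diff_right inner_scaleR_left
        inner_scaleR_right inner_commute[of "snd z" "fst z"] power2_eq_square) algebra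
  then show ?thesis by (simp add: norm_eq_sqrt_inner inner_prod_def)
qed

lemma norm_fst_rot_le: "norm (fst (rot t z)) \<le> norm z" "norm (snd (rot t z)) \<le> norm z"
  using norm_fst_le[of "fst (rot t z)" "snd (rot t z)"] norm_snd_le[of "snd (rot t z)" "fst (rot t z)"]
  by (simp_all add: norm_rot)

lemma continuous_rot: "continuous_on S (rot t)"
  unfolding rot_def by (intro continuous_intros)

lemma shear_fst_lborel:
  "distr lborel borel (\<lambda>z::'a::euclidean_space \<times> 'a. (fst z + a *\<^sub>R snd z, snd z)) = lborel"
proof (rule measure_eqI)
  let ?S = "\<lambda>z::'a \<times> 'a. (fst z + a *\<^sub>R snd z, snd z)"
  have m: "?S \<in> borel_measurable borel"
    by (intro borel_measurable_continuous_onI continuous_intros)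
  fix A assume "A \<in> sets (distr lborel borel ?S)"
  then have A: "A \<in> sets borel" by simp
  have A': "?S -` A \<in> sets borel"
    using measurable_sets[OF m A] by simp
  have mA: "(\<lambda>z::'a \<times> 'a. indicator A z :: ennreal) \<in> borel_measurable (lborel \<Otimes>\<^sub>M lborel)"
    using A by (simp add: lborel_prod)
  have mS: "(\<lambda>z::'a \<times> 'a. indicator A (?S z) :: ennreal) \<in> borel_measurable (lborel \<Otimes>\<^sub>M lborel)"
    using measurable_compose[OF m borel_measurable_indicator[OF A]] by (simp add: lborel_prod)
  have "emeasure (distr lborel borel ?S) A = (\<integral>\<^sup>+z. indicator A z \<partial>distr lborel borel ?S)"
    using A by simp
  also have "\<dots> = (\<integral>\<^sup>+z. indicator A (?S z) \<partial>lborel)"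
    by (rule nn_integral_distr) (use m A in auto)
  also have "\<dots> = (\<integral>\<^sup>+z. indicator A (?S z) \<partial>(lborel \<Otimes>\<^sub>M lborel))" by (simp add: lborel_prod)
  also have "\<dots> = (\<integral>\<^sup>+q. \<integral>\<^sup>+p. indicator A (p + a *\<^sub>R q, q) \<partial>lborel \<partial>lborel)"
    using lborel_pair.nn_integral_snd[OF mS] by simp
  also have "\<dots> = (\<integral>\<^sup>+q. \<integral>\<^sup>+p. indicator A (p, q) \<partial>lborel \<partial>lborel)"
  proof (rule nn_integral_cong)
    fix q :: 'a
    have "(\<lambda>p. (p, q)) \<in> borel_measurable borel"
      by (intro borel_measurable_continuous_onI continuous_intros)
    then have mq: "(\<lambda>p. indicator A (p, q) :: ennreal) \<in> borel_measurable borel"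
      by (rule measurable_compose[OF _ borel_measurable_indicator[OF A]])
    have "(\<integral>\<^sup>+p. indicator A (p, q) \<partial>lborel) = (\<integral>\<^sup>+p. indicator A (p, q) \<partial>distr lborel borel ((+) (a *\<^sub>R q)))"
      by (simp add: lborel_distr_plus)
    also have "\<dots> = (\<integral>\<^sup>+p. indicator A (a *\<^sub>R q + p, q) \<partial>lborel)"
      by (rule nn_integral_distr) (use mq in auto)
    finally show "(\<integral>\<^sup>+p. indicator A (p + a *\<^sub>R q, q) \<partial>lborel) = (\<integral>\<^sup>+p. indicator A (p, q) \<partial>lborel)"
      by (simp add: add.commute)
  qed
  also have "\<dots> = (\<integral>\<^sup>+z. indicator A z \<partial>(lborel \<Otimes>\<^sub>M lborel))"
    using lborel_pair.nn_integral_snd[OF mA] by simp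
  also have "\<dots> = emeasure lborel A" using A by (simp add: lborel_prod)
  finally show "emeasure (distr lborel borel ?S) A = emeasure lborel A" .
qed simp

lemma swap_lborel: "distr lborel borel (\<lambda>z::'a::euclidean_space \<times> 'a. (snd z, fst z)) = lborel"
proof -
  have "distr (lborel \<Otimes>\<^sub>M lborel) (lborel \<Otimes>\<^sub>M lborel) (\<lambda>(x::'a, y::'a). (y, x)) = lborel \<Otimes>\<^sub>M lborel"
    by (rule lborel_pair.distr_pair_swap[symmetric])
  then have "distr lborel lborel (\<lambda>(x::'a, y::'a). (y, x)) = lborel" by (simp add: lborel_prod)
  then show ?thesis by (simp add: case_prod_unfold cong: distr_cong)
qed

lemma shear_snd_lborel:
  "distr lborel borel (\<lambda>z::'a::euclidean_space \<times> 'a. (fst z, snd z + b *\<^sub>R fst z)) = lborel" (is "distr _ _ ?T = _")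
proof -
  let ?S = "\<lambda>z::'a \<times> 'a. (fst z + b *\<^sub>R snd z, snd z)" and ?W = "\<lambda>z::'a \<times> 'a. (snd z, fst z)"
  have m: "?S \<in> borel_measurable borel" "?W \<in> borel_measurable borel"
    by (intro borel_measurable_continuous_onI continuous_intros)+
  have eq: "?T = ?W \<circ> (?S \<circ> ?W)" by auto
  have "distr lborel borel ?T = distr (distr (distr lborel borel ?W) borel ?S) borel ?W"
    unfolding eq using m by (simp add: distr_distr comp_assoc)
  then show ?thesis by (simp add: swap_lborel shear_fst_lborel)
qed

text \<open>
  A rotation by an angle \<open>t\<close> is the product of three shears with parameters \<open>tan (t/2)\<close>, \<open>- sin t\<close> and
  \<open>tan (t/2)\<close>, and a shear preserves Lebesgue measure by Fubini and translation invariance.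
\<close>

lemma rot_lborel:
  assumes "0 < t" "t < 1"
  shows "distr lborel borel (rot t :: 'a::euclidean_space \<times> 'a \<Rightarrow> _) = lborel"
proof -
  define a where "a = tan (t / 2)"
  define b where "b = - sin t"
  have c: "cos (t / 2) > 0" using assms pi_gt3 by (intro cos_gt_zero_pi) auto
  have s: "sin t = 2 * sin (t / 2) * cos (t / 2)" using sin_double[of "t / 2"] by simp
  have co: "cos t = 1 - 2 * (sin (t / 2))\<^sup>2" using cos_double_sin[of "t / 2"] by simp
  have ab: "1 + a * b = cos t"
    using c by (simp add: a_def b_def s co tan_def power2_eq_square)
  have ac: "a * (1 + cos t) = sin t"
  proof -
    have "1 + cos t = 2 * (cos (t / 2))\<^sup>2" using cos_double_cos[of "t / 2"] by simp
    then show ?thesis using c by (simp add: a_def s tan_def power2_eq_square)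
  qed
  have "2 * a + a * (a * b) = a * (1 + (1 + a * b))" by (simp add: algebra_simps)
  then have ac': "a + a + a * (a * b) = sin t" using ac ab by simp
  let ?S = "\<lambda>z::'a \<times> 'a. (fst z + a *\<^sub>R snd z, snd z)" and ?T = "\<lambda>z::'a \<times> 'a. (fst z, snd z + b *\<^sub>R fst z)"
  have m: "?S \<in> borel_measurable borel" "?T \<in> borel_measurable borel"
    by (intro borel_measurable_continuous_onI continuous_intros)+
  have "rot t z = ?S (?T (?S z))" for z :: "'a \<times> 'a"
  proof -
    have "fst (?S (?T (?S z))) = (1 + a * b) *\<^sub>R fst z + (a + a + a * (a * b)) *\<^sub>R snd z"
      by (rule euclidean_eqI) (simp add: inner_add_left algebra_simps)
    moreover have "snd (?S (?T (?S z))) = (1 + a * b) *\<^sub>R snd z + b *\<^sub>R fst z"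
      by (simp add: scaleR_add_left scaleR_add_right mult.commute)
    ultimately show ?thesis unfolding ab ac' by (simp add: rot_def b_def)
  qed
  then have eq: "rot t = ?S \<circ> (?T \<circ> ?S)" by auto
  have "distr lborel borel (rot t) = distr (distr (distr lborel borel ?S) borel ?T) borel ?S"
    unfolding eq using m by (simp add: distr_distr comp_assoc)
  then show ?thesis by (simp add: shear_fst_lborel shear_snd_lborel)
qed

text \<open>
  Adding a solution of the oscillator to a trajectory keeps the constraint \<open>x' = v\<close>. The control
  changes by the bounded function \<open>- fst (rot s z)\<close>.
\<close>

lemma traj_rot:
  assumes t: "traj T x v w"
  shows "traj T (\<lambda>s. x s + fst (rot s z)) (\<lambda>s. v s + snd (rot s z)) (\<lambda>s. w s - fst (rot s z))"
proof -
  have dp: "((\<lambda>s. fst (rot s z)) has_vector_derivative snd (rot s z)) (at s)" for s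
    unfolding rot_def by (auto intro!: derivative_eq_intros)
  have dq: "((\<lambda>s. snd (rot s z)) has_vector_derivative - fst (rot s z)) (at s)" for s
    unfolding rot_def by (auto intro!: derivative_eq_intros)
  have ch: "continuous_on S (\<lambda>s. fst (rot s z))" for S
    unfolding rot_def by (auto intro!: continuous_intros)
  have m: "(\<lambda>s. w s - fst (rot s z)) \<in> borel_measurable borel"
    using traj_measurable[OF t] borel_measurable_continuous_onI[OF ch] by measurable
  have "set_integrable lborel {0..T} (\<lambda>s. 2 * (norm (w s))\<^sup>2 + 2 * (norm (fst (rot s z)))\<^sup>2)"
    by (intro set_integral_add set_integrable_mult_right traj_square[OF t] borel_integrable_atLeastAtMost'
        continuous_intros ch)
  then have "integrable lborel (\<lambda>s. indicator {0..T} s *\<^sub>R (2 * (norm (w s))\<^sup>2 + 2 * (norm (fst (rot s z)))\<^sup>2))"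
    by (simp add: set_integrable_def)
  then have "integrable lborel (\<lambda>s. indicator {0..T} s *\<^sub>R (norm (w s - fst (rot s z)))\<^sup>2)"
  proof (rule Bochner_Integration.integrable_bound)
    show "(\<lambda>s. indicator {0..T} s *\<^sub>R (norm (w s - fst (rot s z)))\<^sup>2) \<in> borel_measurable lborel"
      using m by measurable
    show "AE s in lborel. norm (indicator {0..T} s *\<^sub>R (norm (w s - fst (rot s z)))\<^sup>2)
        \<le> norm (indicator {0..T} s *\<^sub>R (2 * (norm (w s))\<^sup>2 + 2 * (norm (fst (rot s z)))\<^sup>2))"
    proof (rule AE_I2)
      fix s
      let ?a = "norm (w s)" and ?b = "norm (fst (rot s z))"
      have "(norm (w s - fst (rot s z)))\<^sup>2 \<le> (?a + ?b)\<^sup>2"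
        by (intro power_mono norm_triangle_ineq4) auto
      also have "\<dots> \<le> 2 * ?a\<^sup>2 + 2 * ?b\<^sup>2"
        using zero_le_power2[of "?a - ?b"] by (simp add: power2_sum power2_diff)
      finally show "norm (indicator {0..T} s *\<^sub>R (norm (w s - fst (rot s z)))\<^sup>2)
        \<le> norm (indicator {0..T} s *\<^sub>R (2 * (norm (w s))\<^sup>2 + 2 * (norm (fst (rot s z)))\<^sup>2))"
        by (simp add: indicator_def)
    qed
  qed
  then have sq: "set_integrable lborel {0..T} (\<lambda>s. (norm (w s - fst (rot s z)))\<^sup>2)"
    by (simp add: set_integrable_def)
  show ?thesis
    unfolding traj_def
  proof (intro conjI m sq)
    have "antideriv T (\<lambda>s. snd (rot s z)) (\<lambda>s. - fst (rot s z))"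
      by (rule antideriv_has_vector_derivative) (rule dq)
    from antideriv_add[OF traj_v[OF t] this]
    show "antideriv T (\<lambda>s. v s + snd (rot s z)) (\<lambda>s. w s - fst (rot s z))" by simp
    have "antideriv T (\<lambda>s. fst (rot s z)) (\<lambda>s. snd (rot s z))"
      by (rule antideriv_has_vector_derivative) (rule dp)
    from antideriv_add[OF traj_x[OF t] this]
    show "antideriv T (\<lambda>s. x s + fst (rot s z)) (\<lambda>s. v s + snd (rot s z))" .
  qed
qed

lemma rot_0 [simp]: "rot 0 z = z"
  by (simp add: rot_def)

text \<open>
  A smooth function of \<open>|z|\<^sup>2\<close> is rotation invariant.
\<close>

lemma rotational_mollifier:
  fixes e :: real
  assumes "e > 0"
  obtains \<rho> :: "'a::euclidean_space \<times> 'a \<Rightarrow> real"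
  where "smooth \<rho>" "\<And>z. \<rho> z \<ge> 0" "\<And>z. norm z > e \<Longrightarrow> \<rho> z = 0" "integral\<^sup>L lborel \<rho> = 1"
    "\<And>t z. \<rho> (rot t z) = \<rho> z"
proof -
  define k where "k z = bump ((1 / e\<^sup>2) * (z \<bullet> z))" for z :: "'a \<times> 'a"
  have sm: "smooth k"
    unfolding k_def[abs_def]
    by (rule smooth_compose_real[OF smooth_bump smooth_mult[OF smooth_const]])
      (simp add: smooth_def Ck_inner_self)
  have k_eq: "k z = bump ((norm z / e)\<^sup>2)" for z
    by (simp add: k_def power2_norm_eq_inner power_divide)
  have out: "k z = 0" if "norm z > e" for z
  proof -
    have "1 \<le> norm z / e" using that assms by simp
    then show ?thesis unfolding k_eq by (intro bump_zero one_le_power)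
  qed
  have inside: "k z > 0" if "norm z < e" for z
    unfolding k_eq using that assms by (intro bump_pos) (simp add: power_less_one_iff abs_square_less_1)
  have int: "integrable lborel k"
    using correlation_integrable[of "\<lambda>_. 1" 1 k e 0] smooth_continuous[OF sm] out by simp
  define N where "N = integral\<^sup>L lborel k"
  have "N \<noteq> 0"
  proof
    assume "N = 0"
    then have "AE z in lborel. k z = 0"
      using integral_nonneg_eq_0_iff_AE[OF int] bump_nonneg by (auto simp: N_def k_def)
    then obtain A where A: "A \<in> null_sets lborel" "{z. k z \<noteq> 0} \<subseteq> A"
      by (auto simp: eventually_ae_filter)
    then have "negligible A" by (simp add: negligible_iff_null_sets null_sets_completionI)
    moreover have "ball (0::'a \<times> 'a) e \<subseteq> A" using A(2) inside by fastforce
    ultimately have "negligible (ball (0::'a \<times> 'a) e)" by (rule negligible_subset)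
    then show False using open_not_negligible[of "ball (0::'a \<times> 'a) e"] assms by auto
  qed
  moreover have "N \<ge> 0" unfolding N_def by (rule integral_nonneg_AE) (auto simp: k_def bump_nonneg)
  ultimately have N: "N > 0" by simp
  show thesis
  proof (rule that[of "\<lambda>z. (1 / N) * k z"])
    show "smooth (\<lambda>z. (1 / N) * k z)" by (rule smooth_mult[OF smooth_const sm])
    show "integral\<^sup>L lborel (\<lambda>z. (1 / N) * k z) = 1" using N by (simp add: N_def)
    show "(1 / N) * k (rot t z) = (1 / N) * k z" for t z by (simp add: k_eq norm_rot)
  qed (use N out in \<open>auto simp: k_def bump_nonneg\<close>)
qed

lemma lborel_integral_translation:
  fixes g :: "'a::euclidean_space \<Rightarrow> real"
  assumes "g \<in> borel_measurable borel"
  shows "(\<integral>\<zeta>. g (z + \<zeta>) \<partial>lborel) = integral\<^sup>L lborel g"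
proof -
  have "integral\<^sup>L (distr lborel borel ((+) z)) g = (\<integral>\<zeta>. g (z + \<zeta>) \<partial>lborel)"
    by (rule integral_distr) (use assms in auto)
  then show ?thesis by (simp add: lborel_distr_plus)
qed

lemma correlation_translate:
  fixes u \<rho> :: "'a::euclidean_space \<Rightarrow> real"
  assumes "u \<in> borel_measurable borel" "\<rho> \<in> borel_measurable borel"
  shows "correlation u \<rho> z = (\<integral>\<zeta>. u (z + \<zeta>) * \<rho> \<zeta> \<partial>lborel)"
proof -
  have "(\<lambda>\<zeta>. u \<zeta> * \<rho> (\<zeta> - z)) \<in> borel_measurable borel" using assms by measurable
  from lborel_integral_translation[OF this, of z] show ?thesis by (simp add: correlation_def)
qed

lemma traj_constant_acceleration:
  "traj T (\<lambda>t. x + t *\<^sub>R v + (t\<^sup>2 / 2) *\<^sub>R w) (\<lambda>t. v + t *\<^sub>R w) (\<lambda>t. w)"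
  unfolding traj_def
  by (auto intro!: antideriv_has_vector_derivative derivative_eq_intros borel_integrable_atLeastAtMost'
      continuous_intros)

section \<open>A mollified subsolution\<close>

context periodic_lagrangian
begin

text \<open>
  Periodicity reduces the position to a compact set, so continuity in \<open>x\<close> is uniform over all of
  \<open>\<real>\<^sup>d\<close> as long as the velocity is bounded.
\<close>

lemma uniform_modulus:
  assumes "e > 0"
  obtains d where "d > 0" "\<And>x v x' v'. norm v \<le> R \<Longrightarrow> norm (x' - x) < d \<Longrightarrow> norm (v' - v) < d \<Longrightarrow>
    \<bar>f (x', v') - f (x, v)\<bar> < e"
proof -
  define D where "D = real CARD('d)"
  let ?K = "cball (0::real^'d) (D + 1) \<times> cball (0::real^'d) (R + 1)"
  have "uniformly_continuous_on ?K f"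
    by (intro compact_uniformly_continuous continuous_on_subset[OF cont] compact_Times) auto
  then obtain d where d: "d > 0" "\<And>z z'. z \<in> ?K \<Longrightarrow> z' \<in> ?K \<Longrightarrow> dist z' z < d \<Longrightarrow> dist (f z') (f z) < e"
    unfolding uniformly_continuous_on_def using assms by metis
  show thesis
  proof
    show "min (d / 2) 1 > 0" using d by simp
    fix x v x' v' :: "real^'d"
    assume h: "norm v \<le> R" "norm (x' - x) < min (d / 2) 1" "norm (v' - v) < min (d / 2) 1"
    obtain n where n: "\<And>i. n $ i \<in> \<int>" "norm (x + n - 0) \<le> real CARD('d)"
      using nearby_integer_translate[of x 0] by blast
    have "norm (x' + n) \<le> norm (x + n) + norm (x' - x)"
      using norm_triangle_ineq[of "x + n" "x' - x"] by (simp add: algebra_simps)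
    moreover have "norm v' \<le> norm v + norm (v' - v)"
      using norm_triangle_ineq[of v "v' - v"] by simp
    ultimately have "(x + n, v) \<in> ?K" "(x' + n, v') \<in> ?K" using n h by (auto simp: D_def)
    moreover have "dist (x' + n, v') (x + n, v) < d"
    proof -
      have "dist (x' + n, v') (x + n, v) \<le> norm (x' - x) + norm (v' - v)"
        using norm_Pair_le[of "x' - x" "v' - v"] by (simp add: dist_norm)
      then show ?thesis using h by linarith
    qed
    ultimately have "dist (f (x' + n, v')) (f (x + n, v)) < e" by (rule d(2))
    then show "\<bar>f (x', v') - f (x, v)\<bar> < e" by (simp add: periodic[OF n(1)] dist_real_def)
  qed
qed

text \<open>
  All horizons compete, including \<open>T = 0\<close>, which makes the infimum \<open>potential\<close> nonpositive; \<open>c' < rate\<close> bounds it from below.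
\<close>

definition reduced_costs :: "real \<Rightarrow> (real^'d) \<times> (real^'d) \<Rightarrow> real set" where
  "reduced_costs c' z = {cost f T x v w - c' * T | T x v w. 0 \<le> T \<and> traj T x v w \<and> (x 0, v 0) = z}"

definition potential :: "real \<Rightarrow> (real^'d) \<times> (real^'d) \<Rightarrow> real" where
  "potential c' z = Inf (reduced_costs c' z)"

lemma potential_set_bounds:
  assumes "c' < rate"
  obtains K where "\<And>T x v w. 0 \<le> T \<Longrightarrow> traj T x v w \<Longrightarrow> - K \<le> cost f T x v w - c' * T"
proof -
  obtain K where K: "\<And>T. 0 \<le> T \<Longrightarrow> c' * T - K \<le> least_cost T"
    using least_cost_lower[OF assms] by metis
  have "- K \<le> cost f T x v w - c' * T" if "0 \<le> T" "traj T x v w" for T x v w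
    using K[OF that(1)] least_cost_le[OF that(2)] by linarith
  then show thesis by (rule that)
qed

lemma reduced_costs_nonempty: "reduced_costs c' z \<noteq> {}"
proof -
  have "0 \<le> (1::real) \<and> traj 1 (\<lambda>t. fst z + t *\<^sub>R snd z) (\<lambda>t. snd z) (\<lambda>t. 0)
      \<and> (fst z + 0 *\<^sub>R snd z, snd z) = z"
    by (simp add: traj_const)
  then show ?thesis unfolding reduced_costs_def by blast
qed

lemma potential_le:
  assumes "c' < rate" "0 \<le> T" "traj T x v w"
  shows "potential c' (x 0, v 0) \<le> cost f T x v w - c' * T"
proof -
  obtain K where K: "\<And>T x v w. 0 \<le> T \<Longrightarrow> traj T x v w \<Longrightarrow> - K \<le> cost f T x v w - c' * T"
    using potential_set_bounds[OF assms(1)] by metis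
  show ?thesis
    unfolding potential_def
  proof (rule cInf_lower)
    show "bdd_below (reduced_costs c' (x 0, v 0))"
      by (rule bdd_belowI[of _ "- K"]) (use K in \<open>auto simp: reduced_costs_def\<close>)
    show "cost f T x v w - c' * T \<in> reduced_costs c' (x 0, v 0)"
      unfolding reduced_costs_def using assms by blast
  qed
qed

lemma potential_greatest:
  assumes "\<And>T x v w. 0 \<le> T \<Longrightarrow> traj T x v w \<Longrightarrow> (x 0, v 0) = z \<Longrightarrow> k \<le> cost f T x v w - c' * T"
  shows "k \<le> potential c' z"
  unfolding potential_def
  by (rule cInf_greatest[OF reduced_costs_nonempty]) (auto simp: reduced_costs_def intro: assms)

lemma potential_bounded:
  assumes "c' < rate"
  obtains M where "\<And>z. \<bar>potential c' z\<bar> \<le> M"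
proof -
  obtain K where K: "\<And>T x v w. 0 \<le> T \<Longrightarrow> traj T x v w \<Longrightarrow> - K \<le> cost f T x v w - c' * T"
    using potential_set_bounds[OF assms] by metis
  have "\<bar>potential c' z\<bar> \<le> \<bar>K\<bar>" for z
  proof -
    have "- K \<le> potential c' z" by (rule potential_greatest) (rule K)
    moreover have "potential c' z \<le> 0"
      using potential_le[OF assms _ traj_const[of 0 "fst z" "snd z"]] by (simp add: cost_def)
    ultimately show ?thesis by linarith
  qed
  then show thesis by (rule that)
qed

lemma potential_periodic:
  assumes "\<And>i. n $ i \<in> \<int>" shows "potential c' (x + n, v) = potential c' (x, v)"
proof -
  have sub: "reduced_costs c' (x, v) \<subseteq> reduced_costs c' (x + n, v)" if n: "\<And>i. n $ i \<in> \<int>" for n x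
  proof
    fix r assume "r \<in> reduced_costs c' (x, v)"
    then obtain T y u w where r: "r = cost f T y u w - c' * T" "0 \<le> T" "traj T y u w" "y 0 = x" "u 0 = v"
      by (auto simp: reduced_costs_def)
    have "r = cost f T (\<lambda>t. y t + n) u w - c' * T \<and> 0 \<le> T \<and> traj T (\<lambda>t. y t + n) u w \<and> (y 0 + n, u 0) = (x + n, v)"
      using r cost_translate[OF n, of T y u w] traj_translate[OF r(3), of n] by simp
    then show "r \<in> reduced_costs c' (x + n, v)" unfolding reduced_costs_def by blast
  qed
  have "reduced_costs c' (x + n, v) \<subseteq> reduced_costs c' ((x + n) + (- n), v)"
    by (rule sub) (use assms in simp)
  then have "reduced_costs c' (x + n, v) = reduced_costs c' (x, v)" using sub[OF assms, of x] by auto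
  then show ?thesis by (simp add: potential_def)
qed

text \<open>
  A trajectory followed by a competitor for its endpoint is a competitor for its initial point.
\<close>

lemma potential_dominated:
  assumes "c' < rate" "0 \<le> T" "traj T x v w"
  shows "potential c' (x 0, v 0) \<le> cost f T x v w - c' * T + potential c' (x T, v T)"
proof -
  have "potential c' (x 0, v 0) - (cost f T x v w - c' * T) \<le> potential c' (x T, v T)"
  proof (rule potential_greatest)
    fix S y u r assume h: "0 \<le> S" "traj S y u r" "(y 0, u 0) = (x T, v T)"
    have t: "traj (T + S) (glue T x y) (glue T v u) (glue T w r)"
      by (rule traj_glue[OF assms(3) h(2)]) (use h assms in auto)
    have "cost f (T + S) (glue T x y) (glue T v u) (glue T w r) = cost f T x v w + cost f S y u r"
      by (rule cost_glue[OF assms(3) h(2) cont]) (use h assms in auto)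
    then show "potential c' (x 0, v 0) - (cost f T x v w - c' * T) \<le> cost f S y u r - c' * S"
      using potential_le[OF assms(1) _ t] h assms by (simp add: algebra_simps)
  qed
  then show ?thesis by simp
qed

text \<open>
  Cost of an oscillating perturbation of size \<open>\<eta>\<close>. The mixed term \<open>\<langle>w, h\<rangle>\<close> in \<open>|w - h|\<^sup>2\<close> is
  absorbed with \<open>2 |w| \<le> 1 + |w|\<^sup>2\<close>.
\<close>

lemma cost_rot_le:
  assumes t: "traj T x v w" and "0 \<le> T" "norm z \<le> \<eta>" "\<eta> \<le> 1"
    and e: "\<And>s. s \<in> {0..T} \<Longrightarrow> f (x s + fst (rot s z), v s + snd (rot s z)) \<le> f (x s, v s) + e"
  shows "cost f T (\<lambda>s. x s + fst (rot s z)) (\<lambda>s. v s + snd (rot s z)) (\<lambda>s. w s - fst (rot s z))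
    \<le> cost f T x v w + e * T + \<eta> * (T + integral {0..T} (\<lambda>s. (norm (w s))\<^sup>2))"
proof -
  note t' = traj_rot[OF t, of z]
  have iw: "(\<lambda>s. (norm (w s))\<^sup>2) integrable_on {0..T}"
    by (rule set_borel_integral_eq_integral(1)[OF traj_square[OF t]])
  have i0: "running_cost f x v w integrable_on {0..T}"
    by (rule running_cost_integrable[OF t cont]) auto
  have "((\<lambda>s. running_cost f x v w s + (e + \<eta> * (1 + (norm (w s))\<^sup>2))) has_integral
      (cost f T x v w + (e * T + \<eta> * (T + integral {0..T} (\<lambda>s. (norm (w s))\<^sup>2))))) {0..T}"
    unfolding cost_def
    using has_integral_add[OF integrable_integral[OF i0] has_integral_add[OF has_integral_const_real[of e 0 T]
          has_integral_mult_right[OF has_integral_add[OF has_integral_const_real[of 1 0 T] integrable_integral[OF iw]], of \<eta>]]]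
      assms(2) by (simp add: mult.commute)
  then have I: "integral {0..T} (\<lambda>s. running_cost f x v w s + (e + \<eta> * (1 + (norm (w s))\<^sup>2)))
      = cost f T x v w + (e * T + \<eta> * (T + integral {0..T} (\<lambda>s. (norm (w s))\<^sup>2)))"
    and J: "(\<lambda>s. running_cost f x v w s + (e + \<eta> * (1 + (norm (w s))\<^sup>2))) integrable_on {0..T}"
    by (auto intro: integral_unique)
  have "cost f T (\<lambda>s. x s + fst (rot s z)) (\<lambda>s. v s + snd (rot s z)) (\<lambda>s. w s - fst (rot s z))
    \<le> integral {0..T} (\<lambda>s. running_cost f x v w s + (e + \<eta> * (1 + (norm (w s))\<^sup>2)))"
    unfolding cost_def
  proof (rule integral_le[OF _ J])
    show "running_cost f (\<lambda>s. x s + fst (rot s z)) (\<lambda>s. v s + snd (rot s z)) (\<lambda>s. w s - fst (rot s z)) integrable_on {0..T}"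
      by (rule running_cost_integrable[OF t' cont]) auto
    fix s assume s: "s \<in> {0..T}"
    let ?a = "norm (w s)" and ?b = "norm (fst (rot s z))"
    have b: "?b \<le> \<eta>" "0 \<le> ?b" using norm_fst_rot_le(1)[of s z] assms(3) by auto
    have "(norm (w s - fst (rot s z)))\<^sup>2 \<le> (?a + ?b)\<^sup>2"
      by (intro power_mono norm_triangle_ineq4) auto
    also have "\<dots> = ?a\<^sup>2 + 2 * (?a * ?b) + ?b\<^sup>2" by (simp add: power2_sum)
    also have "\<dots> \<le> ?a\<^sup>2 + \<eta> * (1 + ?a\<^sup>2) + \<eta>"
    proof -
      have "2 * ?a \<le> 1 + ?a\<^sup>2" using zero_le_power2[of "?a - 1"] by (simp add: power2_diff)
      then have "(2 * ?a) * ?b \<le> (1 + ?a\<^sup>2) * \<eta>" using b by (intro mult_mono) auto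
      moreover have "?b\<^sup>2 \<le> 1 * \<eta>" unfolding power2_eq_square using b assms(4) by (intro mult_mono) auto
      ultimately show ?thesis unfolding mult.assoc mult.commute[of _ \<eta>] mult.commute[of _ ?b] by linarith
    qed
    finally have "(norm (w s - fst (rot s z)))\<^sup>2 \<le> ?a\<^sup>2 + \<eta> * (1 + ?a\<^sup>2) + \<eta>" .
    moreover have "0 \<le> \<eta>" using b by linarith
    then have "0 \<le> \<eta> * ?a\<^sup>2" by simp
    ultimately have "(norm (w s - fst (rot s z)))\<^sup>2 / 2 \<le> ?a\<^sup>2 / 2 + \<eta> * (1 + ?a\<^sup>2)"
      by (simp add: distrib_left)
    then show "running_cost f (\<lambda>s. x s + fst (rot s z)) (\<lambda>s. v s + snd (rot s z)) (\<lambda>s. w s - fst (rot s z)) s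
        \<le> running_cost f x v w s + (e + \<eta> * (1 + (norm (w s))\<^sup>2))"
      using e[OF s] by (simp add: running_cost_def)
  qed
  then show ?thesis using I by simp
qed

text \<open>
  The potential is upper semicontinuous: an almost optimal trajectory from \<open>z\<close> yields one from every
  nearby point by adding an oscillation (\<open>traj_rot\<close>), at almost the same cost.
\<close>

lemma potential_measurable:
  assumes c': "c' < rate" shows "potential c' \<in> borel_measurable borel"
  unfolding borel_measurable_iff_less
proof
  fix a
  have "open {z. potential c' z < a}"
    unfolding open_dist
  proof
    fix z assume "z \<in> {z. potential c' z < a}"
    then have "potential c' z < a" by simp
    then obtain T x v w where t: "0 \<le> T" "traj T x v w" "(x 0, v 0) = z" "cost f T x v w - c' * T < a"
      using cInf_lessD[OF reduced_costs_nonempty, of c' z a] unfolding potential_def[symmetric]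
      by (auto simp: reduced_costs_def)
    define g where "g = a - (cost f T x v w - c' * T)"
    define W where "W = integral {0..T} (\<lambda>s. (norm (w s))\<^sup>2)"
    have W: "W \<ge> 0" unfolding W_def
      by (intro Henstock_Kurzweil_Integration.integral_nonneg
          set_borel_integral_eq_integral(1)[OF traj_square[OF t(2)]]) auto
    have g: "g > 0" using t by (simp add: g_def)
    define e where "e = g / (2 * (T + 1))"
    have e: "e > 0" "e * T < g / 2" using g t(1) by (auto simp: e_def field_simps)
    obtain R where R: "\<And>s. s \<in> {0..T} \<Longrightarrow> norm (v s) \<le> R"
      using compact_imp_bounded[OF compact_continuous_image[OF antideriv_continuous[OF traj_v[OF t(2)]] compact_Icc]]
      unfolding bounded_iff by blast
    obtain d where d: "d > 0" "\<And>x v x' v'. norm v \<le> R \<Longrightarrow> norm (x' - x) < d \<Longrightarrow> norm (v' - v) < d \<Longrightarrow>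
      \<bar>f (x', v') - f (x, v)\<bar> < e" using uniform_modulus[OF e(1)] by metis
    define \<eta> where "\<eta> = min 1 (min (d / 2) (g / (2 * (T + W + 1))))"
    have \<eta>: "\<eta> > 0" "\<eta> \<le> 1" "\<eta> < d" using d g t(1) W by (auto simp: \<eta>_def)
    have "\<eta> * (T + W) \<le> g / (2 * (T + W + 1)) * (T + W)"
      using t(1) W by (intro mult_right_mono) (auto simp: \<eta>_def)
    also have "\<dots> \<le> g / 2" using g t(1) W by (simp add: field_simps)
    finally have \<eta>T: "\<eta> * (T + W) \<le> g / 2" .
    show "\<exists>r>0. \<forall>y. dist y z < r \<longrightarrow> y \<in> {z. potential c' z < a}"
    proof (intro exI[of _ \<eta>] conjI allI impI \<eta>(1))
      fix y assume y: "dist y z < \<eta>"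
      define h where "h = y - z"
      have h: "norm h \<le> \<eta>" using y by (simp add: h_def dist_norm)
      have "cost f T (\<lambda>s. x s + fst (rot s h)) (\<lambda>s. v s + snd (rot s h)) (\<lambda>s. w s - fst (rot s h))
        \<le> cost f T x v w + e * T + \<eta> * (T + W)"
        unfolding W_def
      proof (rule cost_rot_le[OF t(2,1) h \<eta>(2)])
        fix s assume s: "s \<in> {0..T}"
        have "\<bar>f (x s + fst (rot s h), v s + snd (rot s h)) - f (x s, v s)\<bar> < e"
          using norm_fst_rot_le[of s h] h \<eta>(3) by (intro d(2) R[OF s]) auto
        then show "f (x s + fst (rot s h), v s + snd (rot s h)) \<le> f (x s, v s) + e" by linarith
      qed
      moreover have "(x 0 + fst (rot 0 h), v 0 + snd (rot 0 h)) = y"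
        using t(3) by (auto simp: h_def)
      then have "potential c' y \<le> cost f T (\<lambda>s. x s + fst (rot s h)) (\<lambda>s. v s + snd (rot s h)) (\<lambda>s. w s - fst (rot s h)) - c' * T"
        using potential_le[OF c' t(1) traj_rot[OF t(2), of h]] by simp
      ultimately have "potential c' y < a" using e(2) \<eta>T by (simp add: g_def)
      then show "y \<in> {z. potential c' z < a}" by simp
    qed
  qed
  then show "{z \<in> space borel. potential c' z < a} \<in> sets borel" by simp
qed

text \<open>
  The mollified potential \<open>U z\<close> is the mean of \<open>potential c' (z + \<zeta>)\<close>. For the trajectory with constant
  control \<open>w\<close> from \<open>(x, v)\<close>, perturbed by the oscillation that starts at \<open>\<zeta>\<close>, domination gives
  \<open>potential c' ((x, v) + \<zeta>) \<le> t (B - c') + potential c' ((X t, V t) + rot t \<zeta>)\<close>, where \<open>B\<close> bounds the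
  running cost near \<open>(x, v)\<close>. In the mean over \<open>\<zeta>\<close> the rotation disappears, so that
  \<open>U (x, v) \<le> t (B - c') + U (X t, V t)\<close>; dividing by \<open>t \<rightarrow> 0\<close> gives the differential inequality.
\<close>

lemma mollified_subsolution:
  assumes c': "c' < rate" and M: "\<And>z. \<bar>potential c' z\<bar> \<le> M" and e: "e > 0"
  obtains U where "smooth U" "\<And>z. \<bar>U z\<bar> \<le> M"
    "\<And>n x v. (\<And>i. n $ i \<in> \<int>) \<Longrightarrow> U (x + n, v) = U (x, v)"
    "\<And>x v w. norm v \<le> R \<Longrightarrow> c' \<le> grad U (x, v) \<bullet> (v, w) + (norm w + e)\<^sup>2 / 2 + f (x, v) + e"
proof -
  let ?u = "potential c'"
  obtain d where d: "d > 0" "\<And>x v x' v'. norm v \<le> R \<Longrightarrow> norm (x' - x) < d \<Longrightarrow> norm (v' - v) < d \<Longrightarrow>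
      \<bar>f (x', v') - f (x, v)\<bar> < e" using uniform_modulus[OF e] by metis
  define \<epsilon> where "\<epsilon> = min e (d / 2)"
  have \<epsilon>: "\<epsilon> > 0" "\<epsilon> \<le> e" "\<epsilon> \<le> d / 2" using e d by (auto simp: \<epsilon>_def)
  obtain \<rho> :: "(real^'d) \<times> (real^'d) \<Rightarrow> real" where \<rho>: "smooth \<rho>" "\<And>z. \<rho> z \<ge> 0" "\<And>z. norm z > \<epsilon> \<Longrightarrow> \<rho> z = 0"
    "integral\<^sup>L lborel \<rho> = 1" "\<And>t z. \<rho> (rot t z) = \<rho> z"
    using rotational_mollifier[OF \<epsilon>(1)] by metis
  have mu: "?u \<in> borel_measurable borel" by (rule potential_measurable[OF c'])
  have m\<rho>: "\<rho> \<in> borel_measurable borel" by (rule smooth_measurable[OF \<rho>(1)])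
  define U where "U = correlation ?u \<rho>"
  have U: "U z = (\<integral>\<zeta>. ?u (z + \<zeta>) * \<rho> \<zeta> \<partial>lborel)" for z
    unfolding U_def by (rule correlation_translate[OF mu m\<rho>])
  have int: "integrable lborel (\<lambda>\<zeta>. ?u (z + \<zeta>) * \<rho> \<zeta>)" for z
    using correlation_integrable[of "\<lambda>\<zeta>. ?u (z + \<zeta>)" M \<rho> \<epsilon> 0] mu M \<rho>(3) smooth_continuous[OF \<rho>(1)] by simp
  have int\<rho>: "integrable lborel \<rho>"
    using correlation_integrable[of "\<lambda>\<zeta>. 1" 1 \<rho> \<epsilon> 0] \<rho>(3) smooth_continuous[OF \<rho>(1)] by simp
  show thesis
  proof
    show sm: "smooth U" unfolding U_def by (rule smooth_correlation[OF mu M \<rho>(1,3)])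
    show "\<bar>U z\<bar> \<le> M" for z
    proof -
      have "\<bar>U z\<bar> \<le> (\<integral>\<zeta>. \<bar>?u (z + \<zeta>) * \<rho> \<zeta>\<bar> \<partial>lborel)" unfolding U by (rule integral_abs_bound)
      also have "\<dots> \<le> (\<integral>\<zeta>. M * \<rho> \<zeta> \<partial>lborel)"
      proof (intro integral_mono integrable_abs int integrable_mult_right int\<rho>)
        show "\<bar>?u (z + \<zeta>) * \<rho> \<zeta>\<bar> \<le> M * \<rho> \<zeta>" for \<zeta>
          using mult_right_mono[OF M[of "z + \<zeta>"] \<rho>(2)[of \<zeta>]] \<rho>(2)[of \<zeta>] by (simp add: abs_mult)
      qed
      also have "\<dots> = M" using \<rho>(4) by simp
      finally show ?thesis .
    qed
    show "U (x + n, v) = U (x, v)" if n: "\<And>i. n $ i \<in> \<int>" for n x v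
    proof -
      have "?u ((x + n, v) + \<zeta>) = ?u ((x, v) + \<zeta>)" for \<zeta>
        using potential_periodic[OF n, of c' "x + fst \<zeta>" "v + snd \<zeta>"]
        by (simp add: plus_prod_def algebra_simps)
      then show ?thesis by (simp add: U)
    qed
    fix x v w :: "real^'d" assume v: "norm v \<le> R"
    define B where "B = (norm w + e)\<^sup>2 / 2 + f (x, v) + e"
    define X where "X t = x + t *\<^sub>R v + (t\<^sup>2 / 2) *\<^sub>R w" for t
    define V where "V t = v + t *\<^sub>R w" for t
    \<comment> \<open>Up to time \<open>t0\<close> the state moves by less than \<open>d / 2\<close>; the oscillation contributes at most \<open>\<epsilon> \<le> d / 2\<close>.\<close>
    define t0 where "t0 = min (1 / 2) (d / (4 * (norm v + norm w + 1)))"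
    have t0: "t0 > 0" using d by (auto simp: t0_def intro!: divide_pos_pos add_nonneg_pos)
    have ineq: "U (x, v) \<le> t * (B - c') + U (X t, V t)" if t: "0 < t" "t < t0" for t
    proof -
      have t1: "t < 1" using t by (simp add: t0_def)
      have tr: "traj t X V (\<lambda>_. w)"
        unfolding X_def[abs_def] V_def[abs_def] by (rule traj_constant_acceleration)
      have pt: "?u ((x, v) + \<zeta>) \<le> t * (B - c') + ?u ((X t, V t) + rot t \<zeta>)" if \<zeta>: "norm \<zeta> \<le> \<epsilon>" for \<zeta>
      proof -
        have "cost f t (\<lambda>s. X s + fst (rot s \<zeta>)) (\<lambda>s. V s + snd (rot s \<zeta>)) (\<lambda>s. w - fst (rot s \<zeta>))
          \<le> integral {0..t} (\<lambda>_. B)"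
          unfolding cost_def
        proof (rule integral_le)
          show "running_cost f (\<lambda>s. X s + fst (rot s \<zeta>)) (\<lambda>s. V s + snd (rot s \<zeta>)) (\<lambda>s. w - fst (rot s \<zeta>)) integrable_on {0..t}"
            by (rule running_cost_integrable[OF traj_rot[OF tr] cont]) auto
          fix s assume s: "s \<in> {0..t}"
          have s1: "0 \<le> s" "s \<le> 1" "s < t0" using s t t1 by auto
          have small: "s * (norm v + norm w) < d / 2"
          proof -
            have "s * (norm v + norm w) \<le> s * (norm v + norm w + 1)" using s1 by (intro mult_left_mono) auto
            also have "\<dots> \<le> d / (4 * (norm v + norm w + 1)) * (norm v + norm w + 1)"
              using s1 by (intro mult_right_mono) (auto simp: t0_def)
            also have "\<dots> = d / 4"
            proof -
              have cancel: "d / (4 * q) * q = d / 4" if "q > 0" for q :: real using that by simp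
              show ?thesis by (rule cancel) (simp add: add_nonneg_pos)
            qed
            finally show ?thesis using d(1) by simp
          qed
          have r: "norm (fst (rot s \<zeta>)) \<le> \<epsilon>" "norm (snd (rot s \<zeta>)) \<le> \<epsilon>"
            using norm_fst_rot_le[of s \<zeta>] \<zeta> by auto
          have "norm (X s + fst (rot s \<zeta>) - x) \<le> norm (s *\<^sub>R v) + norm ((s\<^sup>2 / 2) *\<^sub>R w) + norm (fst (rot s \<zeta>))"
            unfolding X_def
            using norm_triangle_ineq[of "s *\<^sub>R v + (s\<^sup>2 / 2) *\<^sub>R w" "fst (rot s \<zeta>)"]
              norm_triangle_ineq[of "s *\<^sub>R v" "(s\<^sup>2 / 2) *\<^sub>R w"] by (simp add: algebra_simps)
          moreover have "norm ((s\<^sup>2 / 2) *\<^sub>R w) \<le> s * norm w"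
          proof -
            have "s * s \<le> s" using mult_left_mono[of s 1 s] s1 by simp
            then have "s\<^sup>2 / 2 \<le> s" using s1 unfolding power2_eq_square by linarith
            then show ?thesis using mult_right_mono[of "s\<^sup>2 / 2" s "norm w"] by simp
          qed
          ultimately have 1: "norm (X s + fst (rot s \<zeta>) - x) < d"
            using small r(1) \<epsilon>(3) s1 by (simp add: distrib_left)
          have "norm (V s + snd (rot s \<zeta>) - v) \<le> s * norm w + norm (snd (rot s \<zeta>))"
            unfolding V_def using norm_triangle_ineq[of "s *\<^sub>R w" "snd (rot s \<zeta>)"] s1 by simp
          moreover have "0 \<le> s * norm v" using s1 by simp
          ultimately have 2: "norm (V s + snd (rot s \<zeta>) - v) < d"
            using small r(2) \<epsilon>(3) by (simp add: distrib_left)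
          have "norm (w - fst (rot s \<zeta>)) \<le> norm w + e"
            using norm_triangle_ineq4[of w "fst (rot s \<zeta>)"] r(1) \<epsilon>(2) by simp
          then have "(norm (w - fst (rot s \<zeta>)))\<^sup>2 \<le> (norm w + e)\<^sup>2" by (intro power_mono) auto
          then show "running_cost f (\<lambda>s. X s + fst (rot s \<zeta>)) (\<lambda>s. V s + snd (rot s \<zeta>)) (\<lambda>s. w - fst (rot s \<zeta>)) s \<le> B"
            using d(2)[OF v 1 2] unfolding running_cost_def B_def by linarith
        qed auto
        also have "\<dots> = t * B" using t by simp
        finally have le: "cost f t (\<lambda>s. X s + fst (rot s \<zeta>)) (\<lambda>s. V s + snd (rot s \<zeta>)) (\<lambda>s. w - fst (rot s \<zeta>)) \<le> t * B" .
        have "(x, v) + \<zeta> = (X 0 + fst (rot 0 \<zeta>), V 0 + snd (rot 0 \<zeta>))"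
          "(X t, V t) + rot t \<zeta> = (X t + fst (rot t \<zeta>), V t + snd (rot t \<zeta>))"
          by (simp_all add: plus_prod_def X_def V_def)
        then show ?thesis
          using potential_dominated[OF c' _ traj_rot[OF tr], of \<zeta>] t le by (simp add: algebra_simps)
      qed
      let ?G = "\<lambda>\<zeta>. ?u ((X t, V t) + \<zeta>) * \<rho> \<zeta>"
      have mG: "?G \<in> borel_measurable borel" using mu m\<rho> by measurable
      have mr: "rot t \<in> measurable lborel (borel :: ((real^'d) \<times> (real^'d)) measure)"
        using borel_measurable_continuous_onI[OF continuous_rot] by simp
      have iG: "integrable lborel (\<lambda>\<zeta>. ?G (rot t \<zeta>))"
        using integrable_distr_eq[OF mr mG] int[of "(X t, V t)"] unfolding rot_lborel[OF t(1) t1] by blast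
      have eG: "(\<integral>\<zeta>. ?G (rot t \<zeta>) \<partial>lborel) = U (X t, V t)"
        using integral_distr[OF mr mG] unfolding rot_lborel[OF t(1) t1] U by (rule sym)
      have "U (x, v) \<le> (\<integral>\<zeta>. t * (B - c') * \<rho> \<zeta> + ?G (rot t \<zeta>) \<partial>lborel)"
        unfolding U
      proof (rule integral_mono[OF int Bochner_Integration.integrable_add[OF integrable_mult_right[OF int\<rho>] iG]])
        fix \<zeta>
        show "?u ((x, v) + \<zeta>) * \<rho> \<zeta> \<le> t * (B - c') * \<rho> \<zeta> + ?G (rot t \<zeta>)"
        proof (cases "norm \<zeta> \<le> \<epsilon>")
          case True
          then show ?thesis
            using mult_right_mono[OF pt[OF True] \<rho>(2)[of \<zeta>]] by (simp add: \<rho>(5) distrib_right)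
        next
          case False
          then show ?thesis using \<rho>(3)[of \<zeta>] by (simp add: \<rho>(5))
        qed
      qed
      also have "\<dots> = t * (B - c') + U (X t, V t)"
        using Bochner_Integration.integral_add[OF integrable_mult_right[OF int\<rho>] iG] eG \<rho>(4) by simp
      finally show ?thesis .
    qed
    have "((\<lambda>t. U (X t, V t)) has_real_derivative grad U (x, v) \<bullet> (v, w)) (at 0)"
    proof -
      have "((\<lambda>t. (X t, V t)) has_derivative (\<lambda>t. (t *\<^sub>R v, t *\<^sub>R w))) (at 0)"
        unfolding X_def V_def by (auto intro!: derivative_eq_intros)
      moreover have "(U has_derivative (\<lambda>h. grad U (x, v) \<bullet> h)) (at (X 0, V 0))"
        using has_derivative_grad[OF sm] by (simp add: X_def V_def)
      ultimately have "((\<lambda>t. U (X t, V t)) has_derivative (\<lambda>t. grad U (x, v) \<bullet> (t *\<^sub>R v, t *\<^sub>R w))) (at 0)"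
        by (rule has_derivative_compose)
      moreover have "(\<lambda>t. grad U (x, v) \<bullet> (t *\<^sub>R v, t *\<^sub>R w)) = (*) (grad U (x, v) \<bullet> (v, w))"
        by (rule ext) (simp add: inner_prod_def algebra_simps)
      ultimately show ?thesis by (simp add: has_field_derivative_def)
    qed
    then have "((\<lambda>t. (U (X t, V t) - U (X 0, V 0)) / (t - 0)) \<longlongrightarrow> grad U (x, v) \<bullet> (v, w)) (at_right 0)"
      unfolding has_field_derivative_iff by (rule filterlim_mono[OF _ order_refl at_le]) simp
    then have "c' - B \<le> grad U (x, v) \<bullet> (v, w)"
    proof (rule tendsto_lowerbound)
      have "\<forall>\<^sub>F t in at_right 0. t \<in> {0<..<t0}" using t0 by (rule eventually_at_right_real)
      then show "\<forall>\<^sub>F t in at_right 0. c' - B \<le> (U (X t, V t) - U (X 0, V 0)) / (t - 0)"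
      proof eventually_elim
        case (elim t)
        then have "(c' - B) * t \<le> U (X t, V t) - U (x, v)" using ineq[of t] by (simp add: algebra_simps)
        then show ?case using elim by (simp add: X_def V_def pos_le_divide_eq)
      qed
    qed simp
    then show "c' \<le> grad U (x, v) \<bullet> (v, w) + (norm w + e)\<^sup>2 / 2 + f (x, v) + e"
      by (simp add: B_def)
  qed
qed

end

section \<open>Functions on the torus and their lifts\<close>

lemma open_torus_of_image:
  fixes U :: "(real^'d::finite) set"
  assumes "open U" shows "open (torus_of ` U)"
proof -
  have "torus_of -` (torus_of ` U) = (\<Union>n\<in>{n. \<forall>i. n $ i \<in> \<int>}. (\<lambda>x. n + x) ` U)"
  proof (intro set_eqI iffI)
    fix y assume "y \<in> torus_of -` (torus_of ` U)"
    then obtain x where x: "x \<in> U" "torus_of y = torus_of x" by auto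
    then have "\<forall>i. (y - x) $ i \<in> \<int>" by (simp add: torus_of_eq_iff)
    moreover have "y = (y - x) + x" by simp
    ultimately show "y \<in> (\<Union>n\<in>{n. \<forall>i. n $ i \<in> \<int>}. (\<lambda>x. n + x) ` U)" using x(1) by blast
  next
    fix y assume "y \<in> (\<Union>n\<in>{n. \<forall>i. n $ i \<in> \<int>}. (\<lambda>x. n + x) ` U)"
    then obtain n x where x: "\<forall>i. n $ i \<in> \<int>" "x \<in> U" "y = n + x" by blast
    then have "torus_of y = torus_of x" by (simp add: torus_of_eq_iff)
    then show "y \<in> torus_of -` (torus_of ` U)" using x(2) by auto
  qed
  moreover have "open (\<Union>n\<in>{n. \<forall>i. n $ i \<in> \<int>}. (\<lambda>x. n + x) ` U)"
    using assms by (intro open_UN ballI open_translation)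
  ultimately show ?thesis by (simp add: open_torus_def)
qed

text \<open>
  The projection to the torus is open, hence so is its product with an identity map, and open
  surjections are quotient maps.
\<close>

lemma continuous_on_torus_prod:
  fixes h :: "'d::finite torus \<times> 'b::topological_space \<Rightarrow> 'c::topological_space"
  assumes "continuous_on UNIV (\<lambda>p. h (torus_of (fst p), snd p))"
  shows "continuous_on UNIV h"
proof -
  let ?q = "\<lambda>p::(real^'d) \<times> 'b. (torus_of (fst p), snd p)"
  have "open (h -` O')" if "open O'" for O'
  proof -
    let ?A = "(\<lambda>p. h (?q p)) -` O'"
    have A: "open ?A" using assms that by (simp add: continuous_on_open_vimage)
    have "h -` O' = ?q ` ?A"
    proof (intro set_eqI iffI)
      fix z assume z: "z \<in> h -` O'"
      define p where "p = (rep_torus (fst z), snd z)"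
      have eq: "?q p = z" by (simp add: p_def)
      then have "p \<in> ?A" using z by simp
      then have "?q p \<in> ?q ` ?A" by (rule imageI)
      then show "z \<in> ?q ` ?A" unfolding eq .
    next
      fix z assume "z \<in> ?q ` ?A"
      then show "z \<in> h -` O'" by blast
    qed
    moreover have "open (?q ` ?A)"
    proof (rule open_prod_intro)
      fix z assume "z \<in> ?q ` ?A"
      then obtain p where p: "p \<in> ?A" "z = ?q p" by (rule imageE) simp
      obtain U V where UV: "open U" "open V" "p \<in> U \<times> V" "U \<times> V \<subseteq> ?A"
        by (rule open_prod_elim[OF A p(1)])
      have "(torus_of ` U) \<times> V \<subseteq> ?q ` ?A"
      proof
        fix r assume "r \<in> (torus_of ` U) \<times> V"
        then obtain y b where r: "y \<in> U" "b \<in> V" "r = (torus_of y, b)" by auto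
        then have "(y, b) \<in> ?A" using UV(4) by blast
        then have "?q (y, b) \<in> ?q ` ?A" by (rule imageI)
        then show "r \<in> ?q ` ?A" using r(3) by (simp only: fst_conv snd_conv)
      qed
      moreover have "z \<in> (torus_of ` U) \<times> V" using UV(3) p(2) by (auto simp: mem_Times_iff)
      ultimately show "\<exists>A B. open A \<and> open B \<and> z \<in> A \<times> B \<and> A \<times> B \<subseteq> ?q ` ?A"
        using UV(2) open_torus_of_image[OF UV(1)] by blast
    qed
    ultimately show ?thesis by simp
  qed
  then show ?thesis by (simp add: continuous_on_open_vimage)
qed

lemma torus_of_translate: "(\<And>i. n $ i \<in> \<int>) \<Longrightarrow> torus_of (y + n) = torus_of y"
  by (simp add: torus_of_eq_iff)

lemma compact_torus: "compact (UNIV :: 'd::finite torus set)"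
proof -
  have "(UNIV :: 'd torus set) = torus_of ` cball 0 (real CARD('d))"
  proof (intro set_eqI iffI)
    fix p :: "'d torus"
    obtain n where n: "\<And>i. n $ i \<in> \<int>" "norm (rep_torus p + n - 0) \<le> real CARD('d)"
      using nearby_integer_translate[of "rep_torus p" 0] by blast
    have "p = torus_of (rep_torus p + n)" using torus_of_translate[OF n(1), of "rep_torus p"] by simp
    then show "p \<in> torus_of ` cball 0 (real CARD('d))" using n(2) by auto
  qed auto
  moreover have "compact (torus_of ` cball (0::real^'d) (real CARD('d)))"
    by (intro compact_continuous_image continuous_on_subset[OF continuous_torus_of]) auto
  ultimately show ?thesis by simp
qed

lemma grad_translate:
  assumes "smooth f" "\<And>p. f (p + a) = f p"
  shows "grad f (p + a) = grad f p"
proof -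
  have "(f has_derivative (\<lambda>h. grad f (p + a) \<bullet> h)) (at (p + a))" by (rule has_derivative_grad[OF assms(1)])
  moreover have "((\<lambda>q. q + a) has_derivative (\<lambda>h. h)) (at p)" by (auto intro!: derivative_eq_intros)
  ultimately have "((\<lambda>q. f (q + a)) has_derivative (\<lambda>h. grad f (p + a) \<bullet> h)) (at p)"
    using has_derivative_compose[of "\<lambda>q. q + a" "\<lambda>h. h" p UNIV f] by simp
  then have "(f has_derivative (\<lambda>h. grad f (p + a) \<bullet> h)) (at p)" by (simp add: assms(2))
  then have "(\<lambda>h. grad f (p + a) \<bullet> h) = (\<lambda>h. grad f p \<bullet> h)"
    using has_derivative_grad[OF assms(1), of p] has_derivative_unique by blast
  then show ?thesis by (metis vector_eq_rdot)
qed

text \<open>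
  The gradient of a lift is periodic, so it does not matter which lift of the base point is taken.
\<close>

lemma Dx_Dv_eq_grad:
  fixes \<phi> :: "'d::finite torus \<times> (real^'d) \<Rightarrow> real"
  assumes sm: "smooth (lift \<phi>)"
  shows "Dx \<phi> (torus_of y) v = fst (grad (lift \<phi>) (y, v))"
    and "Dv \<phi> (torus_of y) v = snd (grad (lift \<phi>) (y, v))"
proof -
  have dx: "GDERIV (\<lambda>z. \<phi> (torus_of z, v)) y' :> fst (grad (lift \<phi>) (y', v))" for y'
  proof -
    have "((\<lambda>z. (z, v)) has_derivative (\<lambda>h. (h, 0))) (at y')" by (auto intro!: derivative_eq_intros)
    from has_derivative_compose[OF this has_derivative_grad[OF sm]]
    show ?thesis by (simp add: gderiv_def lift_def inner_prod_def inner_commute)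
  qed
  have dv: "GDERIV (\<lambda>u. \<phi> (torus_of y, u)) v :> snd (grad (lift \<phi>) (y, v))"
  proof -
    have "((\<lambda>u. (y, u)) has_derivative (\<lambda>h. (0, h))) (at v)" by (auto intro!: derivative_eq_intros)
    from has_derivative_compose[OF this has_derivative_grad[OF sm]]
    show ?thesis by (simp add: gderiv_def lift_def inner_prod_def inner_commute)
  qed
  have uniq: "g = g'" if "GDERIV k a :> g" "GDERIV k a :> g'" for k :: "real^'d \<Rightarrow> real" and a g g'
  proof -
    have "(\<lambda>h. h \<bullet> g) = (\<lambda>h. h \<bullet> g')" using that has_derivative_unique unfolding gderiv_def by blast
    then show ?thesis by (metis vector_eq_ldot)
  qed
  have hx: "has_Dx \<phi> (torus_of y) v (fst (grad (lift \<phi>) (y, v)))"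
    unfolding has_Dx_def
  proof (intro allI impI)
    fix y' assume "torus_of y' = torus_of y"
    then have n: "(y' - y) $ i \<in> \<int>" for i by (simp add: torus_of_eq_iff)
    have "grad (lift \<phi>) ((y, v) + (y' - y, 0)) = grad (lift \<phi>) (y, v)"
      by (rule grad_translate[OF sm]) (simp add: lift_def torus_of_translate[OF n])
    then show "GDERIV (\<lambda>z. \<phi> (torus_of z, v)) y' :> fst (grad (lift \<phi>) (y, v))" using dx[of y'] by simp
  qed
  show "Dx \<phi> (torus_of y) v = fst (grad (lift \<phi>) (y, v))"
    unfolding Dx_def
  proof (rule the_equality)
    show "has_Dx \<phi> (torus_of y) v (fst (grad (lift \<phi>) (y, v)))" by (rule hx)
    show "g = fst (grad (lift \<phi>) (y, v))" if "has_Dx \<phi> (torus_of y) v g" for g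
      using that dx[of y] uniq unfolding has_Dx_def by blast
  qed
  show "Dv \<phi> (torus_of y) v = snd (grad (lift \<phi>) (y, v))"
    unfolding Dv_def has_Dv_def
  proof (rule the_equality)
    show "GDERIV (\<lambda>u. \<phi> (torus_of y, u)) v :> snd (grad (lift \<phi>) (y, v))" by (rule dv)
    show "g = snd (grad (lift \<phi>) (y, v))" if "GDERIV (\<lambda>u. \<phi> (torus_of y, u)) v :> g" for g
      using that dv uniq by blast
  qed
qed

definition generator :: "('d::finite torus \<times> (real^'d) \<Rightarrow> real) \<Rightarrow> 'd torus \<times> (real^'d) \<times> (real^'d) \<Rightarrow> real" where
  "generator \<phi> = (\<lambda>(x, v, w). Dx \<phi> x v \<bullet> v + Dv \<phi> x v \<bullet> w)"

lemma generator_torus_of: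
  assumes "smooth (lift \<phi>)"
  shows "generator \<phi> (torus_of y, v, w) = grad (lift \<phi>) (y, v) \<bullet> (v, w)"
  by (simp add: generator_def Dx_Dv_eq_grad[OF assms] inner_prod_def)

lemma continuous_generator:
  fixes \<phi> :: "'d::finite torus \<times> (real^'d) \<Rightarrow> real"
  assumes "smooth (lift \<phi>)" shows "continuous_on UNIV (generator \<phi>)"
proof (rule continuous_on_torus_prod)
  have "continuous_on UNIV (\<lambda>p::(real^'d) \<times> (real^'d) \<times> (real^'d).
      grad (lift \<phi>) (fst p, fst (snd p)) \<bullet> (fst (snd p), snd (snd p)))"
    by (intro continuous_intros continuous_on_compose2[OF continuous_grad[OF assms]]) auto
  then show "continuous_on UNIV (\<lambda>p. generator \<phi> (torus_of (fst p), snd p))"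
    using generator_torus_of[OF assms] by (auto simp: case_prod_unfold elim!: continuous_on_eq)
qed

section \<open>Occupation measures of periodic trajectories\<close>

text \<open>
  Time is clamped to \<open>[0,P]\<close>, where the density lives, because a trajectory carries no information about
  its values outside; the clamped curve is continuous and therefore measurable.
\<close>

definition occupation_measure ::
    "real \<Rightarrow> (real \<Rightarrow> real^'d) \<Rightarrow> (real \<Rightarrow> real^'d) \<Rightarrow> (real \<Rightarrow> real^'d) \<Rightarrow>
     ('d::finite torus \<times> (real^'d) \<times> (real^'d)) measure" where
  "occupation_measure P x v w = distr (density lborel (\<lambda>t. ennreal (indicator {0..P} t / P))) borel
     (\<lambda>t. (torus_of (x (max 0 (min P t))), v (max 0 (min P t)), w t))"

lemma
  fixes x v w :: "real \<Rightarrow> real^'d::finite"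
  assumes P: "P > 0" and tr: "traj P x v w"
  shows prob_space_occupation_measure: "prob_space (occupation_measure P x v w)"
    and integral_occupation_measure: "h \<in> borel_measurable borel \<Longrightarrow>
      integral\<^sup>L (occupation_measure P x v w) h = (LBINT t:{0..P}. h (torus_of (x t), v t, w t)) / P"
    and nn_integral_occupation_measure: "h \<in> borel_measurable borel \<Longrightarrow> (\<And>q. h q \<ge> 0) \<Longrightarrow>
      set_integrable lborel {0..P} (\<lambda>t. h (torus_of (x t), v t, w t)) \<Longrightarrow>
      (\<integral>\<^sup>+q. ennreal (h q) \<partial>occupation_measure P x v w) < \<infinity>"
proof -
  define cl where "cl t = max 0 (min P t)" for t
  have cl: "continuous_on UNIV cl" unfolding cl_def by (intro continuous_intros)
  have clP: "cl t = t" if "t \<in> {0..P}" for t using that by (simp add: cl_def)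
  have cx: "continuous_on UNIV (\<lambda>t. x (cl t))" "continuous_on UNIV (\<lambda>t. v (cl t))"
    by (rule continuous_on_compose2[OF antideriv_continuous[OF traj_x[OF tr]] cl]
        continuous_on_compose2[OF antideriv_continuous[OF traj_v[OF tr]] cl];
        use P in \<open>auto simp: cl_def\<close>)+
  define g where "g t = (torus_of (x (cl t)), v (cl t), w t)" for t
  have mg: "g \<in> measurable lborel borel"
  proof -
    let ?G = "\<lambda>p::(real^'d) \<times> (real^'d) \<times> (real^'d). (torus_of (fst p), snd p)"
    have "(\<lambda>t. (x (cl t), v (cl t), w t)) \<in> borel_measurable lborel"
      using borel_measurable_continuous_onI[OF cx(1)] borel_measurable_continuous_onI[OF cx(2)]
        traj_measurable[OF tr] by (intro borel_measurable_Pair) auto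
    moreover have "?G \<in> borel_measurable borel"
      by (intro borel_measurable_continuous_onI continuous_intros continuous_on_compose2[OF continuous_torus_of]) auto
    ultimately have "?G \<circ> (\<lambda>t. (x (cl t), v (cl t), w t)) \<in> measurable lborel borel"
      by (rule measurable_comp)
    then show ?thesis by (simp add: g_def[abs_def] o_def)
  qed
  define k where "k t = indicator {0..P} t / P" for t :: real
  have k0: "k t \<ge> 0" for t using P by (simp add: k_def)
  have mk: "k \<in> borel_measurable lborel" unfolding k_def by measurable
  define D where "D = density lborel (\<lambda>t. ennreal (k t))"
  have ps: "prob_space D"
  proof (rule prob_spaceI)
    have "emeasure D (space D) = (\<integral>\<^sup>+t. ennreal (k t) \<partial>lborel)"
      unfolding D_def using mk by (subst emeasure_density) auto
    also have "\<dots> = (\<integral>\<^sup>+t. ennreal (1 / P) * indicator {0..P} t \<partial>lborel)"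
      by (rule nn_integral_cong) (simp add: k_def indicator_def)
    also have "\<dots> = ennreal (1 / P) * ennreal P"
      using P by (subst nn_integral_cmult_indicator) auto
    also have "\<dots> = 1" using P by (simp flip: ennreal_mult)
    finally show "emeasure D (space D) = 1" .
  qed
  have mgD: "g \<in> measurable D borel" using mg by (simp add: D_def)
  have om: "occupation_measure P x v w = distr D borel g"
    by (simp add: occupation_measure_def D_def k_def[abs_def] g_def[abs_def] cl_def[abs_def])
  show "prob_space (occupation_measure P x v w)"
    unfolding om by (rule prob_space.prob_space_distr[OF ps mgD])
  fix h :: "'d torus \<times> (real^'d) \<times> (real^'d) \<Rightarrow> real" assume h: "h \<in> borel_measurable borel"
  have mh: "(\<lambda>t. h (g t)) \<in> borel_measurable lborel" using measurable_comp[OF mg h] by (simp add: o_def)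
  have eq: "k t * h (g t) = (indicator {0..P} t *\<^sub>R h (torus_of (x t), v t, w t)) / P" for t
    by (cases "t \<in> {0..P}") (simp_all add: k_def g_def clP)
  have "integral\<^sup>L (distr D borel g) h = (\<integral>t. h (g t) \<partial>D)"
    by (rule integral_distr[OF mgD h])
  also have "\<dots> = (\<integral>t. k t * h (g t) \<partial>lborel)"
    unfolding D_def using integral_density[OF mh mk] k0 by simp
  also have "\<dots> = (LBINT t:{0..P}. h (torus_of (x t), v t, w t)) / P"
    unfolding eq set_lebesgue_integral_def by simp
  finally show "integral\<^sup>L (occupation_measure P x v w) h = (LBINT t:{0..P}. h (torus_of (x t), v t, w t)) / P"
    unfolding om .
  assume pos: "\<And>q. h q \<ge> 0" and int: "set_integrable lborel {0..P} (\<lambda>t. h (torus_of (x t), v t, w t))"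
  have "integrable lborel (\<lambda>t. k t * h (g t))"
    unfolding eq using int unfolding set_integrable_def by simp
  moreover have "(\<integral>\<^sup>+q. ennreal (h q) \<partial>distr D borel g) = (\<integral>\<^sup>+t. ennreal (k t * h (g t)) \<partial>lborel)"
    unfolding D_def using h mgD mk mh k0 pos
    by (subst nn_integral_distr) (auto simp: D_def nn_integral_density ennreal_mult)
  ultimately show "(\<integral>\<^sup>+q. ennreal (h q) \<partial>occupation_measure P x v w) < \<infinity>"
    unfolding om using nn_integral_eq_integral[of lborel "\<lambda>t. k t * h (g t)"] k0 pos by simp
qed

lemma continuous_running:
  fixes F :: "'d::finite torus \<times> (real^'d) \<Rightarrow> real"
  assumes "continuous_on UNIV F"
  shows "continuous_on UNIV (\<lambda>(x, v, w::real^'d). (norm w)\<^sup>2 / 2 + F (x, v))"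
  unfolding case_prod_unfold
  by (intro continuous_intros continuous_on_compose2[OF assms]) auto

lemma continuous_moment:
  assumes "\<alpha> > 0"
  shows "continuous_on UNIV (\<lambda>(x::'d::finite torus, v::real^'d, w::real^'d). (norm w)\<^sup>2 + norm v powr \<alpha>)"
  unfolding case_prod_unfold using assms
  by (intro continuous_intros continuous_on_powr') auto

lemma periodic_traj_closed_measure:
  fixes F :: "'d::finite torus \<times> (real^'d) \<Rightarrow> real"
  assumes F: "continuous_on UNIV F" and \<alpha>: "\<alpha> > 0" and P: "P > 0" and tr: "traj P x v w"
    and per: "torus_of (x P) = torus_of (x 0)" "v P = v 0"
  shows "occupation_measure P x v w \<in> closed_measures \<alpha>"
    "(\<integral>(x, v, w). (norm w)\<^sup>2 / 2 + F (x, v) \<partial>occupation_measure P x v w) = cost (lift F) P x v w / P"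
proof -
  let ?\<mu> = "occupation_measure P x v w"
  have "set_integrable lborel {0..P} (\<lambda>t. (norm (w t))\<^sup>2 + norm (v t) powr \<alpha>)"
    using \<alpha> by (intro set_integral_add traj_square[OF tr] borel_integrable_atLeastAtMost' continuous_on_powr'
        continuous_intros antideriv_continuous[OF traj_v[OF tr]]) auto
  then have "(\<integral>\<^sup>+ q. ennreal ((\<lambda>(x, v, w). (norm w)\<^sup>2 + norm v powr \<alpha>) q) \<partial>?\<mu>) < \<infinity>"
    by (intro nn_integral_occupation_measure[OF P tr] borel_measurable_continuous_onI continuous_moment \<alpha>) auto
  then have mom: "(\<integral>\<^sup>+ (x, v, w). ennreal ((norm w)\<^sup>2 + norm v powr \<alpha>) \<partial>?\<mu>) < \<infinity>"
    by (simp add: case_prod_unfold)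
  have clos: "(\<integral>(x, v, w). Dx \<phi> x v \<bullet> v + Dv \<phi> x v \<bullet> w \<partial>?\<mu>) = 0" if \<phi>: "\<phi> \<in> test_phase" for \<phi>
  proof -
    have sm: "smooth (lift \<phi>)" using \<phi> by (simp add: test_phase_def lift_def[abs_def])
    have int: "set_integrable lborel {0..P} (\<lambda>t. (v t, w t))"
      by (intro set_integrable_Pair borel_integrable_atLeastAtMost' antideriv_continuous[OF traj_v[OF tr]]
          traj_integrable[OF tr])
    have ad: "antideriv P (\<lambda>t. (x t, v t)) (\<lambda>t. (v t, w t))"
      by (rule antideriv_Pair[OF traj_x[OF tr] traj_v[OF tr]])
    have ai: "(\<lambda>t. (v t, w t)) absolutely_integrable_on {0..P}"
      by (rule set_integrable_imp_absolutely_integrable[OF int]) simp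
    have "((\<lambda>t. grad (lift \<phi>) (x t, v t) \<bullet> (v t, w t)) has_integral
        (lift \<phi> (x P, v P) - lift \<phi> (x 0, v 0))) {0..P}"
      by (rule chain_rule_absolutely_continuous[OF sm _ ai]) (use P ad in \<open>auto simp: antideriv_def\<close>)
    then have *: "((\<lambda>t. grad (lift \<phi>) (x t, v t) \<bullet> (v t, w t)) has_integral 0) {0..P}"
      by (simp add: lift_def per)
    have si: "set_integrable lborel {0..P} (\<lambda>t. grad (lift \<phi>) (x t, v t) \<bullet> (v t, w t))"
      by (rule set_integrable_continuous_inner[OF _ int])
        (auto intro!: continuous_on_compose2[OF continuous_grad[OF sm]] antideriv_continuous[OF ad])
    have "(LBINT t:{0..P}. grad (lift \<phi>) (x t, v t) \<bullet> (v t, w t)) = 0"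
      unfolding set_borel_integral_eq_integral(2)[OF si] by (rule integral_unique[OF *])
    then have "integral\<^sup>L ?\<mu> (generator \<phi>) = 0"
      using integral_occupation_measure[OF P tr, OF borel_measurable_continuous_onI[OF continuous_generator[OF sm]]]
      by (simp add: generator_torus_of[OF sm])
    then show ?thesis by (simp add: generator_def)
  qed
  have "sets ?\<mu> = sets borel" by (simp add: occupation_measure_def)
  then show "?\<mu> \<in> closed_measures \<alpha>"
    using prob_space_occupation_measure[OF P tr] mom clos by (simp add: closed_measures_def prob_moments_def)
  show "(\<integral>(x, v, w). (norm w)\<^sup>2 / 2 + F (x, v) \<partial>?\<mu>) = cost (lift F) P x v w / P"
  proof -
    have "(\<integral>(x, v, w). (norm w)\<^sup>2 / 2 + F (x, v) \<partial>?\<mu>)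
        = (LBINT t:{0..P}. running_cost (lift F) x v w t) / P"
      using integral_occupation_measure[OF P tr, OF borel_measurable_continuous_onI[OF continuous_running[OF F]]]
      by (simp add: running_cost_def lift_def)
    then show ?thesis
      using set_borel_integral_eq_integral(2)[OF running_cost_set_integrable[OF tr continuous_lift[OF F]]]
      by (simp add: cost_def)
  qed
qed

context periodic_lagrangian
begin

text \<open>
  A near optimal piece is closed up, modulo integer vectors, by a connection of unit length; for large
  \<open>T\<close> its cost is negligible against \<open>\<eta> T\<close>.
\<close>

lemma near_optimal_periodic_traj:
  assumes \<eta>: "\<eta> > 0"
  obtains P x v w n where "P > 0" "traj P x v w" "\<And>i. n $ i \<in> \<int>" "x P = x 0 + n" "v P = v 0"
    "cost f P x v w \<le> (rate + \<eta>) * P"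
proof -
  define \<delta> where "\<delta> = \<eta> / (2 * (rate + 1))"
  have \<delta>: "\<delta> > 0" "rate * \<delta> \<le> \<eta> / 2"
    using \<eta> rate_nonneg by (auto simp: \<delta>_def field_simps)
  obtain R where R: "\<And>T. T \<ge> 1 \<Longrightarrow> \<exists>S x v w. T \<le> S \<and> traj S x v w \<and> norm (v 0) \<le> R \<and> norm (v S) \<le> R
    \<and> cost f S x v w \<le> rate * (1 + \<delta>) * T + 1" using near_optimal_piece[OF \<delta>(1)] by metis
  obtain K where K: "\<And>x0 x1 v0 v1. norm v0 \<le> R \<Longrightarrow> norm v1 \<le> R \<Longrightarrow>
    norm (x1 - x0) \<le> real CARD('d) \<Longrightarrow>
    \<exists>x v w. traj 1 x v w \<and> x 0 = x0 \<and> v 0 = v0 \<and> x 1 = x1 \<and> v 1 = v1 \<and> cost f 1 x v w \<le> K"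
    using bounded_cost_connection[of R "real CARD('d)"] by metis
  define T where "T = max 1 (2 * (1 + K) / \<eta>)"
  have T: "T \<ge> 1" "2 * (1 + K) \<le> \<eta> * T"
  proof -
    have "2 * (1 + K) / \<eta> \<le> T" by (simp add: T_def)
    then show "2 * (1 + K) \<le> \<eta> * T" using \<eta> by (simp add: pos_divide_le_eq mult.commute)
  qed (simp add: T_def)
  obtain S x v w where p: "T \<le> S" "traj S x v w" "norm (v 0) \<le> R" "norm (v S) \<le> R"
    "cost f S x v w \<le> rate * (1 + \<delta>) * T + 1" using R[OF T(1)] by blast
  obtain n where n: "\<And>i. n $ i \<in> \<int>" "norm (x 0 + n - x S) \<le> real CARD('d)"
    using nearby_integer_translate[of "x 0" "x S"] by blast
  obtain y u r where q: "traj 1 y u r" "y 0 = x S" "u 0 = v S" "y 1 = x 0 + n" "u 1 = v 0" "cost f 1 y u r \<le> K"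
    using K[OF p(4,3) n(2)] by blast
  show thesis
  proof (rule that)
    show "S + 1 > 0" using p(1) T(1) by simp
    show "traj (S + 1) (glue S x y) (glue S v u) (glue S w r)"
      by (rule traj_glue[OF p(2) q(1)]) (use p q T in auto)
    show "n $ i \<in> \<int>" for i by (rule n(1))
    show "glue S x y (S + 1) = glue S x y 0 + n" "glue S v u (S + 1) = glue S v u 0"
      using p(1) T(1) q by (auto simp: glue_def)
    have "cost f (S + 1) (glue S x y) (glue S v u) (glue S w r) = cost f S x v w + cost f 1 y u r"
      by (rule cost_glue[OF p(2) q(1) cont]) (use p q T in auto)
    also have "\<dots> \<le> rate * T + rate * \<delta> * T + (1 + K)"
      using p(5) q(6) by (simp add: algebra_simps)
    also have "\<dots> \<le> rate * T + \<eta> / 2 * T + \<eta> * T / 2"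
    proof -
      have "rate * \<delta> * T \<le> \<eta> / 2 * T" using \<delta>(2) T(1) by (intro mult_right_mono) auto
      moreover have "1 + K \<le> \<eta> * T / 2" using T(2) by simp
      ultimately show ?thesis by (intro add_mono) auto
    qed
    also have "\<dots> = (rate + \<eta>) * T" by (simp add: algebra_simps)
    also have "\<dots> \<le> (rate + \<eta>) * (S + 1)"
      using p(1) \<eta> rate_nonneg by (intro mult_left_mono) auto
    finally show "cost f (S + 1) (glue S x y) (glue S v u) (glue S w r) \<le> (rate + \<eta>) * (S + 1)" .
  qed
qed

end

section \<open>Closed measures cost at least the ergodic constant\<close>

lemma bounded_deriv_smooth_step:
  fixes H :: "real \<Rightarrow> real"
  assumes "smooth H" "\<And>s. s \<le> -1 \<Longrightarrow> H s = 0" "\<And>s. s \<ge> 1 \<Longrightarrow> H s = 1"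
  obtains C where "C \<ge> 0" "\<And>s. \<bar>deriv H s\<bar> \<le> C" "\<And>s. \<bar>s\<bar> > 1 \<Longrightarrow> deriv H s = 0"
proof -
  have out: "deriv H s = 0" if "\<bar>s\<bar> > 1" for s
    by (rule deriv_step_outside[OF assms(2,3) that])
  obtain C where "C \<ge> 0" "\<And>s. \<bar>deriv H s\<bar> \<le> C"
    using smooth_cutoff_bounded[OF real_smooth_deriv(2)[OF assms(1)], of 1] out by auto
  then show thesis using that out by blast
qed

text \<open>
  The cutoff equals one for \<open>|v| \<le> R\<close> and zero for \<open>|v| \<ge> 2 R\<close>, since its argument is then at most
  \<open>-1\<close> and at least \<open>2\<close>, respectively. Its gradient is of order \<open>|v| / R\<^sup>2\<close>, that is \<open>1 / R\<close>.
\<close>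

lemma truncated_test_function:
  fixes U :: "(real^'d::finite) \<times> (real^'d) \<Rightarrow> real"
  assumes step: "smooth H" "\<forall>s\<le>-1. H s = 0" "\<forall>s\<ge>1. H s = 1"
    and per: "smooth U" "\<forall>n x v. (\<forall>i. n $ i \<in> \<int>) \<longrightarrow> U (x + n, v) = U (x, v)"
    and R: "R > 0"
  defines "\<phi> \<equiv> \<lambda>(\<xi>, v). U (rep_torus \<xi>, v) * (1 - H ((1 / R\<^sup>2) * (v \<bullet> v) - 2))"
  shows "\<phi> \<in> test_phase" "smooth (lift \<phi>)"
    and "grad (lift \<phi>) (y, v) \<bullet> (a, b) = (1 - H ((1 / R\<^sup>2) * (v \<bullet> v) - 2)) * (grad U (y, v) \<bullet> (a, b))
      - U (y, v) * (deriv H ((1 / R\<^sup>2) * (v \<bullet> v) - 2) * ((2 / R\<^sup>2) * (v \<bullet> b)))"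
    and "norm v > 2 * R \<Longrightarrow> grad (lift \<phi>) (y, v) = 0"
    and "\<exists>G. \<forall>y v. norm (grad (lift \<phi>) (y, v)) \<le> G"
proof -
  have H: "smooth H" "\<And>s. s \<le> -1 \<Longrightarrow> H s = 0" "\<And>s. s \<ge> 1 \<Longrightarrow> H s = 1"
    and U: "smooth U" "\<And>n x v. (\<And>i. n $ i \<in> \<int>) \<Longrightarrow> U (x + n, v) = U (x, v)"
    using step per by blast+
  define \<kappa> where "\<kappa> z = 1 - H ((1 / R\<^sup>2) * (snd z \<bullet> snd z) - 2)" for z :: "(real^'d) \<times> (real^'d)"
  have Urep: "U (rep_torus (torus_of y), v) = U (y, v)" for y v
  proof -
    have "torus_of (rep_torus (torus_of y)) = torus_of y" by simp
    then have "(rep_torus (torus_of y) - y) $ i \<in> \<int>" for i unfolding torus_of_eq_iff by simp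
    from U(2)[OF this, of y v] show ?thesis by simp
  qed
  have lift: "lift \<phi> = (\<lambda>z. U z * \<kappa> z)"
    by (rule ext) (simp add: lift_def \<phi>_def \<kappa>_def Urep)
  have sq: "smooth (\<lambda>z::(real^'d) \<times> (real^'d). (1 / R\<^sup>2) * (snd z \<bullet> snd z) - 2)"
    by (intro smooth_diff[OF smooth_mult[OF smooth_const] smooth_const])
      (simp add: smooth_def Ck_inner_self bounded_linear_snd)
  have sk: "smooth \<kappa>"
    unfolding \<kappa>_def[abs_def] by (rule smooth_diff[OF smooth_const smooth_compose_real[OF H(1) sq]])
  show sm: "smooth (lift \<phi>)" unfolding lift by (rule smooth_mult[OF U(1) sk])
  have big: "H ((1 / R\<^sup>2) * (v \<bullet> v) - 2) = 1" "1 < (1 / R\<^sup>2) * (v \<bullet> v) - 2" if "norm v > 2 * R" for v :: "real^'d"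
  proof -
    have "(2 * R)\<^sup>2 \<le> (norm v)\<^sup>2" using that R by (intro power_mono) auto
    then have "4 * R\<^sup>2 \<le> v \<bullet> v" by (simp add: power2_norm_eq_inner power_mult_distrib)
    then have "(1 / R\<^sup>2) * (4 * R\<^sup>2) \<le> (1 / R\<^sup>2) * (v \<bullet> v)" by (intro mult_left_mono) auto
    moreover have "(1 / R\<^sup>2) * (4 * R\<^sup>2) = 4" using R by simp
    ultimately show "1 < (1 / R\<^sup>2) * (v \<bullet> v) - 2" by linarith
    then show "H ((1 / R\<^sup>2) * (v \<bullet> v) - 2) = 1" using H(3) by simp
  qed
  have g: "grad (lift \<phi>) (y, v) \<bullet> (a, b) = (1 - H ((1 / R\<^sup>2) * (v \<bullet> v) - 2)) * (grad U (y, v) \<bullet> (a, b))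
      - U (y, v) * (deriv H ((1 / R\<^sup>2) * (v \<bullet> v) - 2) * ((2 / R\<^sup>2) * (v \<bullet> b)))" for y v a b
  proof -
    let ?s = "(1 / R\<^sup>2) * (v \<bullet> v) - 2"
    have dk: "(\<kappa> has_derivative (\<lambda>h. - (deriv H ?s * ((2 / R\<^sup>2) * (v \<bullet> snd h))))) (at (y, v))"
    proof -
      have "((\<lambda>z. (1 / R\<^sup>2) * (snd z \<bullet> snd z) - 2) has_derivative (\<lambda>h. (2 / R\<^sup>2) * (v \<bullet> snd h))) (at (y, v))"
      proof -
        have "((\<lambda>z. k * (snd z \<bullet> snd z) - 2) has_derivative (\<lambda>h. k * (2 * (v \<bullet> snd h)))) (at (y, v))" for k
          by (auto intro!: derivative_eq_intros simp: inner_commute)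
        from this[of "1 / R\<^sup>2"] show ?thesis by simp
      qed
      moreover have "(H has_derivative (*) (deriv H ?s)) (at ((1 / R\<^sup>2) * (snd (y, v) \<bullet> snd (y, v)) - 2))"
        using real_smooth_deriv(1)[OF H(1), of ?s] by (simp add: has_field_derivative_def)
      ultimately have "((\<lambda>z. H ((1 / R\<^sup>2) * (snd z \<bullet> snd z) - 2)) has_derivative
          (\<lambda>h. deriv H ?s * ((2 / R\<^sup>2) * (v \<bullet> snd h)))) (at (y, v))"
        by (rule has_derivative_compose)
      from has_derivative_diff[OF has_derivative_const[of 1] this]
      show ?thesis by (simp add: \<kappa>_def[abs_def])
    qed
    have "(lift \<phi> has_derivative (\<lambda>h. U (y, v) * - (deriv H ?s * ((2 / R\<^sup>2) * (v \<bullet> snd h)))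
        + grad U (y, v) \<bullet> h * \<kappa> (y, v))) (at (y, v))"
      unfolding lift by (rule has_derivative_mult[OF has_derivative_grad[OF U(1)] dk])
    then have "(\<lambda>h. grad (lift \<phi>) (y, v) \<bullet> h) = (\<lambda>h. U (y, v) * - (deriv H ?s * ((2 / R\<^sup>2) * (v \<bullet> snd h)))
        + grad U (y, v) \<bullet> h * \<kappa> (y, v))"
      using has_derivative_grad[OF sm] has_derivative_unique by blast
    from fun_cong[OF this, of "(a, b)"] show ?thesis by (simp add: \<kappa>_def mult.commute)
  qed
  then show "grad (lift \<phi>) (y, v) \<bullet> (a, b) = (1 - H ((1 / R\<^sup>2) * (v \<bullet> v) - 2)) * (grad U (y, v) \<bullet> (a, b))
      - U (y, v) * (deriv H ((1 / R\<^sup>2) * (v \<bullet> v) - 2) * ((2 / R\<^sup>2) * (v \<bullet> b)))" .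
  have g0: "grad (lift \<phi>) (y, v) = 0" if "norm v > 2 * R" for y v
  proof -
    obtain C where C: "\<And>s. \<bar>s\<bar> > 1 \<Longrightarrow> deriv H s = 0" using bounded_deriv_smooth_step[OF H] by metis
    have "deriv H ((1 / R\<^sup>2) * (v \<bullet> v) - 2) = 0" using big(2)[OF that] by (intro C) linarith
    then have "grad (lift \<phi>) (y, v) \<bullet> (a, b) = 0" for a b
      unfolding g big(1)[OF that] by simp
    then have "grad (lift \<phi>) (y, v) \<bullet> grad (lift \<phi>) (y, v) = 0" by (metis prod.collapse)
    then show ?thesis by simp
  qed
  then show "norm v > 2 * R \<Longrightarrow> grad (lift \<phi>) (y, v) = 0" .
  have "closure {q. \<phi> q \<noteq> 0} \<subseteq> UNIV \<times> cball 0 (2 * R)"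
  proof (rule closure_minimal)
    show "{q. \<phi> q \<noteq> 0} \<subseteq> UNIV \<times> cball 0 (2 * R)"
    proof
      fix q assume "q \<in> {q. \<phi> q \<noteq> 0}"
      then have "H ((1 / R\<^sup>2) * (snd q \<bullet> snd q) - 2) \<noteq> 1" by (auto simp: \<phi>_def case_prod_unfold)
      then have "\<not> norm (snd q) > 2 * R" using big(1) by blast
      then show "q \<in> UNIV \<times> cball 0 (2 * R)" by (simp add: mem_Times_iff)
    qed
    show "closed (UNIV \<times> cball 0 (2 * R) :: ('d torus \<times> (real^'d)) set)" by (intro closed_Times) auto
  qed
  moreover have "compact (UNIV \<times> cball 0 (2 * R) :: ('d torus \<times> (real^'d)) set)"
    by (intro compact_Times compact_torus compact_cball)
  ultimately have "compact (closure {q. \<phi> q \<noteq> 0})"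
    using compact_Int_closed[of "UNIV \<times> cball 0 (2 * R)" "closure {q. \<phi> q \<noteq> 0}"] by (simp add: inf.absorb2)
  then show "\<phi> \<in> test_phase" using sm by (simp add: test_phase_def lift_def[abs_def])
  show "\<exists>G. \<forall>y v. norm (grad (lift \<phi>) (y, v)) \<le> G"
  proof -
    let ?K = "cball (0::real^'d) (real CARD('d)) \<times> cball (0::real^'d) (2 * R)"
    have "bounded (grad (lift \<phi>) ` ?K)"
      by (intro compact_imp_bounded compact_continuous_image continuous_on_subset[OF continuous_grad[OF sm]]
          compact_Times) auto
    then obtain G where G: "\<And>z. z \<in> ?K \<Longrightarrow> norm (grad (lift \<phi>) z) \<le> G"
      unfolding bounded_iff by blast
    have "norm (grad (lift \<phi>) (y, v)) \<le> max G 0" for y v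
    proof (cases "norm v > 2 * R")
      case True
      then show ?thesis using g0 by simp
    next
      case False
      obtain n where n: "\<And>i. n $ i \<in> \<int>" "norm (y + n - 0) \<le> real CARD('d)"
        using nearby_integer_translate[of y 0] by blast
      have "grad (lift \<phi>) ((y, v) + (n, 0)) = grad (lift \<phi>) (y, v)"
        by (rule grad_translate[OF sm]) (simp add: lift_def torus_of_translate[OF n(1)])
      then show ?thesis using G[of "(y + n, v)"] n(2) False by (simp add: le_max_iff_disj)
    qed
    then show ?thesis by blast
  qed
qed

text \<open>
  The pointwise inequality \<open>c' \<le> generator \<phi> + L + Q / R\<close> for the truncated subsolution is integrated
  against \<open>\<mu>\<close>. The integral of the generator vanishes because \<open>\<mu>\<close> is closed, \<open>Q\<close> is integrable by the
  moment bounds on \<open>\<mu>\<close> and does not depend on \<open>R\<close>, and \<open>R\<close> tends to infinity.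
\<close>

lemma rate_le_closed_measure:
  fixes F :: "'d::finite torus \<times> (real^'d) \<Rightarrow> real"
  assumes F: "continuous_on UNIV F" and pl: "periodic_lagrangian (lift F) \<alpha> c"
    and \<mu>: "\<mu> \<in> closed_measures \<alpha>"
  shows "periodic_lagrangian.rate (lift F) \<le> (\<integral>(x, v, w). (norm w)\<^sup>2 / 2 + F (x, v) \<partial>\<mu>)"
proof -
  interpret periodic_lagrangian "lift F" \<alpha> c by (rule pl)
  have sets: "sets \<mu> = sets borel" and ps: "prob_space \<mu>"
    and mom: "(\<integral>\<^sup>+ (x, v, w). ennreal ((norm w)\<^sup>2 + norm v powr \<alpha>) \<partial>\<mu>) < \<infinity>"
    and vanish: "\<And>\<phi>. \<phi> \<in> test_phase \<Longrightarrow> (\<integral>(x, v, w). Dx \<phi> x v \<bullet> v + Dv \<phi> x v \<bullet> w \<partial>\<mu>) = 0"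
    using \<mu> by (auto simp: closed_measures_def prob_moments_def)
  interpret prob_space \<mu> by (rule ps)
  let ?v = "\<lambda>q::'d torus \<times> (real^'d) \<times> (real^'d). fst (snd q)" and ?w = "\<lambda>q::'d torus \<times> (real^'d) \<times> (real^'d). snd (snd q)"
  let ?L = "\<lambda>(x::'d torus, v::real^'d, w::real^'d). (norm w)\<^sup>2 / 2 + F (x, v)"
  let ?m = "\<lambda>q. (norm (?w q))\<^sup>2 + norm (?v q) powr \<alpha>"
  have meas: "h \<in> borel_measurable \<mu>" if "continuous_on UNIV h" for h :: "'d torus \<times> (real^'d) \<times> (real^'d) \<Rightarrow> real"
    using borel_measurable_continuous_onI[OF that] by (simp add: measurable_cong_sets[OF sets refl])
  have im: "integrable \<mu> ?m"
  proof (rule integrableI_nonneg)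
    show "?m \<in> borel_measurable \<mu>"
      using continuous_moment[of \<alpha>, where 'd='d] \<alpha> by (intro meas) (simp add: case_prod_unfold)
    show "(\<integral>\<^sup>+ q. ennreal (?m q) \<partial>\<mu>) < \<infinity>" using mom by (simp add: case_prod_unfold)
  qed auto
  have dom: "integrable \<mu> h" if "continuous_on UNIV h" "\<And>q. \<bar>h q\<bar> \<le> A * (1 + ?m q)"
    for h :: "'d torus \<times> (real^'d) \<times> (real^'d) \<Rightarrow> real" and A
  proof (rule Bochner_Integration.integrable_bound[of _ "\<lambda>q. A * (1 + ?m q)"])
    have "integrable \<mu> (\<lambda>q. 1 + ?m q)" by (rule Bochner_Integration.integrable_add[OF _ im]) simp
    then show "integrable \<mu> (\<lambda>q. A * (1 + ?m q))" by (rule integrable_mult_right)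
    show "AE q in \<mu>. norm (h q) \<le> norm (A * (1 + ?m q))"
      by (rule AE_I2) (use that(2) in \<open>auto intro: order.trans[OF _ abs_ge_self]\<close>)
  qed (rule meas[OF that(1)])
  have iL: "integrable \<mu> ?L"
  proof (rule dom[of _ "c + 1"])
    show "continuous_on UNIV ?L" by (rule continuous_running[OF F])
    show "\<bar>?L q\<bar> \<le> (c + 1) * (1 + ?m q)" for q
    proof -
      obtain x v w where q: "q = (x, v, w)" by (cases q) auto
      have "F (x, v) \<ge> 0" "F (x, v) \<le> c * (1 + norm v powr \<alpha>)"
        using nonneg[of "(rep_torus x, v)"] upper[of "rep_torus x" v] by (simp_all add: lift_def)
      moreover have "0 \<le> c * (norm w)\<^sup>2" using c by simp
      moreover have "0 \<le> norm v powr \<alpha>" "0 \<le> (norm w)\<^sup>2" by simp_all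
      ultimately have "0 \<le> (norm w)\<^sup>2 / 2 + F (x, v)"
        "(norm w)\<^sup>2 / 2 + F (x, v) \<le> (c + 1) * (1 + ((norm w)\<^sup>2 + norm v powr \<alpha>))"
        unfolding distrib_left distrib_right mult_1_left mult_1_right using c by linarith+
      then show ?thesis by (simp only: q case_prod_conv fst_conv snd_conv abs_of_nonneg)
    qed
  qed
  have iw: "integrable \<mu> (\<lambda>q. norm (?w q))"
  proof (rule dom[of _ 1])
    show "continuous_on UNIV (\<lambda>q. norm (?w q))" by (intro continuous_intros)
    show "\<bar>norm (?w q)\<bar> \<le> 1 * (1 + ?m q)" for q
    proof -
      have "norm (?w q) \<le> 1 + (norm (?w q))\<^sup>2" by (rule le_one_plus_square)
      moreover have "0 \<le> norm (?v q) powr \<alpha>" by simp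
      ultimately show ?thesis unfolding abs_norm_cancel mult_1_left by linarith
    qed
  qed
  have iv: "integrable \<mu> (\<lambda>q. norm (?v q) powr \<alpha>)"
  proof (rule dom[of _ 1])
    show "continuous_on UNIV (\<lambda>q. norm (?v q) powr \<alpha>)"
      using \<alpha> by (intro continuous_on_powr' continuous_intros) auto
    show "\<bar>norm (?v q) powr \<alpha>\<bar> \<le> 1 * (1 + ?m q)" for q by simp
  qed
  obtain H :: "real \<Rightarrow> real" where H: "smooth H" "mono H"
    "\<And>s. s \<le> -1 \<Longrightarrow> H s = 0" "\<And>s. s \<ge> 1 \<Longrightarrow> H s = 1" and H01: "\<And>s. 0 \<le> H s" "\<And>s. H s \<le> 1"
    using smooth_step_exists by metis
  obtain C where C: "C \<ge> 0" "\<And>s. \<bar>deriv H s\<bar> \<le> C" "\<And>s. \<bar>s\<bar> > 1 \<Longrightarrow> deriv H s = 0"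
    using bounded_deriv_smooth_step[OF H(1,3,4)] by metis
  have "c' \<le> integral\<^sup>L \<mu> ?L" if c': "c' < rate" for c'
  proof -
    obtain M where M: "\<And>z. \<bar>potential c' z\<bar> \<le> M" using potential_bounded[OF c'] by metis
    have M0: "M \<ge> 0" using M[of 0] by linarith
    \<comment> \<open>The \<open>|v|\<^sup>\<alpha>\<close> term pays for the region where the cutoff is not one, the factor \<open>4 M C\<close> for its gradient.\<close>
    let ?Q = "\<lambda>q. (2 + \<bar>c'\<bar> * norm (?v q) powr \<alpha>) + (1 + 4 * M * C) * norm (?w q)"
    have iQ: "integrable \<mu> ?Q" using iv iw by simp
    have R: "c' \<le> integral\<^sup>L \<mu> ?L + integral\<^sup>L \<mu> ?Q / R" if R: "R \<ge> 1" for R :: real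
    proof -
      obtain U where U: "smooth U" "\<And>z. \<bar>U z\<bar> \<le> M"
        "\<And>n x v. (\<And>i. n $ i \<in> \<int>) \<Longrightarrow> U (x + n, v) = U (x, v)"
        "\<And>x v w. norm v \<le> 2 * R \<Longrightarrow> c' \<le> grad U (x, v) \<bullet> (v, w) + (norm w + 1 / R)\<^sup>2 / 2 + lift F (x, v) + 1 / R"
        using mollified_subsolution[OF c' M, of "1 / R" "2 * R"] R by auto
      define \<phi> where "\<phi> = (\<lambda>(\<xi>, v). U (rep_torus \<xi>, v) * (1 - H ((1 / R\<^sup>2) * (v \<bullet> v) - 2)))"
      have R0: "R > 0" using R by simp
      have sides: "\<forall>s\<le>-1. H s = 0" "\<forall>s\<ge>1. H s = 1"
        "\<forall>n x v. (\<forall>i. n $ i \<in> \<int>) \<longrightarrow> U (x + n, v) = U (x, v)"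
        using H(3,4) U(3) by blast+
      note \<phi> = truncated_test_function[OF H(1) sides(1,2) U(1) sides(3) R0, folded \<phi>_def]
      obtain G where G: "\<And>y v. norm (grad (lift \<phi>) (y, v)) \<le> G" using \<phi>(5) by blast
      have G0: "G \<ge> 0" using G[of 0 0] norm_ge_zero order.trans by blast
      have ig: "integrable \<mu> (generator \<phi>)"
      proof (rule dom[of _ "G * (2 * R + 1)", OF continuous_generator[OF \<phi>(2)]])
        fix q :: "'d torus \<times> (real^'d) \<times> (real^'d)"
        obtain y v w where q: "q = (torus_of y, v, w)"
          by (metis prod.collapse torus_of_rep_torus)
        have "\<bar>grad (lift \<phi>) (y, v) \<bullet> (v, w)\<bar> \<le> G * (2 * R + norm w)"
        proof (cases "norm v > 2 * R")
          case True
          then show ?thesis using \<phi>(4)[of v y] G0 R0 by simp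
        next
          case False
          have "\<bar>grad (lift \<phi>) (y, v) \<bullet> (v, w)\<bar> \<le> norm (grad (lift \<phi>) (y, v)) * norm (v, w)"
            by (rule Cauchy_Schwarz_ineq2)
          also have "\<dots> \<le> G * (2 * R + norm w)"
            using norm_Pair_le[of v w] False by (intro mult_mono G G0) auto
          finally show ?thesis .
        qed
        also have "\<dots> \<le> G * ((2 * R + 1) * (1 + ((norm w)\<^sup>2 + norm v powr \<alpha>)))"
        proof (intro mult_left_mono G0)
          have "2 * R + norm w \<le> (2 * R + 1) + (norm w)\<^sup>2" using le_one_plus_square[of "norm w"] by simp
          moreover have "0 \<le> 2 * R * ((norm w)\<^sup>2 + norm v powr \<alpha>)" "0 \<le> norm v powr \<alpha>" using R0 by simp_all
          moreover have "(2 * R + 1) * (1 + ((norm w)\<^sup>2 + norm v powr \<alpha>))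
              = 2 * R + 1 + 2 * R * ((norm w)\<^sup>2 + norm v powr \<alpha>) + ((norm w)\<^sup>2 + norm v powr \<alpha>)"
            by (simp add: algebra_simps)
          ultimately show "2 * R + norm w \<le> (2 * R + 1) * (1 + ((norm w)\<^sup>2 + norm v powr \<alpha>))"
            by linarith
        qed
        finally show "\<bar>generator \<phi> q\<bar> \<le> G * (2 * R + 1) * (1 + ?m q)"
          by (simp add: q generator_torus_of[OF \<phi>(2)] mult.assoc)
      qed
      have pt: "c' \<le> generator \<phi> q + ?L q + ?Q q / R" for q
      proof -
        obtain y v w where q: "q = (torus_of y, v, w)"
          by (metis prod.collapse torus_of_rep_torus)
        let ?s = "(1 / R\<^sup>2) * (v \<bullet> v) - 2"
        let ?k = "1 - H ?s"
        let ?N = "norm v powr \<alpha>"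
        have f0: "lift F (y, v) \<ge> 0" by (rule nonneg)
        have k: "0 \<le> ?k" "?k \<le> 1" using H01 by (auto simp: algebra_simps)
        have kN: "1 - ?k \<le> ?N / R"
        proof (cases "norm v \<le> R")
          case True
          then have "(norm v)\<^sup>2 \<le> R\<^sup>2" by (intro power_mono) auto
          then have "?s \<le> -1" using R0 by (simp add: power2_norm_eq_inner field_simps)
          then show ?thesis using H(3) R0 by simp
        next
          case False
          then have "norm v powr 1 \<le> norm v powr \<alpha>" using \<alpha> R by (intro powr_mono) auto
          then have "R \<le> ?N" using False R by simp
          then have "1 \<le> ?N / R" using R0 by simp
          then show ?thesis using k by linarith
        qed
        have c'k: "c' \<le> ?k * c' + \<bar>c'\<bar> * ?N / R"
        proof -
          have "c' - ?k * c' = (1 - ?k) * c'" by (simp add: algebra_simps)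
          also have "\<dots> \<le> (1 - ?k) * \<bar>c'\<bar>" using k by (intro mult_left_mono) auto
          also have "\<dots> \<le> (?N / R) * \<bar>c'\<bar>" using kN by (intro mult_right_mono) auto
          finally show ?thesis by (simp add: mult.commute)
        qed
        have main: "?k * c' \<le> grad (lift \<phi>) (y, v) \<bullet> (v, w) + ((norm w)\<^sup>2 / 2 + lift F (y, v))
            + (2 + (1 + 4 * M * C) * norm w) / R"
        proof (cases "norm v > 2 * R")
          case True
          have "1 < ?s"
          proof -
            have "(2 * R)\<^sup>2 \<le> (norm v)\<^sup>2" using True R0 by (intro power_mono) auto
            then have "4 * R\<^sup>2 \<le> v \<bullet> v" by (simp add: power2_norm_eq_inner power_mult_distrib)
            then have "(1 / R\<^sup>2) * (4 * R\<^sup>2) \<le> (1 / R\<^sup>2) * (v \<bullet> v)" by (intro mult_left_mono) auto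
            moreover have "(1 / R\<^sup>2) * (4 * R\<^sup>2) = 4" using R0 by simp
            ultimately show ?thesis by linarith
          qed
          then have "?k = 0" using H(4) by simp
          moreover have "0 \<le> (2 + (1 + 4 * M * C) * norm w) / R" using M0 C(1) R0 by simp
          ultimately show ?thesis using \<phi>(4)[OF True, of y] f0 by (simp only: inner_zero_left) simp
        next
          case False
          let ?E = "(norm w + 1 / R)\<^sup>2 / 2 + lift F (y, v) + 1 / R"
          have "?k * c' \<le> ?k * (grad U (y, v) \<bullet> (v, w) + ?E)"
            using U(4)[of v y w] False k(1) by (intro mult_left_mono) auto
          also have "\<dots> = ?k * (grad U (y, v) \<bullet> (v, w)) + ?k * ?E" by (rule distrib_left)
          also have "?k * ?E \<le> 1 * ?E" using k f0 R0 by (intro mult_right_mono) auto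
          finally have 1: "?k * c' \<le> ?k * (grad U (y, v) \<bullet> (v, w)) + ?E" by simp
          have "\<bar>U (y, v) * (deriv H ?s * ((2 / R\<^sup>2) * (v \<bullet> w)))\<bar> \<le> M * (C * ((2 / R\<^sup>2) * (2 * R * norm w)))"
          proof -
            have "\<bar>v \<bullet> w\<bar> \<le> 2 * R * norm w"
              using Cauchy_Schwarz_ineq2[of v w] mult_right_mono[of "norm v" "2 * R" "norm w"] False by simp
            then have "\<bar>(2 / R\<^sup>2) * (v \<bullet> w)\<bar> \<le> (2 / R\<^sup>2) * (2 * R * norm w)"
              unfolding abs_mult using R0 by (intro mult_mono) auto
            then show ?thesis unfolding abs_mult[of "U _"] abs_mult[of "deriv H _"]
              using U(2) C M0 by (intro mult_mono) auto
          qed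
          also have "\<dots> = 4 * M * C * norm w / R" using R0 by (simp add: power2_eq_square)
          finally have 2: "\<bar>U (y, v) * (deriv H ?s * ((2 / R\<^sup>2) * (v \<bullet> w)))\<bar> \<le> 4 * M * C * norm w / R" .
          have 3: "(norm w + 1 / R)\<^sup>2 / 2 \<le> (norm w)\<^sup>2 / 2 + norm w / R + 1 / R"
          proof -
            have "(1 / R)\<^sup>2 \<le> 1 / R"
              using R R0 by (simp add: power2_eq_square field_simps)
            moreover have "(norm w + 1 / R)\<^sup>2 = (norm w)\<^sup>2 + 2 * (norm w / R) + (1 / R)\<^sup>2"
              by (simp add: power2_sum)
            moreover have "0 \<le> 1 / R" using R0 by simp
            ultimately show ?thesis by linarith
          qed
          have "(2 + (1 + 4 * M * C) * norm w) / R = 1 / R + 1 / R + norm w / R + 4 * M * C * norm w / R"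
            by (simp add: add_divide_distrib distrib_right)
          then show ?thesis using 1 2 3 unfolding \<phi>(3) by linarith
        qed
        have "?Q q / R = \<bar>c'\<bar> * ?N / R + (2 + (1 + 4 * M * C) * norm w) / R"
          by (simp add: q add_divide_distrib)
        then show ?thesis using main c'k
          by (simp add: q generator_torus_of[OF \<phi>(2)] lift_def)
      qed
      have iQR: "integrable \<mu> (\<lambda>q. ?Q q / R)" by (rule integrable_divide_zero) (rule iQ)
      have all: "integrable \<mu> (\<lambda>q. generator \<phi> q + ?L q + ?Q q / R)"
        by (rule Bochner_Integration.integrable_add[OF Bochner_Integration.integrable_add[OF ig iL] iQR])
      have "c' = (\<integral>q. c' \<partial>\<mu>)" by (simp add: prob_space)
      also have "\<dots> \<le> (\<integral>q. generator \<phi> q + ?L q + ?Q q / R \<partial>\<mu>)"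
        by (rule integral_mono[OF _ all pt]) simp
      also have "\<dots> = integral\<^sup>L \<mu> (generator \<phi>) + integral\<^sup>L \<mu> ?L + integral\<^sup>L \<mu> ?Q / R"
        unfolding Bochner_Integration.integral_add[OF Bochner_Integration.integrable_add[OF ig iL] iQR]
          Bochner_Integration.integral_add[OF ig iL] by simp
      also have "integral\<^sup>L \<mu> (generator \<phi>) = 0" using vanish[OF \<phi>(1)] by (simp add: generator_def)
      finally show ?thesis by simp
    qed
    have "((\<lambda>R. integral\<^sup>L \<mu> ?L + integral\<^sup>L \<mu> ?Q / R) \<longlongrightarrow> integral\<^sup>L \<mu> ?L + 0) at_top"
      by (intro tendsto_add tendsto_const tendsto_divide_0[OF tendsto_const] filterlim_at_top_imp_at_infinity filterlim_ident)
    then have "c' \<le> integral\<^sup>L \<mu> ?L + 0"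
    proof (rule tendsto_lowerbound)
      show "\<forall>\<^sub>F R in at_top. c' \<le> integral\<^sup>L \<mu> ?L + integral\<^sup>L \<mu> ?Q / R"
        using eventually_ge_at_top[of "1::real"] by eventually_elim (rule R)
    qed simp
    then show ?thesis by simp
  qed
  then show ?thesis by (rule dense_le)
qed

section \<open>The limit of the averaged value function\<close>

theorem theorem2p2:
  fixes F :: "'d::finite torus \<times> (real^'d) \<Rightarrow> real" and \<alpha> c\<^sub>F :: real
  assumes "continuous_on UNIV F"
    and "\<alpha> > 1" and "c\<^sub>F \<ge> 1"
    and "\<forall>x v. (1 / c\<^sub>F) * norm v powr \<alpha> - c\<^sub>F \<le> F (x, v) \<and> F (x, v) \<le> c\<^sub>F * (1 + norm v powr \<alpha>)"
    and "\<forall>x v. F (x, v) \<ge> 0"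
  shows "\<exists>c::real.
      (\<forall>x v. ((\<lambda>T. ereal (1 / T) * value_fun F T x v) \<longlongrightarrow> ereal c) at_top
           \<and> ((\<lambda>T. INF \<gamma>\<in>C1_curves_from x v. ereal (1 / T) * action F T \<gamma>) \<longlongrightarrow> ereal c) at_top)
    \<and> ((\<exists>C\<^sub>F\<ge>0. \<forall>x v. (\<exists>g. has_Dx F x v g) \<and> (\<exists>g. has_Dv F x v g)
             \<and> norm (Dx F x v) + norm (Dv F x v) \<le> C\<^sub>F * (1 + norm v powr \<alpha>))
        \<longrightarrow> ereal c = (INF \<mu>\<in>closed_measures \<alpha>.
              ereal (\<integral>(x, v, w). (norm w)\<^sup>2 / 2 + F (x, v) \<partial>\<mu>)))"
proof -
  have pl: "periodic_lagrangian (lift F) \<alpha> c\<^sub>F"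
  proof
    show "continuous_on UNIV (lift F)" by (rule continuous_lift[OF assms(1)])
    show "lift F (x + n, v) = lift F (x, v)" if "\<And>i. n $ i \<in> \<int>" for n x v
      by (simp add: lift_def torus_of_translate[OF that])
  qed (use assms in \<open>auto simp: lift_def\<close>)
  interpret periodic_lagrangian "lift F" \<alpha> c\<^sub>F by (rule pl)
  have inf: "(INF \<gamma>\<in>C1_curves_from x v. ereal k * action F T \<gamma>) = ereal (k * min_cost (lift F) T (rep_torus x, v))"
    if "0 < T" "0 < k" for T k x v
    using INF_action_eq_min_cost[OF assms(1) _ that, of "rep_torus x" v] assms(5) by simp
  have lim: "((\<lambda>T. ereal (min_cost (lift F) T (rep_torus x, v) / T)) \<longlongrightarrow> ereal rate) at_top" for x v
    by (intro tendsto_intros min_cost_limit)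
  have lim1: "((\<lambda>T. ereal (1 / T) * value_fun F T x v) \<longlongrightarrow> ereal rate) at_top" for x v
  proof (rule Lim_transform_eventually[OF lim])
    show "\<forall>\<^sub>F T in at_top. ereal (min_cost (lift F) T (rep_torus x, v) / T) = ereal (1 / T) * value_fun F T x v"
      using eventually_gt_at_top[of 0]
    proof eventually_elim
      case (elim T)
      have "value_fun F T x v = ereal (min_cost (lift F) T (rep_torus x, v))"
        using inf[OF elim, of 1 x v] by (simp add: value_fun_def one_ereal_def[symmetric])
      then show ?case by simp
    qed
  qed
  have lim2: "((\<lambda>T. INF \<gamma>\<in>C1_curves_from x v. ereal (1 / T) * action F T \<gamma>) \<longlongrightarrow> ereal rate) at_top" for x v
  proof (rule Lim_transform_eventually[OF lim])
    show "\<forall>\<^sub>F T in at_top. ereal (min_cost (lift F) T (rep_torus x, v) / T)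
        = (INF \<gamma>\<in>C1_curves_from x v. ereal (1 / T) * action F T \<gamma>)"
      using eventually_gt_at_top[of 0]
    proof eventually_elim
      case (elim T)
      then show ?case using inf[OF elim, of "1 / T" x v] by simp
    qed
  qed
  have "ereal rate = (INF \<mu>\<in>closed_measures \<alpha>. ereal (\<integral>(x, v, w). (norm w)\<^sup>2 / 2 + F (x, v) \<partial>\<mu>))"
  proof (rule antisym)
    show "ereal rate \<le> (INF \<mu>\<in>closed_measures \<alpha>. ereal (\<integral>(x, v, w). (norm w)\<^sup>2 / 2 + F (x, v) \<partial>\<mu>))"
      by (rule INF_greatest) (use rate_le_closed_measure[OF assms(1) pl] in simp)
    show "(INF \<mu>\<in>closed_measures \<alpha>. ereal (\<integral>(x, v, w). (norm w)\<^sup>2 / 2 + F (x, v) \<partial>\<mu>)) \<le> ereal rate"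
    proof (rule ereal_le_epsilon2)
      fix e :: real assume e: "e > 0"
      obtain P x v w n where p: "P > 0" "traj P x v w" "\<And>i. n $ i \<in> \<int>" "x P = x 0 + n" "v P = v 0"
        "cost (lift F) P x v w \<le> (rate + e) * P" using near_optimal_periodic_traj[OF e] by blast
      have "torus_of (x P) = torus_of (x 0)" using p(4) torus_of_translate[OF p(3)] by simp
      note \<mu> = periodic_traj_closed_measure[OF assms(1) _ p(1,2) this p(5), of \<alpha>]
      have "cost (lift F) P x v w / P \<le> rate + e" using p(1,6) by (simp add: pos_divide_le_eq)
      then show "(INF \<mu>\<in>closed_measures \<alpha>. ereal (\<integral>(x, v, w). (norm w)\<^sup>2 / 2 + F (x, v) \<partial>\<mu>)) \<le> ereal rate + ereal e"
        using \<mu> assms(2) by (intro INF_lower2[OF \<mu>(1)]) auto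
    qed
  qed
  then show ?thesis using lim1 lim2 by blast
qed

end
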